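(* Let $q$ be an even prime power and $m\ge1$, and let the $P$-numbers $P_i(k)$ of the association scheme of quadratic forms $\mathscr Q(m,q)$ and the numbers $F^{(M)}_r(s)$ be as in the context. Then $P_{(0,1)}(k)=1$ for every $k\in I$ with $\mathscr S_k\ne\emptyset$, and $P_i(0,1)=v_i:=\lvert\mathscr Q_i\rvert$ for every $i\in I$. Moreover, for all integers $r,s$ and $\epsilon,\tau\in\{1,-1\}$, where $s\ge0$ in an index $2s+1$, $s\ge1$ in an index $(2s,\tau)$, $r\ge0$ in an argument $2r+1$ and $r\ge1$ in an argument $(2r,\epsilon)$ (and the argument class $\mathscr S_{2r+1}$, resp. $\mathscr S_{2r,\epsilon}$, is nonempty): \begin{align*} P_{2s+1}(2r+1)&=-q^{2s}F^{(m-1)}_s(r),\\ 2P_{2s,\tau}(2r+1)&=q^{2s}F^{(m-1)}_s(r)+\tau\, q^s F^{(m)}_s(r),\\ 2P_{2s,\tau}(2r,1)&=q^s(q^s+\tau)F^{(m)}_s(r),\\ 2P_{2s,\tau}(2r,-1)&=q^{2s}F^{(m-1)}_s(r-1)+\tau\,q^sF^{(m)}_s(r),\\ P_{2s+1}(2r,1)&=(q^m-q^{2s})F^{(m)}_s(r),\\ P_{2s+1}(2r,-1)&=-q^{2s}F^{(m-1)}_s(r-1). \end{align*}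
   Context: Let $q$ be a prime power, $m\ge1$, and $V$ an $m$-dimensional $\mathbb F_q$-vector space. $\mathscr Q(m,q)$ is the set of quadratic forms on $V$ and $\mathscr S(m,q)$ the set of symmetric bilinear forms on $V$. The rank of $S\in\mathscr S(m,q)$ is the codimension of $\{x\in V:S(x,y)=0\ \forall y\in V\}$. For $Q\in\mathscr Q(m,q)$ let $S_Q(x,y)=Q(x+y)-Q(x)-Q(y)$; the radical of $Q$ is $\{x: S_Q(x,y)=0\ \forall y,\ Q(x)=0\}$ and the rank of $Q$ is its codimension. Quadratic forms $Q,Q'$ are equivalent if $Q'(x)=aQ(Lx)$ for some $a\in\mathbb F_q^*$, $L\in GL(V)$; symmetric bilinear forms $S,S'$ are equivalent if $S'(x,y)=aS(Lx,Ly)$ for such $a,L$. Since $q$ is even, fix $\lambda\in\mathbb F_q$ of absolute trace $1$. A quadratic form of rank $2s\ge2$ has type $1$ (hyperbolic) if it is equivalent to the form given in coordinates of some basis by $\sum_{i=1}^s x_{2i-1}x_{2i}$, and type $-1$ (elliptic) if equivalent to $\sum_{i=1}^{s-1}x_{2i-1}x_{2i}+x_{2s-1}^2+x_{2s-1}x_{2s}+\lambda x_{2s}^2$; each such form has exactly one type. A symmetric bilinear form of rank $2s\ge2$ has type $1$ if equivalent to $\sum_{i=1}^s(x_{2i-1}y_{2i}+x_{2i}y_{2i-1})$ and type $-1$ if equivalent to $\sum_{i=1}^{s-1}(x_{2i-1}y_{2i}+x_{2i}y_{2i-1})+x_{2s-1}y_{2s}+x_{2s}y_{2s-1}+x_{2s}y_{2s}$;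 each has exactly one type. Zero forms have rank $0$ and type $1$. Let $I=\{2s+1:s\in\mathbb Z\}\cup\{(2s,\tau):s\in\mathbb Z,\tau=\pm1\}$. For $i=2s+1$, $\mathscr Q_i$ (resp. $\mathscr S_i$) is the set of quadratic (resp. symmetric bilinear) forms of rank $2s+1$; for $i=(2s,\tau)$ the set of those of rank $2s$ and type $\tau$ (possibly empty). Pairing: fix a nontrivial character $\chi$ of $(\mathbb F_q,+)$ and bases $(u_1,\dots,u_m)$, $(w_1,\dots,w_m)$ of $V$. For $Q$ pick $A\in\mathbb F_q^{m\times m}$ with $Q(\sum_i x_iu_i)=\sum_{i,j}A_{ij}x_ix_j$ (unique modulo alternating matrices); for $S$ let $B_{ij}=S(w_i,w_j)$; set $\langle Q,S\rangle=\chi(\operatorname{tr}(AB))$. For $i,k\in I$ with $\mathscr S_k\ne\emptyset$, $P_i(k)=\sum_{Q\in\mathscr Q_i}\langle Q,S\rangle$ for any $S\in\mathscr S_k$ (independent of the choice; $0$ if $\mathscr Q_i=\emptyset$). Numbers: ${a\brack b}=\prod_{i=0}^{b-1}\frac{q^{2a}-q^{2i}}{q^{2b}-q^{2i}}$ for integers $a$ and $b\ge0$. For an integer $M\ge0$ let $n=\lfloor M/2\rfloor$ and (if $n\ge1$) $c=q^{M(M-1)/(2n)}$; for integers $0\le r,s\le n$ put $F^{(M)}_r(s)=\sum_{j=0}^r(-1)^{r-j}q^{(r-j)(r-j-1)}{n-j\brack n-r}{n-s\brack j}c^j$ (so $F^{(M)}_0(0)=1$ when $n=0$), and $F^{(M)}_r(s)=0$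 for all other integers $r,s$ and for $M<0$. *)

theory Defs
  imports Complex_Main "HOL-Library.Cardinality" "HOL-Computational_Algebra.Primes"
begin

section \<open>Finite-dimensional vector spaces over a finite field\<close>

text \<open>
  The vector space \<open>V\<close> is a whole type \<open>'v\<close> with a scalar multiplication \<open>scale\<close> satisfying
  \<open>vector_space scale\<close>.  The library's \<open>dim\<close> is 0 on infinite-dimensional spaces, so a hypothesis
  \<open>vdim scale = m\<close> with \<open>m \<ge> 1\<close> includes finite-dimensionality.
\<close>

definition vdim :: "('a::field \<Rightarrow> 'v::ab_group_add \<Rightarrow> 'v) \<Rightarrow> nat" where
  "vdim scale = vector_space.dim scale UNIV"

text \<open>Ordered bases are indexed by \<open>1, \<dots>, m\<close>; values at other indices are irrelevant.\<close>

definition is_basis :: "('a::field \<Rightarrow> 'v::ab_group_add \<Rightarrow> 'v) \<Rightarrow> (nat \<Rightarrow> 'v) \<Rightarrow> bool" where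
  "is_basis scale b \<longleftrightarrow>
     inj_on b {1..vdim scale} \<and>
     \<not> module.dependent scale (b ` {1..vdim scale}) \<and>
     module.span scale (b ` {1..vdim scale}) = UNIV"

definition coords ::
  "('a::field \<Rightarrow> 'v::ab_group_add \<Rightarrow> 'v) \<Rightarrow> (nat \<Rightarrow> 'v) \<Rightarrow> 'v \<Rightarrow> nat \<Rightarrow> 'a" where
  "coords scale b v i = module.representation scale (b ` {1..vdim scale}) v (b i)"

definition GL :: "('a::field \<Rightarrow> 'v::ab_group_add \<Rightarrow> 'v) \<Rightarrow> ('v \<Rightarrow> 'v) set" where
  "GL scale = {L. Vector_Spaces.linear scale scale L \<and> bij L}"

text \<open>If \<open>q = p ^ e\<close> with \<open>p\<close> prime, this is \<open>x + x ^ p + \<dots> + x ^ (p ^ (e - 1))\<close>.\<close>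

definition absolute_trace :: "'a::finite_field \<Rightarrow> 'a" where
  "absolute_trace x = (\<Sum>i<multiplicity CHAR('a) CARD('a). x ^ (CHAR('a) ^ i))"

definition nontrivial_additive_character :: "('a::ab_group_add \<Rightarrow> complex) \<Rightarrow> bool" where
  "nontrivial_additive_character \<chi> \<longleftrightarrow>
     \<chi> 0 = 1 \<and> (\<forall>x y. \<chi> (x + y) = \<chi> x * \<chi> y) \<and> (\<exists>x. \<chi> x \<noteq> 1)"


section \<open>Symmetric bilinear forms and quadratic forms\<close>

definition symmetric_bilinear_forms ::
  "('a::field \<Rightarrow> 'v::ab_group_add \<Rightarrow> 'v) \<Rightarrow> ('v \<Rightarrow> 'v \<Rightarrow> 'a) set" where
  "symmetric_bilinear_forms scale =
     {S. (\<forall>x y. S x y = S y x) \<and>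
         (\<forall>y. Vector_Spaces.linear scale (*) (\<lambda>x. S x y)) \<and>
         (\<forall>x. Vector_Spaces.linear scale (*) (\<lambda>y. S x y))}"

definition polar :: "('v::ab_group_add \<Rightarrow> 'a::field) \<Rightarrow> 'v \<Rightarrow> 'v \<Rightarrow> 'a" where
  "polar Q x y = Q (x + y) - Q x - Q y"

definition quadratic_forms ::
  "('a::field \<Rightarrow> 'v::ab_group_add \<Rightarrow> 'v) \<Rightarrow> ('v \<Rightarrow> 'a) set" where
  "quadratic_forms scale =
     {Q. (\<forall>c x. Q (scale c x) = c\<^sup>2 * Q x) \<and> polar Q \<in> symmetric_bilinear_forms scale}"

definition quad_rank :: "('a::field \<Rightarrow> 'v::ab_group_add \<Rightarrow> 'v) \<Rightarrow> ('v \<Rightarrow> 'a) \<Rightarrow> nat" where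
  "quad_rank scale Q =
     vdim scale - vector_space.dim scale {x. (\<forall>y. polar Q x y = 0) \<and> Q x = 0}"

definition sym_rank :: "('a::field \<Rightarrow> 'v::ab_group_add \<Rightarrow> 'v) \<Rightarrow> ('v \<Rightarrow> 'v \<Rightarrow> 'a) \<Rightarrow> nat" where
  "sym_rank scale S = vdim scale - vector_space.dim scale {x. \<forall>y. S x y = 0}"

definition quad_equivalent ::
  "('a::field \<Rightarrow> 'v::ab_group_add \<Rightarrow> 'v) \<Rightarrow> ('v \<Rightarrow> 'a) \<Rightarrow> ('v \<Rightarrow> 'a) \<Rightarrow> bool" where
  "quad_equivalent scale Q Q' \<longleftrightarrow>
     (\<exists>a L. a \<noteq> 0 \<and> L \<in> GL scale \<and> (\<forall>x. Q' x = a * Q (L x)))"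

definition sym_equivalent ::
  "('a::field \<Rightarrow> 'v::ab_group_add \<Rightarrow> 'v) \<Rightarrow> ('v \<Rightarrow> 'v \<Rightarrow> 'a) \<Rightarrow> ('v \<Rightarrow> 'v \<Rightarrow> 'a) \<Rightarrow> bool" where
  "sym_equivalent scale S S' \<longleftrightarrow>
     (\<exists>a L. a \<noteq> 0 \<and> L \<in> GL scale \<and> (\<forall>x y. S' x y = a * S (L x) (L y)))"


subsection \<open>Types of forms of even rank (even characteristic)\<close>

definition hyperbolic_quad :: "nat \<Rightarrow> (nat \<Rightarrow> 'a::field) \<Rightarrow> 'a" where
  "hyperbolic_quad s x = (\<Sum>i=1..s. x (2*i - 1) * x (2*i))"

definition elliptic_quad :: "'a::field \<Rightarrow> nat \<Rightarrow> (nat \<Rightarrow> 'a) \<Rightarrow> 'a" where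
  "elliptic_quad lam s x =
     (\<Sum>i=1..s - 1. x (2*i - 1) * x (2*i)) +
     (x (2*s - 1))\<^sup>2 + x (2*s - 1) * x (2*s) + lam * (x (2*s))\<^sup>2"

definition plus_sym :: "nat \<Rightarrow> (nat \<Rightarrow> 'a::field) \<Rightarrow> (nat \<Rightarrow> 'a) \<Rightarrow> 'a" where
  "plus_sym s x y = (\<Sum>i=1..s. x (2*i - 1) * y (2*i) + x (2*i) * y (2*i - 1))"

definition minus_sym :: "nat \<Rightarrow> (nat \<Rightarrow> 'a::field) \<Rightarrow> (nat \<Rightarrow> 'a) \<Rightarrow> 'a" where
  "minus_sym s x y =
     (\<Sum>i=1..s - 1. x (2*i - 1) * y (2*i) + x (2*i) * y (2*i - 1)) +
     x (2*s - 1) * y (2*s) + x (2*s) * y (2*s - 1) + x (2*s) * y (2*s)"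

definition quad_has_type ::
  "('a::field \<Rightarrow> 'v::ab_group_add \<Rightarrow> 'v) \<Rightarrow> 'a \<Rightarrow> ('v \<Rightarrow> 'a) \<Rightarrow> int \<Rightarrow> bool" where
  "quad_has_type scale lam Q \<tau> \<longleftrightarrow>
     (Q = (\<lambda>x. 0) \<and> \<tau> = 1) \<or>
     (\<exists>s\<ge>1. quad_rank scale Q = 2*s \<and>
        (\<exists>b. is_basis scale b \<and>
           (\<tau> = 1 \<and> quad_equivalent scale Q (\<lambda>v. hyperbolic_quad s (coords scale b v)) \<or>
            \<tau> = -1 \<and> quad_equivalent scale Q (\<lambda>v. elliptic_quad lam s (coords scale b v)))))"

definition sym_has_type ::
  "('a::field \<Rightarrow> 'v::ab_group_add \<Rightarrow> 'v) \<Rightarrow> ('v \<Rightarrow> 'v \<Rightarrow> 'a) \<Rightarrow> int \<Rightarrow> bool" where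
  "sym_has_type scale S \<tau> \<longleftrightarrow>
     (S = (\<lambda>x y. 0) \<and> \<tau> = 1) \<or>
     (\<exists>s\<ge>1. sym_rank scale S = 2*s \<and>
        (\<exists>b. is_basis scale b \<and>
           (\<tau> = 1 \<and> sym_equivalent scale S
              (\<lambda>v v'. plus_sym s (coords scale b v) (coords scale b v')) \<or>
            \<tau> = -1 \<and> sym_equivalent scale S
              (\<lambda>v v'. minus_sym s (coords scale b v) (coords scale b v')))))"


section \<open>Classes and \<open>P\<close>-numbers\<close>

text \<open>\<open>Odd_Idx s\<close> stands for the index \<open>2 s + 1\<close> and \<open>Even_Idx s \<tau>\<close> for the index \<open>(2 s, \<tau>)\<close>.\<close>

datatype form_index = Odd_Idx int | Even_Idx int int

definition form_indices :: "form_index set" where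
  "form_indices = range Odd_Idx \<union> {Even_Idx s \<tau> | s \<tau>. \<tau> \<in> {1, -1}}"

fun quad_class ::
  "('a::field \<Rightarrow> 'v::ab_group_add \<Rightarrow> 'v) \<Rightarrow> 'a \<Rightarrow> form_index \<Rightarrow> ('v \<Rightarrow> 'a) set" where
  "quad_class scale lam (Odd_Idx s) =
     {Q \<in> quadratic_forms scale. int (quad_rank scale Q) = 2*s + 1}"
| "quad_class scale lam (Even_Idx s \<tau>) =
     {Q \<in> quadratic_forms scale. int (quad_rank scale Q) = 2*s \<and> quad_has_type scale lam Q \<tau>}"

fun sym_class ::
  "('a::field \<Rightarrow> 'v::ab_group_add \<Rightarrow> 'v) \<Rightarrow> form_index \<Rightarrow> ('v \<Rightarrow> 'v \<Rightarrow> 'a) set" where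
  "sym_class scale (Odd_Idx s) =
     {S \<in> symmetric_bilinear_forms scale. int (sym_rank scale S) = 2*s + 1}"
| "sym_class scale (Even_Idx s \<tau>) =
     {S \<in> symmetric_bilinear_forms scale. int (sym_rank scale S) = 2*s \<and> sym_has_type scale S \<tau>}"

text \<open>
  \<open>m \<times> m\<close> matrices are functions on \<open>{1..m} \<times> {1..m}\<close>.  The coefficient matrix of a quadratic form
  is only determined modulo alternating matrices, hence the choice operator.
\<close>

definition coefficient_matrix ::
  "('a::field \<Rightarrow> 'v::ab_group_add \<Rightarrow> 'v) \<Rightarrow> (nat \<Rightarrow> 'v) \<Rightarrow> ('v \<Rightarrow> 'a) \<Rightarrow> nat \<Rightarrow> nat \<Rightarrow> 'a" where
  "coefficient_matrix scale u Q =
     (SOME A. \<forall>x. Q (\<Sum>i=1..vdim scale. scale (x i) (u i)) =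
                  (\<Sum>i=1..vdim scale. \<Sum>j=1..vdim scale. A i j * x i * x j))"

text \<open>The argument of \<open>\<chi>\<close> is the trace of \<open>A B\<close>, where \<open>B\<close> is the matrix with entries \<open>S (w i) (w j)\<close>.\<close>

definition pairing ::
  "('a::field \<Rightarrow> 'v::ab_group_add \<Rightarrow> 'v) \<Rightarrow> ('a \<Rightarrow> complex) \<Rightarrow> (nat \<Rightarrow> 'v) \<Rightarrow> (nat \<Rightarrow> 'v) \<Rightarrow>
     ('v \<Rightarrow> 'a) \<Rightarrow> ('v \<Rightarrow> 'v \<Rightarrow> 'a) \<Rightarrow> complex" where
  "pairing scale \<chi> u w Q S =
     \<chi> (\<Sum>i=1..vdim scale. \<Sum>j=1..vdim scale. coefficient_matrix scale u Q i j * S (w j) (w i))"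

text \<open>
  The common value of the character sum over all \<open>S\<close> in the class \<open>k\<close>; it is unspecified if the
  class \<open>k\<close> is empty.
\<close>

definition P_number ::
  "('a::field \<Rightarrow> 'v::ab_group_add \<Rightarrow> 'v) \<Rightarrow> 'a \<Rightarrow> ('a \<Rightarrow> complex) \<Rightarrow> (nat \<Rightarrow> 'v) \<Rightarrow> (nat \<Rightarrow> 'v) \<Rightarrow>
     form_index \<Rightarrow> form_index \<Rightarrow> complex" where
  "P_number scale lam \<chi> u w i k =
     (THE z. \<forall>S\<in>sym_class scale k. (\<Sum>Q\<in>quad_class scale lam i. pairing scale \<chi> u w Q S) = z)"


section \<open>The numbers \<open>F\<close>\<close>

definition gauss_binomial_sq :: "nat \<Rightarrow> int \<Rightarrow> nat \<Rightarrow> real" where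
  "gauss_binomial_sq q a b =
     (\<Prod>i<b. (real q powi (2*a) - real q ^ (2*i)) / (real q ^ (2*b) - real q ^ (2*i)))"

text \<open>For \<open>n = 0\<close> the base \<open>c\<close> is only used in \<open>c ^ 0\<close>.\<close>

definition F_number :: "nat \<Rightarrow> int \<Rightarrow> int \<Rightarrow> int \<Rightarrow> real" where
  "F_number q M r s =
     (let n = M div 2;
          c = real q powr (real_of_int (M * (M - 1)) / real_of_int (2 * n))
      in if M \<ge> 0 \<and> r \<in> {0..n} \<and> s \<in> {0..n}
         then \<Sum>j\<in>{0..r}. (-1) ^ nat (r - j) * real q ^ nat ((r - j) * (r - j - 1)) *
                gauss_binomial_sq q (n - j) (nat (n - r)) * gauss_binomial_sq q (n - s) (nat j) *
                c ^ nat j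
         else 0)"

end

theory Submission
  imports Defs "HOL-Library.FuncSet"
begin

text \<open>
  In a suitable basis of \<open>V\<close> the pairing with a symmetric form \<open>S\<close> of rank \<open>2 r\<close> or \<open>2 r + 1\<close> becomes
  \<open>Q \<mapsto> \<chi> (B\<^sub>1\<^sub>2 + B\<^sub>3\<^sub>4 + \<dots> + B\<^sub>2\<^sub>r\<^sub>-\<^sub>1\<^sub>,\<^sub>2\<^sub>r + Q z)\<close>, where \<open>B\<close> is the matrix of the polarization of \<open>Q\<close> and \<open>z\<close> is \<open>0\<close>
  if \<open>S\<close> is alternating, the basis vector with index \<open>2 r\<close> if the type is \<open>-1\<close>, and the one with
  index \<open>2 r + 1\<close> if the rank is odd.  The quadratic forms with a given polarization \<open>B\<close> are a coset
  of the space of diagonals.  Over this coset, three sums are immediate by orthogonality of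
  characters: the sum over all forms (nonzero only for \<open>z = 0\<close>), the sum over the forms vanishing on
  the radical of \<open>B\<close> (nonzero only for \<open>z\<close> in the radical), and the sum weighted by the Gauss sum
  \<open>\<Sum>x. \<chi> (Q x)\<close>, which equals \<open>\<tau> q\<^sup>m\<^sup>-\<^sup>s\<close> on forms of rank \<open>2 s\<close> and type \<open>\<tau>\<close> and vanishes on forms of
  odd rank.  What remains are character sums over alternating matrices of rank \<open>2 s\<close>, on \<open>V\<close> or on
  \<open>V / z\<close>.  Splitting off a hyperbolic plane gives for them the recurrence in \<open>r\<close> that the numbers \<open>F\<close>
  satisfy by Pascal's rule; the initial values are the numbers of alternating matrices of given rank.
\<close>

section \<open>q-binomial coefficients and the numbers F\<close>

text \<open>Two indicators make the classes summable. On a coset of diagonals the indicator of type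
  \<tau> is half of \<open>1 + \<tau> * q^s * G / q^m\<close>, where G is the Gauss sum of the form,
  and the forms of odd rank are the complement of those vanishing on the radical. Hence every
  P-number combines two character sums over alternating matrices of rank 2s: one over all of them,
  which lives in dimension m, and one over those with \<open>z\<close> in the radical, which lives
  in dimension m-1. Passing to the quotient by \<open>z\<close> leaves all r pairs intact if
  \<open>z\<close> has index 2r+1, but destroys the last pair if \<open>z\<close> has index 2r; this
  is the shift from r to r-1 for type -1. The constant c comes from the number of alternating
  matrices: its exponent is the odd one of m-1 and m, so lowering m by two divides c by q^2 while n
  drops by one. That a form has only one type is read off from its Gauss sum, and the value is
  computed for each symmetric form of a class, which makes the P-number well defined.\<close>

definition qfall :: "real \<Rightarrow> nat \<Rightarrow> nat \<Rightarrow> real" where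
  "qfall Q a b = (\<Prod>i<b. Q ^ a - Q ^ i)"

text \<open>The Gaussian binomial coefficient as a quotient of counts: \<open>qfall Q a b\<close> is
  the number of linearly independent \<open>b\<close>-tuples in an \<open>a\<close>-dimensional
  space over a field with \<open>Q\<close> elements. For the numbers F the base is
  \<open>Q = q^2\<close>.\<close>

definition qbinom :: "real \<Rightarrow> nat \<Rightarrow> nat \<Rightarrow> real" where
  "qbinom Q a b = qfall Q a b / qfall Q b b"

lemma qfall_0 [simp]: "qfall Q a 0 = 1"
  by (simp add: qfall_def)

lemma qfall_Suc: "qfall Q a (Suc b) = qfall Q a b * (Q ^ a - Q ^ b)"
  by (simp add: qfall_def)

lemma qfall_eq_0: "a < b \<Longrightarrow> qfall Q a b = 0"
  unfolding qfall_def by (rule prod_zero) auto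

lemma qfall_Suc_Suc: "qfall Q (Suc a) (Suc b) = (Q ^ Suc a - 1) * Q ^ b * qfall Q a b"
proof -
  have "qfall Q (Suc a) (Suc b) = (Q ^ Suc a - 1) * (\<Prod>i<b. Q ^ Suc a - Q ^ Suc i)"
    unfolding qfall_def by (simp add: prod.lessThan_Suc_shift del: prod.lessThan_Suc)
  also have "(\<Prod>i<b. Q ^ Suc a - Q ^ Suc i) = (\<Prod>i<b. Q * (Q ^ a - Q ^ i))"
    by (intro prod.cong) (auto simp: algebra_simps)
  also have "\<dots> = Q ^ b * qfall Q a b"
    by (simp add: prod.distrib qfall_def)
  finally show ?thesis by simp
qed

text \<open>F with natural number arguments and base \<open>Q = q^2\<close>; the exponent
  (s-j)(s-j-1) of q is twice a binomial coefficient. The constant \<open>c\<close> is kept as a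
  parameter since the recurrence in \<open>r\<close> replaces it by \<open>c / Q\<close>.\<close>

definition altF :: "real \<Rightarrow> real \<Rightarrow> nat \<Rightarrow> nat \<Rightarrow> nat \<Rightarrow> real" where
  "altF Q c n s r = (\<Sum>j\<le>s. (-1) ^ (s - j) * Q ^ ((s - j) choose 2) *
      qbinom Q (n - j) (n - s) * qbinom Q (n - r) j * c ^ j)"

context
  fixes Q :: real
  assumes Q: "Q > 1"
begin

lemma qpow_neq_1: "Q * Q ^ n \<noteq> 1"
  using one_less_power[of Q "Suc n"] Q by simp

lemma qfall_nz: "b \<le> a \<Longrightarrow> qfall Q a b \<noteq> 0"
  unfolding qfall_def using Q by (auto simp: power_inject_exp)

lemma qbinom_0 [simp]: "qbinom Q a 0 = 1"
  by (simp add: qbinom_def)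

lemma qbinom_self [simp]: "qbinom Q a a = 1"
  using qfall_nz[of a a] by (simp add: qbinom_def)

lemma qbinom_eq_0: "a < b \<Longrightarrow> qbinom Q a b = 0"
  by (simp add: qbinom_def qfall_eq_0)

lemma qbinom_absorb: "qbinom Q (Suc a) (Suc b) * (Q ^ Suc b - 1) = (Q ^ Suc a - 1) * qbinom Q a b"
  unfolding qbinom_def qfall_Suc_Suc using qfall_nz[of b b] qpow_neq_1 Q
  by (simp add: field_simps)

text \<open>Multiplying by the nonzero factor \<open>Q ^ Suc b - 1\<close> reduces both sides to
  multiples of \<open>qbinom Q a b\<close>. This version of Pascal's rule serves the recurrence in
  \<open>r\<close>, its mirror image \<open>qbinom_pascal_left\<close> the q-binomial
  theorem.\<close>

lemma qbinom_pascal_right: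
  assumes "b \<le> a"
  shows "qbinom Q (Suc a) (Suc b) = qbinom Q a (Suc b) + Q ^ (a - b) * qbinom Q a b"
proof -
  have a: "Q ^ a = Q ^ b * Q ^ (a - b)"
    using assms by (simp flip: power_add)
  have 1: "qbinom Q a (Suc b) * (Q ^ Suc b - 1) = qbinom Q a b * (Q ^ (a - b) - 1)"
    unfolding qbinom_def qfall_Suc_Suc using qfall_nz[of b b] qpow_neq_1 Q
    by (simp add: field_simps qfall_Suc a)
  have "qbinom Q (Suc a) (Suc b) * (Q ^ Suc b - 1) =
      (qbinom Q a (Suc b) + Q ^ (a - b) * qbinom Q a b) * (Q ^ Suc b - 1)"
    unfolding qbinom_absorb distrib_right 1 by (simp add: a algebra_simps)
  then show ?thesis using qpow_neq_1[of b] by simp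
qed

lemma qbinom_pascal_left:
  "qbinom Q (Suc a) (Suc b) = Q ^ Suc b * qbinom Q a (Suc b) + qbinom Q a b"
proof (cases "b \<le> a")
  case True
  have a: "Q ^ a = Q ^ b * Q ^ (a - b)"
    using True by (simp flip: power_add)
  have 1: "qbinom Q a (Suc b) * (Q ^ Suc b - 1) = qbinom Q a b * (Q ^ (a - b) - 1)"
    unfolding qbinom_def qfall_Suc_Suc using qfall_nz[of b b] qpow_neq_1 Q
    by (simp add: field_simps qfall_Suc a)
  have "qbinom Q (Suc a) (Suc b) * (Q ^ Suc b - 1) =
      (Q ^ Suc b * qbinom Q a (Suc b) + qbinom Q a b) * (Q ^ Suc b - 1)"
    unfolding qbinom_absorb distrib_right mult.assoc 1 by (simp add: a algebra_simps)
  then show ?thesis using qpow_neq_1[of b] by simp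
qed (simp add: qbinom_eq_0)

text \<open>The two Pascal rules are exchanged by reflecting the lower index, so symmetry passes
  from \<open>a\<close> to \<open>Suc a\<close>.\<close>

lemma qbinom_symmetric: "b \<le> a \<Longrightarrow> qbinom Q a (a - b) = qbinom Q a b"
proof (induction a arbitrary: b)
  case (Suc a)
  show ?case
  proof (cases b)
    case (Suc b')
    then have b': "b' \<le> a" using Suc.prems by simp
    show ?thesis
    proof (cases "b' = a")
      case False
      then obtain k where k: "a = b' + Suc k"
        using b' less_imp_Suc_add[of b' a] by force
      have "qbinom Q a (Suc k) = qbinom Q a b'" "qbinom Q a k = qbinom Q a (Suc b')"
        using Suc.IH[of b'] Suc.IH[of "Suc b'"] k by simp_all
      then have "qbinom Q (Suc a) (Suc k) = qbinom Q (Suc a) (Suc b')"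
        using qbinom_pascal_right[of b' a] qbinom_pascal_left[of a k] k by simp
      then show ?thesis using k \<open>b = Suc b'\<close> by simp
    qed (use Suc in simp)
  qed simp
qed simp

text \<open>Trinomial revision: absorption strips one from \<open>n\<close>, \<open>s\<close> and
  \<open>j\<close> at once and leaves the differences unchanged. It separates the dependence on
  \<open>j\<close> in \<open>altF\<close> at \<open>r = 0\<close>.\<close>

lemma qbinom_trinomial:
  "j \<le> s \<Longrightarrow> s \<le> n \<Longrightarrow> qbinom Q (n - j) (n - s) * qbinom Q n j = qbinom Q n s * qbinom Q s j"
proof (induction j arbitrary: n s)
  case 0
  then show ?case by (simp add: qbinom_symmetric)
next
  case (Suc j)
  obtain n' s' where ns: "n = Suc n'" "s = Suc s'"
    using Suc.prems by (cases n; cases s) auto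
  have IH: "qbinom Q (n' - j) (n' - s') * qbinom Q n' j = qbinom Q n' s' * qbinom Q s' j"
    using Suc ns by auto
  have "(qbinom Q (n - Suc j) (n - s) * qbinom Q n (Suc j)) * (Q ^ Suc j - 1) * (Q ^ Suc s' - 1) =
    qbinom Q (n' - j) (n' - s') * (qbinom Q (Suc n') (Suc j) * (Q ^ Suc j - 1)) * (Q ^ Suc s' - 1)"
    by (simp only: ns diff_Suc_Suc mult.assoc)
  also have "\<dots> = (Q ^ Suc s' - 1) * (Q ^ Suc n' - 1) * (qbinom Q (n' - j) (n' - s') * qbinom Q n' j)"
    unfolding qbinom_absorb by (simp only: mult_ac)
  also have "\<dots> = ((Q ^ Suc n' - 1) * qbinom Q n' s') * ((Q ^ Suc s' - 1) * qbinom Q s' j)"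
    unfolding IH by (simp only: mult_ac)
  also have "\<dots> = (qbinom Q n s * qbinom Q s (Suc j)) * (Q ^ Suc j - 1) * (Q ^ Suc s' - 1)"
    unfolding qbinom_absorb[symmetric] ns by (simp only: mult_ac)
  finally show ?case using qpow_neq_1[of j] qpow_neq_1[of s'] by simp
qed

lemma q_binomial_theorem:
  "(\<Prod>i<s. c - Q ^ i) = (\<Sum>j\<le>s. (-1) ^ (s - j) * Q ^ ((s - j) choose 2) * qbinom Q s j * c ^ j)"
proof (induction s)
  case (Suc s)
  define t where "t s j = (-1) ^ (s - j) * Q ^ ((s - j) choose 2) * qbinom Q s j * c ^ j" for s j
  have IH: "(\<Prod>i<s. c - Q ^ i) = (\<Sum>j\<le>s. t s j)" using Suc by (simp add: t_def)
  have 0: "t (Suc s) 0 = - (Q ^ s * t s 0)"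
    by (simp add: t_def numeral_2_eq_2 power_add)
  have step: "t (Suc s) (Suc j) = c * t s j - Q ^ s * t s (Suc j)" if "j \<le> s" for j
  proof (cases "j = s")
    case True
    then show ?thesis by (simp add: t_def qbinom_eq_0)
  next
    case False
    then obtain k where k: "s = j + Suc k"
      using \<open>j \<le> s\<close> less_imp_Suc_add[of j s] by force
    \<comment> \<open>With \<open>s = j + k + 1\<close> this is the exponent identity s + C(k,2) =
      C(k+1,2) + j + 1, which aligns the powers of \<open>Q\<close> with the left Pascal
      rule.\<close>
    have *: "Q ^ s * Q ^ (k choose 2) = Q ^ (Suc k choose 2) * Q ^ Suc j"
      by (simp add: k numeral_2_eq_2 power_add)
    show ?thesis
      using * unfolding t_def qbinom_pascal_left
      by (simp add: k numeral_2_eq_2 algebra_simps power_add)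
  qed
  have "(\<Prod>i<Suc s. c - Q ^ i) = c * (\<Sum>j\<le>s. t s j) - Q ^ s * (\<Sum>j\<le>s. t s j)"
    by (simp add: IH algebra_simps)
  also have "\<dots> = (\<Sum>j\<le>s. c * t s j) - (- t (Suc s) 0 + (\<Sum>j\<le>s. Q ^ s * t s (Suc j)))"
  proof -
    have "(\<Sum>j\<le>s. t s j) = t s 0 + (\<Sum>j\<le>s. t s (Suc j))"
      using sum.atMost_Suc_shift[of "t s" s] by (simp add: t_def qbinom_eq_0)
    then have "Q ^ s * (\<Sum>j\<le>s. t s j) = - t (Suc s) 0 + (\<Sum>j\<le>s. Q ^ s * t s (Suc j))"
      by (simp only: 0 sum_distrib_left distrib_left minus_minus)
    then show ?thesis by (simp only: sum_distrib_left)
  qed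
  also have "(\<Sum>j\<le>s. c * t s j) - (- t (Suc s) 0 + (\<Sum>j\<le>s. Q ^ s * t s (Suc j))) =
      t (Suc s) 0 + (\<Sum>j\<le>s. t (Suc s) (Suc j))"
    by (simp add: step sum_subtractf)
  also have "\<dots> = (\<Sum>j\<le>Suc s. t (Suc s) j)"
    by (simp only: sum.atMost_Suc_shift)
  finally show ?case by (simp add: t_def)
qed (simp add: binomial_eq_0)

lemma altF_0 [simp]: "altF Q c n 0 r = 1"
  by (simp add: altF_def binomial_eq_0)

text \<open>Trinomial revision pulls \<open>qbinom Q n s\<close> out of every summand, and what
  remains is the q-binomial expansion of the product. With the constant of F the right-hand side is
  the number of alternating matrices of rank 2s.\<close>

lemma altF_at_0:
  assumes "s \<le> n"
  shows "altF Q c n s 0 = qbinom Q n s * (\<Prod>i<s. c - Q ^ i)"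
  unfolding q_binomial_theorem altF_def sum_distrib_left
  using qbinom_trinomial[OF _ assms] by (intro sum.cong) (auto simp: algebra_simps)

text \<open>Only \<open>qbinom Q (n - r) j\<close> depends on \<open>r\<close>. By the right Pascal
  rule its increment is a power of \<open>Q\<close> times the coefficient with lower index one less;
  the part of that power depending on \<open>j\<close> turns powers of \<open>c\<close> into powers
  of \<open>c / Q\<close>.\<close>

lemma altF_rec:
  assumes "s \<le> n" "r \<le> n"
  shows "altF Q c (Suc n) (Suc s) (Suc r) =
    altF Q c (Suc n) (Suc s) r - c * Q ^ (n - r) * altF Q (c / Q) n s r"
proof -
  define w where "w j = (-1) ^ (Suc s - j) * Q ^ ((Suc s - j) choose 2) *
      qbinom Q (Suc n - j) (n - s) * c ^ j" for j
  have "altF Q c (Suc n) (Suc s) r - altF Q c (Suc n) (Suc s) (Suc r) =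
      (\<Sum>j\<le>Suc s. w j * (qbinom Q (Suc (n - r)) j - qbinom Q (n - r) j))"
    using assms unfolding altF_def w_def
    by (simp add: sum_subtractf Suc_diff_le algebra_simps)
  also have "\<dots> = (\<Sum>j\<le>s. w (Suc j) * (qbinom Q (Suc (n - r)) (Suc j) - qbinom Q (n - r) (Suc j)))"
    by (simp only: sum.atMost_Suc_shift) simp
  also have "\<dots> = (\<Sum>j\<le>s. c * Q ^ (n - r) * ((-1) ^ (s - j) * Q ^ ((s - j) choose 2) *
      qbinom Q (n - j) (n - s) * qbinom Q (n - r) j * (c / Q) ^ j))"
  proof (intro sum.cong refl)
    fix j assume "j \<in> {..s}"
    show "w (Suc j) * (qbinom Q (Suc (n - r)) (Suc j) - qbinom Q (n - r) (Suc j)) =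
       c * Q ^ (n - r) * ((-1) ^ (s - j) * Q ^ ((s - j) choose 2) *
      qbinom Q (n - j) (n - s) * qbinom Q (n - r) j * (c / Q) ^ j)"
    proof (cases "j \<le> n - r")
      case True
      then have "Q ^ (n - r) = Q ^ j * Q ^ (n - r - j)"
        by (metis le_add_diff_inverse power_add)
      then show ?thesis
        using Q by (simp add: w_def qbinom_pascal_right[OF True] power_divide)
    qed (simp add: qbinom_eq_0)
  qed
  also have "\<dots> = c * Q ^ (n - r) * altF Q (c / Q) n s r"
    unfolding altF_def sum_distrib_left ..
  finally show ?thesis by simp
qed

lemma prod_shift_rec:
  "(\<Prod>i<Suc s. Q * c - Q ^ i) = (Q * c - 1) * Q ^ s * (\<Prod>i<s. c - Q ^ i)"
proof -
  have "(\<Prod>i<Suc s. Q * c - Q ^ i) = (Q * c - 1) * (\<Prod>i<s. Q * (c - Q ^ i))"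
    by (simp add: prod.lessThan_Suc_shift right_diff_distrib del: prod.lessThan_Suc)
  then show ?thesis by (simp add: prod.distrib del: prod.lessThan_Suc)
qed

end

lemma gauss_binomial_sq_qbinom: "gauss_binomial_sq q (int a) b = qbinom ((real q)\<^sup>2) a b"
proof -
  have "real q powi (2 * int a) = ((real q)\<^sup>2) ^ a"
    by (metis of_nat_mult of_nat_numeral power_int_of_nat power_mult)
  then show ?thesis
    unfolding gauss_binomial_sq_def qbinom_def qfall_def
    by (simp add: power_mult prod_dividef)
qed

text \<open>With n = m div 2, the exponent m(m-1)/(2n) of the constant c is the odd one of m-1 and
  m. For \<open>m = 0\<close> the value is 1 by truncated subtraction, and only its zeroth power
  occurs.\<close>

definition F_base :: "nat \<Rightarrow> nat \<Rightarrow> real" where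
  "F_base q m = real q ^ (if even m then m - 1 else m)"

lemma F_number_altF:
  assumes q: "q > 1"
  shows "F_number q (int m) (int s) (int r) =
    (if s \<le> m div 2 \<and> r \<le> m div 2 then altF ((real q)\<^sup>2) (F_base q m) (m div 2) s r else 0)"
proof (cases "s \<le> m div 2 \<and> r \<le> m div 2")
  case True
  define n where "n = m div 2"
  define c where "c = real q powr (real_of_int (int m * (int m - 1)) / real_of_int (2 * int n))"
  have sn: "s \<le> n" "r \<le> n" using True by (auto simp: n_def)
  \<comment> \<open>At \<open>n = 0\<close> the exponent in \<open>c\<close> is a division by zero;
    the restriction to \<open>j \<le> n\<close> leaves only the power zero there.\<close>
  have c: "c ^ j = F_base q m ^ j" if "j \<le> n" for j
  proof (cases "n = 0")
    case False
    have "real_of_int (int m * (int m - 1)) / real_of_int (2 * int n) = real (if even m then m - 1 else m)"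
    proof (cases "even m")
      case True
      then have m: "m = 2 * n" by (simp add: n_def)
      show ?thesis using False by (simp add: m field_simps of_nat_diff)
    next
      case odd: False
      then have m: "m = 2 * n + 1" by (simp add: n_def)
      show ?thesis using False by (simp add: m field_simps)
    qed
    then have "c = F_base q m"
      unfolding c_def F_base_def using q by (simp only: powr_realpow of_nat_0_less_iff)
    then show ?thesis by simp
  qed (use that in simp)
  have m2: "int m div 2 = int n" by (simp add: n_def zdiv_int)
  have "F_number q (int m) (int s) (int r) = (\<Sum>j\<in>{0..int s}. (-1) ^ nat (int s - j) *
        real q ^ nat ((int s - j) * (int s - j - 1)) *
        gauss_binomial_sq q (int n - j) (nat (int n - int s)) * gauss_binomial_sq q (int n - int r) (nat j) *
        c ^ nat j)"
    unfolding F_number_def Let_def m2 c_def using sn by simp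
  also have "\<dots> = (\<Sum>j\<in>int ` {..s}. (-1) ^ nat (int s - j) *
        real q ^ nat ((int s - j) * (int s - j - 1)) *
        gauss_binomial_sq q (int n - j) (nat (int n - int s)) * gauss_binomial_sq q (int n - int r) (nat j) *
        c ^ nat j)"
    by (simp add: image_int_atLeastAtMost flip: atLeast0AtMost)
  also have "\<dots> = (\<Sum>j\<le>s. (-1) ^ (s - j) * ((real q)\<^sup>2) ^ ((s - j) choose 2) *
      qbinom ((real q)\<^sup>2) (n - j) (n - s) * qbinom ((real q)\<^sup>2) (n - r) j * F_base q m ^ j)"
    unfolding sum.reindex[OF inj_on_of_nat] comp_def
  proof (intro sum.cong refl)
    fix j assume j: "j \<in> {..s}"
    have e: "nat ((int s - int j) * (int s - int j - 1)) = 2 * ((s - j) choose 2)"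
    proof (cases "s - j")
      case 0
      then show ?thesis using j by simp
    next
      case (Suc k)
      then have "int s - int j = int (Suc k)" using j by auto
      then show ?thesis unfolding Suc
        by (simp add: choose_two del: of_nat_Suc) (simp add: algebra_simps flip: of_nat_mult)
    qed
    have i: "nat (int s - int j) = s - j" "int n - int j = int (n - j)" "nat (int n - int s) = n - s"
      "int n - int r = int (n - r)"
      using j sn by auto
    show "(- 1) ^ nat (int s - int j) * real q ^ nat ((int s - int j) * (int s - int j - 1)) *
         gauss_binomial_sq q (int n - int j) (nat (int n - int s)) *
         gauss_binomial_sq q (int n - int r) (nat (int j)) * c ^ nat (int j) =
       (- 1) ^ (s - j) * ((real q)\<^sup>2) ^ ((s - j) choose 2) *
      qbinom ((real q)\<^sup>2) (n - j) (n - s) * qbinom ((real q)\<^sup>2) (n - r) j * F_base q m ^ j"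
      unfolding e unfolding i gauss_binomial_sq_qbinom using c[of j] j sn
      by (simp add: power_mult)
  qed
  also have "\<dots> = altF ((real q)\<^sup>2) (F_base q m) n s r"
    using q by (simp add: altF_def)
  finally show ?thesis using True by (simp add: n_def)
next
  case False
  then show ?thesis
    unfolding F_number_def Let_def
    by (metis atLeastAtMost_iff nat_int_comparison(3) of_nat_numeral zdiv_int)
qed

lemma F_number_rank_0: "q > 1 \<Longrightarrow> r \<le> m div 2 \<Longrightarrow> F_number q (int m) 0 (int r) = 1"
  using F_number_altF[of q m 0 r] by (simp add: altF_0)

text \<open>Lowering \<open>m\<close> by two lowers n by one and divides the constant by q^2, so
  \<open>altF_rec\<close> applies. The power of q is the constant for \<open>m + 2\<close> times
  \<open>q^(2 * (m div 2 - r))\<close>; its exponent is \<open>2 * m + 1 - 2 * r\<close> for both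
  parities.\<close>

lemma F_number_rec:
  assumes q: "q > 1" and r: "2 * r \<le> m"
  shows "F_number q (int (m + 2)) (int (Suc s)) (int (Suc r)) =
    F_number q (int (m + 2)) (int (Suc s)) (int r) -
    real q ^ (2 * m + 1 - 2 * r) * F_number q (int m) (int s) (int r)"
proof (cases "s \<le> m div 2")
  case True
  have Q: "(real q)\<^sup>2 > 1" using q by (simp add: power_strict_mono one_less_power)
  have b: "F_base q m = F_base q (m + 2) / (real q)\<^sup>2" if "m > 0"
    using that q unfolding F_base_def by (cases m) (auto simp: power2_eq_square)
  \<comment> \<open>\<open>F_base q 0\<close> is 1 and not the value 1/q that the constant for 2
    would suggest, but for \<open>m = 0\<close> only \<open>s = 0\<close> occurs, where
    \<open>altF\<close> does not depend on the constant.\<close>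
  have b': "altF ((real q)\<^sup>2) (F_base q m) (m div 2) s r =
      altF ((real q)\<^sup>2) (F_base q (m + 2) / (real q)\<^sup>2) (m div 2) s r"
    using b True by (cases "m = 0") (auto simp: altF_0[OF Q])
  have e: "F_base q (m + 2) * ((real q)\<^sup>2) ^ (m div 2 - r) = real q ^ (2 * m + 1 - 2 * r)"
  proof -
    have "(if even (m + 2) then m + 2 - 1 else m + 2) + 2 * (m div 2 - r) = 2 * m + 1 - 2 * r"
    proof (cases "even m")
      case True
      then obtain n where "m = 2 * n" by (elim evenE)
      then show ?thesis using r by simp
    next
      case False
      then obtain n where "m = 2 * n + 1" by (elim oddE)
      then show ?thesis using r by simp
    qed
    then show ?thesis unfolding F_base_def power_mult[symmetric] power_add[symmetric] by simp
  qed
  have r': "r \<le> m div 2" using r by simp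
  have d: "(m + 2) div 2 = Suc (m div 2)" by simp
  show ?thesis
    unfolding F_number_altF[OF q] b' d altF_rec[OF Q True r'] e[symmetric] using True r'
    by (simp only: Suc_le_mono le_SucI if_True simp_thms)
next
  case False
  then have "\<not> Suc s \<le> (m + 2) div 2" by simp
  then show ?thesis unfolding F_number_altF[OF q] using False by (simp only: if_False simp_thms)
qed

text \<open>This mirrors the count of alternating matrices by a fixed row: the zero row, or one of
  \<open>q^(m+1) - 1\<close> nonzero rows with \<open>q^m\<close> further choices. For even
  \<open>m\<close> the constants of \<open>m + 2\<close> and \<open>m + 1\<close> agree and Pascal's
  rule does the work; for odd \<open>m\<close> the binomial coefficients agree and absorption
  does.\<close>

lemma F_number_at_0_rec:
  assumes q: "q > 1"
  shows "F_number q (int (m + 2)) (int (Suc s)) 0 = F_number q (int (m + 1)) (int (Suc s)) 0 +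
    (real q ^ (m + 1) - 1) * real q ^ m * F_number q (int m) (int s) 0"
proof -
  define Q where "Q = (real q)\<^sup>2"
  have Q: "Q > 1" unfolding Q_def using q by (simp add: one_less_power)
  have q0: "real q > 0" using q by simp
  have F0: "F_number q (int m) (int s) 0 = qbinom Q (m div 2) s * (\<Prod>i<s. F_base q m - Q ^ i)" for m s
    using F_number_altF[OF q, of m s 0] altF_at_0[OF Q, of s "m div 2"] qbinom_eq_0[OF Q, of "m div 2" s]
    by (auto simp: Q_def not_le)
  show ?thesis
  proof (cases "even m")
    case True
    then obtain n where m: "m = 2 * n" by (elim evenE)
    show ?thesis
    proof (cases "s \<le> n")
      case s: True
      define c where "c = real q ^ (2 * n + 1)"
      have b: "F_base q (m + 2) = c" "F_base q (m + 1) = c"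
        by (simp_all add: F_base_def m c_def)
      have P: "(\<Prod>i<Suc s. c - Q ^ i) = (c - 1) * Q ^ s * (\<Prod>i<s. F_base q m - Q ^ i)"
      proof (cases "m = 0")
        case False
        then have "c = Q * F_base q m"
          by (cases n) (simp_all add: F_base_def m c_def Q_def power2_eq_square)
        then show ?thesis using prod_shift_rec[OF Q, of "F_base q m" s] by simp
      next
        case True
        then show ?thesis using s m by (simp add: c_def)
      qed
      have e: "real q ^ m = Q ^ (n - s) * Q ^ s"
        using s by (simp add: m Q_def power_mult flip: power_add)
      have c': "real q ^ (m + 1) = c" by (simp add: c_def m)
      have d: "(m + 2) div 2 = Suc n" "(m + 1) div 2 = n" "m div 2 = n" by (simp_all add: m)
      show ?thesis unfolding F0 b P e d qbinom_pascal_right[OF Q s] c'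
        by (simp add: algebra_simps)
    next
      case False
      then show ?thesis unfolding F0 by (simp add: m qbinom_eq_0[OF Q])
    qed
  next
    case False
    then obtain n where m: "m = 2 * n + 1" by (elim oddE)
    define c where "c = real q ^ (2 * n + 1)"
    have b: "F_base q (m + 2) = Q * c" "F_base q (m + 1) = c" "F_base q m = c"
      by (simp_all add: F_base_def m c_def Q_def power2_eq_square)
    have d: "(m + 2) div 2 = Suc n" "(m + 1) div 2 = Suc n" "m div 2 = n" by (simp_all add: m)
    have e: "real q ^ (m + 1) = Q ^ Suc n" "real q ^ m = c"
      by (simp_all add: m Q_def c_def power_mult power2_eq_square)
    have "(Q * c - 1) * Q ^ s = (c - Q ^ s) + c * (Q ^ Suc s - 1)"
      by (simp add: algebra_simps)
    then have "qbinom Q (Suc n) (Suc s) * ((Q * c - 1) * Q ^ s) = qbinom Q (Suc n) (Suc s) * (c - Q ^ s) +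
      c * (qbinom Q (Suc n) (Suc s) * (Q ^ Suc s - 1))"
      by (simp add: algebra_simps)
    then have "qbinom Q (Suc n) (Suc s) * ((Q * c - 1) * Q ^ s) = qbinom Q (Suc n) (Suc s) * (c - Q ^ s) +
      (Q ^ Suc n - 1) * c * qbinom Q n s"
      unfolding qbinom_absorb[OF Q] by (simp add: algebra_simps)
    then have "qbinom Q (Suc n) (Suc s) * ((Q * c - 1) * Q ^ s) * X = (qbinom Q (Suc n) (Suc s) * (c - Q ^ s) +
      (Q ^ Suc n - 1) * c * qbinom Q n s) * X" for X
      by (simp only:)
    from this[of "\<Prod>i<s. c - Q ^ i"]
    show ?thesis unfolding F0 b d e prod_shift_rec[OF Q] prod.lessThan_Suc distrib_right[of _ _ "\<Prod>i<s. c - Q ^ i"]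
      by (simp only: mult_ac)
  qed
qed

lemma F_number_at_0_small: "q > 1 \<Longrightarrow> m \<le> 1 \<Longrightarrow> F_number q (int m) (int (Suc s)) 0 = 0"
  using F_number_altF[of q m "Suc s" 0] by auto

section \<open>Alternating matrices of given rank\<close>

text \<open>Vectors are indexed by an arbitrary set, so that deleting a coordinate or a hyperbolic
  plane requires no renumbering. The value 0 outside the set makes the representation unique, hence
  countable.\<close>

definition vecs :: "nat set \<Rightarrow> (nat \<Rightarrow> 'a::zero) set" where
  "vecs I = {x. \<forall>i. i \<notin> I \<longrightarrow> x i = 0}"

text \<open>In characteristic 2 skew-symmetry does not force a zero diagonal, so both are required.
  The support condition on the rows extends to the columns by skew-symmetry.\<close>

definition alternating_on :: "nat set \<Rightarrow> (nat \<Rightarrow> nat \<Rightarrow> 'a::ab_group_add) set" where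
  "alternating_on I = {B. (\<forall>i. B i i = 0) \<and> (\<forall>i j. B i j + B j i = 0) \<and> (\<forall>i j. i \<notin> I \<longrightarrow> B i j = 0)}"

definition matrix_radical :: "nat set \<Rightarrow> (nat \<Rightarrow> nat \<Rightarrow> 'a::semiring_0) \<Rightarrow> (nat \<Rightarrow> 'a) set" where
  "matrix_radical I B = {x \<in> vecs I. \<forall>i. (\<Sum>j\<in>I. B i j * x j) = 0}"

text \<open>The rank is encoded by the number of elements of the radical, which avoids dimensions.\<close>

definition alternating_of_rank :: "nat set \<Rightarrow> nat \<Rightarrow> (nat \<Rightarrow> nat \<Rightarrow> 'a::{finite, ring}) set" where
  "alternating_of_rank I r =
     {B \<in> alternating_on I. card (matrix_radical I B) * CARD('a) ^ r = CARD('a) ^ card I}"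

section \<open>Coordinate vectors and alternating matrices as finite sets\<close>

lemma zero_in_vecs [simp]: "(\<lambda>_. 0) \<in> vecs I"
  by (simp add: vecs_def)

lemma bij_betw_vecs_insert:
  assumes "i \<notin> I"
  shows "bij_betw (\<lambda>(c, x). x(i := c)) (UNIV \<times> vecs I) (vecs (insert i I))"
  by (rule bij_betw_byWitness[where f' = "\<lambda>x. (x i, x(i := 0))"])
    (use assms in \<open>auto simp: vecs_def fun_eq_iff\<close>)

lemma finite_vecs [simp]: "finite I \<Longrightarrow> finite (vecs I :: (nat \<Rightarrow> 'a::{zero,finite}) set)"
proof (induction rule: finite_induct)
  case empty
  have "vecs {} = {\<lambda>_. 0 :: 'a}" by (auto simp: vecs_def)
  then show ?case by simp
next
  case (insert i I)
  then show ?case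
    using bij_betw_finite[OF bij_betw_vecs_insert[of i I, where ?'a = 'a]] by simp
qed

lemma sum_vecs_insert:
  fixes g :: "(nat \<Rightarrow> 'a::{zero,finite}) \<Rightarrow> 'b::comm_monoid_add"
  assumes "i \<notin> I"
  shows "(\<Sum>x\<in>vecs (insert i I). g x) = (\<Sum>c\<in>UNIV. \<Sum>x\<in>vecs I. g (x(i := c)))"
proof -
  have "(\<Sum>x\<in>vecs (insert i I). g x) = (\<Sum>(c, x)\<in>UNIV \<times> vecs I. g (x(i := c)))"
    by (subst sum.reindex_bij_betw[OF bij_betw_vecs_insert[OF assms], symmetric])
      (simp add: case_prod_unfold)
  then show ?thesis by (simp add: sum.cartesian_product)
qed

lemma card_vecs: "finite I \<Longrightarrow> card (vecs I :: (nat \<Rightarrow> 'a::{zero,finite}) set) = CARD('a) ^ card I"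
proof (induction rule: finite_induct)
  case empty
  have "vecs {} = {\<lambda>_. 0 :: 'a}" by (auto simp: vecs_def)
  then show ?case by simp
next
  case (insert i I)
  then show ?case
    using bij_betw_same_card[OF bij_betw_vecs_insert[of i I, where ?'a = 'a]]
    by (simp add: card_cartesian_product)
qed

lemma alternating_on_diag: "B \<in> alternating_on I \<Longrightarrow> B i i = 0"
  by (simp add: alternating_on_def)

lemma alternating_on_swap: "B \<in> alternating_on I \<Longrightarrow> B j i = - B i j"
  by (intro minus_unique[symmetric]) (simp add: alternating_on_def)

lemma alternating_on_outside:
  assumes "B \<in> alternating_on I" "i \<notin> I \<or> j \<notin> I"
  shows "B i j = 0"
  using assms alternating_on_swap[OF assms(1), of i j] by (auto simp: alternating_on_def)

lemma finite_alternating_on: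
  assumes "finite I"
  shows "finite (alternating_on I :: (nat \<Rightarrow> nat \<Rightarrow> 'a::{finite, ring}) set)"
proof (rule finite_subset)
  let ?f = "\<lambda>x i j. if i \<in> I \<and> j \<in> I then x (i, j) else (0 :: 'a)"
  show "finite (?f ` (I \<times> I \<rightarrow>\<^sub>E UNIV))"
    using assms by (intro finite_imageI finite_PiE) auto
  show "alternating_on I \<subseteq> ?f ` (I \<times> I \<rightarrow>\<^sub>E UNIV)"
  proof
    fix B :: "nat \<Rightarrow> nat \<Rightarrow> 'a"
    assume B: "B \<in> alternating_on I"
    then have "B i j = 0" if "i \<notin> I \<or> j \<notin> I" for i j
      using that by (rule alternating_on_outside)
    then have "B = ?f (restrict (\<lambda>(i, j). B i j) (I \<times> I))"
      by (auto simp: fun_eq_iff)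
    moreover have "restrict (\<lambda>(i, j). B i j) (I \<times> I) \<in> (I \<times> I \<rightarrow>\<^sub>E UNIV)" by simp
    ultimately show "B \<in> ?f ` (I \<times> I \<rightarrow>\<^sub>E UNIV)" by (rule image_eqI)
  qed
qed

lemma finite_alternating_of_rank [simp]:
  "finite I \<Longrightarrow> finite (alternating_of_rank I r)"
  unfolding alternating_of_rank_def by (rule finite_subset[OF _ finite_alternating_on]) auto

lemma alternating_of_rankD: "B \<in> alternating_of_rank I r \<Longrightarrow> B \<in> alternating_on I"
  by (simp add: alternating_of_rank_def)

lemma zero_in_alternating_of_rank:
  "finite I \<Longrightarrow> (\<lambda>_ _. 0) \<in> alternating_of_rank I 0"
  by (simp add: alternating_of_rank_def alternating_on_def matrix_radical_def card_vecs)

lemma alternating_of_rank_0: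
  assumes "finite I"
  shows "alternating_of_rank I 0 = {\<lambda>_ _. 0 :: 'a::{finite, field}}"
proof -
  have "B = (\<lambda>_ _. 0)" if B: "B \<in> alternating_of_rank I 0" for B :: "nat \<Rightarrow> nat \<Rightarrow> 'a"
  proof -
    have "card (matrix_radical I B) = card (vecs I :: (nat \<Rightarrow> 'a) set)"
      using B assms by (simp add: alternating_of_rank_def card_vecs)
    then have eq: "matrix_radical I B = vecs I"
      using assms by (intro card_subset_eq) (auto simp: matrix_radical_def)
    have "B i j = 0" for i j
    proof (cases "j \<in> I")
      case True
      then have "(\<lambda>k. if k = j then 1 else 0) \<in> matrix_radical I B"
        unfolding eq by (auto simp: vecs_def)
      then have "(\<Sum>k\<in>I. B i k * (if k = j then 1 else 0)) = 0"
        by (simp only: matrix_radical_def mem_Collect_eq)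
      then show ?thesis using True assms by (simp add: if_distrib cong: if_cong)
    qed (use alternating_on_outside[OF alternating_of_rankD[OF B]] in auto)
    then show ?thesis by blast
  qed
  then show ?thesis using zero_in_alternating_of_rank[OF assms] by auto
qed

text \<open>Column \<open>i\<close> vanishes with row \<open>i\<close>, so the coordinate at
  \<open>i\<close> is free in the radical: radical and space both grow by the factor q, and the rank
  stays. This identifies the matrices with a given unit vector in the radical with those on the
  quotient by it.\<close>

lemma alternating_zero_row:
  assumes I: "finite I" and i: "i \<in> I"
  shows "{B \<in> alternating_of_rank I r. B i = (\<lambda>_. 0)} =
    (alternating_of_rank (I - {i}) r :: (nat \<Rightarrow> nat \<Rightarrow> 'a::{finite, field}) set)"
proof -
  have on: "{B \<in> alternating_on I. B i = (\<lambda>_. 0)} = (alternating_on (I - {i}) :: (nat \<Rightarrow> nat \<Rightarrow> 'a) set)"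
    unfolding alternating_on_def by (auto simp: fun_eq_iff)
  have I': "I = insert i (I - {i})" using i by blast
  have card_rad: "card (matrix_radical I B) = CARD('a) * card (matrix_radical (I - {i}) B)"
    if B: "B \<in> alternating_on (I - {i})" for B :: "nat \<Rightarrow> nat \<Rightarrow> 'a"
  proof -
    have z: "B k i = 0" for k using alternating_on_outside[OF B] by simp
    have s: "(\<Sum>j\<in>I. B k j * x j) = (\<Sum>j\<in>I - {i}. B k j * x j)" for k x
      by (subst sum.remove[OF I i]) (simp add: z)
    have "bij_betw (\<lambda>(c, x). x(i := c)) (UNIV \<times> matrix_radical (I - {i}) B) (matrix_radical I B)"
    proof (rule bij_betw_byWitness[where f' = "\<lambda>x. (x i, x(i := 0))"])
      show "(\<lambda>(c, x). x(i := c)) ` (UNIV \<times> matrix_radical (I - {i}) B) \<subseteq> matrix_radical I B"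
        using i unfolding matrix_radical_def s by (auto simp: vecs_def)
      show "(\<lambda>x. (x i, x(i := 0))) ` matrix_radical I B \<subseteq> UNIV \<times> matrix_radical (I - {i}) B"
        using i unfolding matrix_radical_def s by (auto simp: vecs_def)
    qed (auto simp: matrix_radical_def vecs_def fun_eq_iff)
    from bij_betw_same_card[OF this] show ?thesis by (simp add: card_cartesian_product)
  qed
  have c: "card I = Suc (card (I - {i}))" using card_Suc_Diff1[OF I i] by simp
  have "{B \<in> alternating_of_rank I r. B i = (\<lambda>_. 0 :: 'a)} =
    {B \<in> {B \<in> alternating_on I. B i = (\<lambda>_. 0)}. card (matrix_radical I B) * CARD('a) ^ r = CARD('a) ^ card I}"
    by (auto simp: alternating_of_rank_def)
  also have "\<dots> = alternating_of_rank (I - {i}) r"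
    unfolding on alternating_of_rank_def using card_rad c by auto
  finally show ?thesis .
qed

text \<open>
  An alternating matrix \<open>B\<close> with \<open>i\<close>-th row \<open>\<rho>\<close> and \<open>\<rho> j \<noteq> 0\<close> splits off the hyperbolic plane
  spanned by the \<open>i\<close>-th and \<open>j\<close>-th unit vectors.  Here \<open>\<beta>\<close> is the \<open>j\<close>-th row without its
  entry at \<open>i\<close>, and \<open>C\<close> is the matrix of the restriction to the orthogonal complement of the plane.
\<close>

definition attach_plane ::
  "nat \<Rightarrow> nat \<Rightarrow> (nat \<Rightarrow> 'a::field) \<Rightarrow> (nat \<Rightarrow> 'a) \<Rightarrow> (nat \<Rightarrow> nat \<Rightarrow> 'a) \<Rightarrow> nat \<Rightarrow> nat \<Rightarrow> 'a" where
  "attach_plane i j \<rho> \<beta> C k l =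
     C k l + (\<rho> k * (\<beta>(i := - \<rho> j)) l - (\<beta>(i := - \<rho> j)) k * \<rho> l) / \<rho> j"

text \<open>The block of \<open>B\<close> at \<open>i\<close> and \<open>j\<close> is invertible,
  with determinant \<open>(\<rho> j)^2\<close>; \<open>C\<close> is its Schur complement. The entry
  at \<open>i\<close> of row \<open>j\<close> is forced to be \<open>- \<rho> j\<close>, and
  \<open>\<beta>\<close> records the rest of that row.\<close>

lemma bij_attach_plane:
  fixes \<rho> :: "nat \<Rightarrow> 'a::{finite, field}"
  assumes I: "finite I" and ij: "i \<in> I" "j \<in> I" "i \<noteq> j"
    and \<rho>: "\<rho> \<in> vecs (I - {i})" "\<rho> j \<noteq> 0"
  shows "bij_betw (\<lambda>(\<beta>, C). attach_plane i j \<rho> \<beta> C) (vecs (I - {i, j}) \<times> alternating_on (I - {i, j}))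
    {B \<in> alternating_on I. B i = \<rho>}"
proof (rule bij_betw_byWitness[where f' = "\<lambda>B. ((B j)(i := 0), \<lambda>k l. B k l - (B i k * B j l - B j k * B i l) / B i j)"])
  let ?J = "I - {i, j}"
  have \<rho>i: "\<rho> i = 0" using \<rho> by (simp add: vecs_def)
  have \<rho>k: "\<rho> k = 0" if "k \<notin> I" for k using \<rho> that by (simp add: vecs_def)
  have rows: "attach_plane i j \<rho> \<beta> C i = \<rho>" "attach_plane i j \<rho> \<beta> C j = \<beta>(i := - \<rho> j)"
    if "\<beta> \<in> vecs ?J" "C \<in> alternating_on ?J" for \<beta> C
    using that \<rho>i \<rho>(2) alternating_on_outside[OF that(2), of i] alternating_on_outside[OF that(2), of j]
    by (auto simp: attach_plane_def fun_eq_iff vecs_def)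
  show "\<forall>a\<in>vecs ?J \<times> alternating_on ?J.
      (\<lambda>B. ((B j)(i := 0), \<lambda>k l. B k l - (B i k * B j l - B j k * B i l) / B i j)) ((\<lambda>(\<beta>, C). attach_plane i j \<rho> \<beta> C) a) = a"
  proof
    fix a assume "a \<in> (vecs ?J :: (nat \<Rightarrow> 'a) set) \<times> (alternating_on ?J :: (nat \<Rightarrow> nat \<Rightarrow> 'a) set)"
    then obtain \<beta> C where a: "a = (\<beta>, C)" and \<beta>: "\<beta> \<in> vecs ?J" and C: "C \<in> alternating_on ?J"
      by auto
    have "(\<beta>(i := - \<rho> j))(i := 0) = \<beta>" using \<beta> by (auto simp: vecs_def)
    moreover have "attach_plane i j \<rho> \<beta> C k l -
        (\<rho> k * (\<beta>(i := - \<rho> j)) l - (\<beta>(i := - \<rho> j)) k * \<rho> l) / \<rho> j = C k l" for k l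
      by (simp add: attach_plane_def)
    ultimately have "((attach_plane i j \<rho> \<beta> C j)(i := 0), \<lambda>k l. attach_plane i j \<rho> \<beta> C k l -
        (attach_plane i j \<rho> \<beta> C i k * attach_plane i j \<rho> \<beta> C j l -
         attach_plane i j \<rho> \<beta> C j k * attach_plane i j \<rho> \<beta> C i l) /
        attach_plane i j \<rho> \<beta> C i j) = (\<beta>, C)"
      unfolding rows[OF \<beta> C] by (simp only:)
    then show "(\<lambda>B. ((B j)(i := 0), \<lambda>k l. B k l - (B i k * B j l - B j k * B i l) / B i j))
        ((\<lambda>(\<beta>, C). attach_plane i j \<rho> \<beta> C) a) = a"
      unfolding a prod.case .
  qed
  show "\<forall>B\<in>{B \<in> alternating_on I. B i = \<rho>}. (\<lambda>(\<beta>, C). attach_plane i j \<rho> \<beta> C)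
      ((B j)(i := 0), \<lambda>k l. B k l - (B i k * B j l - B j k * B i l) / B i j) = B"
  proof
    fix B assume B: "B \<in> {B \<in> alternating_on I. B i = \<rho>}"
    then have "B j i = - \<rho> j" using alternating_on_swap[of B I i j] by simp
    then have *: "(B j)(i := - \<rho> j) = B j" by auto
    show "(\<lambda>(\<beta>, C). attach_plane i j \<rho> \<beta> C)
      ((B j)(i := 0), \<lambda>k l. B k l - (B i k * B j l - B j k * B i l) / B i j) = B"
      using B * by (simp add: attach_plane_def fun_eq_iff)
  qed
  show "(\<lambda>(\<beta>, C). attach_plane i j \<rho> \<beta> C) ` (vecs ?J \<times> alternating_on ?J) \<subseteq> {B \<in> alternating_on I. B i = \<rho>}"
  proof clarsimp
    fix \<beta> :: "nat \<Rightarrow> 'a" and C :: "nat \<Rightarrow> nat \<Rightarrow> 'a" assume \<beta>: "\<beta> \<in> vecs ?J" and C: "C \<in> alternating_on ?J"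
    have "attach_plane i j \<rho> \<beta> C k l + attach_plane i j \<rho> \<beta> C l k = 0" for k l
      using alternating_on_swap[OF C, of l k] by (simp add: attach_plane_def algebra_simps diff_divide_distrib)
    moreover have "attach_plane i j \<rho> \<beta> C k l = 0" if "k \<notin> I" for k l
      using that ij \<beta> \<rho>k[OF that] alternating_on_outside[OF C, of k l] by (auto simp: attach_plane_def vecs_def)
    moreover have "attach_plane i j \<rho> \<beta> C k k = 0" for k
      using alternating_on_diag[OF C] by (simp add: attach_plane_def)
    ultimately show "attach_plane i j \<rho> \<beta> C \<in> alternating_on I \<and> attach_plane i j \<rho> \<beta> C i = \<rho>"
      using rows[OF \<beta> C] unfolding alternating_on_def by blast
  qed
  show "(\<lambda>B. ((B j)(i := 0), \<lambda>k l. B k l - (B i k * B j l - B j k * B i l) / B i j)) `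
      {B \<in> alternating_on I. B i = \<rho>} \<subseteq> vecs ?J \<times> alternating_on ?J"
  proof clarsimp
    fix B assume B: "B \<in> alternating_on I" and \<rho>B: "\<rho> = B i"
    note d = alternating_on_diag[OF B] and sw = alternating_on_swap[OF B] and ou = alternating_on_outside[OF B]
    define C where "C = (\<lambda>k l. B k l - (B i k * B j l - B j k * B i l) / B i j)"
    have nz: "B i j \<noteq> 0" using \<rho> \<rho>B by simp
    have ji: "B j i = - B i j" by (rule sw)
    have "C k l + C l k = 0" for k l
      using sw[of k l] by (simp add: C_def algebra_simps diff_divide_distrib)
    moreover have "C k k = 0" for k by (simp add: C_def d)
    moreover have "C k l = 0" if kJ: "k \<notin> ?J" for k l
    proof -
      consider "k = i" | "k = j" | "k \<notin> I" using kJ by blast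
      then show ?thesis
        by cases (use nz d ou ji in \<open>simp_all add: C_def field_simps\<close>)
    qed
    ultimately have "C \<in> alternating_on ?J" unfolding alternating_on_def by blast
    moreover have "(B j)(i := 0) \<in> vecs ?J" using d ou by (auto simp: vecs_def)
    ultimately show "(B j)(i := 0) \<in> vecs ?J \<and> (\<lambda>k l. B k l - (B i k * B j l - B j k * B i l) / B i j) \<in> alternating_on ?J"
      by (simp add: C_def)
  qed
qed

text \<open>Rows \<open>i\<close> and \<open>j\<close> say that \<open>x\<close> is orthogonal to
  \<open>\<rho>\<close> and to row \<open>j\<close>, after which the other rows reduce to
  \<open>C\<close>. These two equations determine \<open>x i\<close> and \<open>x j\<close> from the
  other coordinates, so forgetting them is a bijection of radicals.\<close>

lemma card_radical_attach_plane:
  fixes \<rho> :: "nat \<Rightarrow> 'a::{finite, field}"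
  assumes I: "finite I" and ij: "i \<in> I" "j \<in> I" "i \<noteq> j"
    and \<rho>: "\<rho> \<in> vecs (I - {i})" "\<rho> j \<noteq> 0"
    and \<beta>: "\<beta> \<in> vecs (I - {i, j})" and C: "C \<in> alternating_on (I - {i, j})"
  shows "card (matrix_radical I (attach_plane i j \<rho> \<beta> C)) = card (matrix_radical (I - {i, j}) C)"
proof -
  define J where "J = I - {i, j}"
  define \<sigma> where "\<sigma> = \<beta>(i := - \<rho> j)"
  have IJ: "I = insert i (insert j J)" "i \<notin> J" "j \<notin> J" "finite J" using ij I by (auto simp: J_def)
  have z: "\<rho> i = 0" "\<sigma> i = - \<rho> j" "\<sigma> j = 0" "C i l = 0" "C j l = 0" "C l i = 0" "C l j = 0" for l
    using \<rho> \<beta> ij alternating_on_outside[OF C, of i l] alternating_on_outside[OF C, of j l]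
      alternating_on_outside[OF C, of l i] alternating_on_outside[OF C, of l j]
    by (auto simp: \<sigma>_def vecs_def)
  have \<sigma>\<beta>: "(\<Sum>l\<in>J. \<sigma> l * x l) = (\<Sum>l\<in>J. \<beta> l * x l)" for x
    by (intro sum.cong) (use IJ in \<open>auto simp: \<sigma>_def\<close>)
  have s\<sigma>: "(\<Sum>l\<in>I. \<sigma> l * x l) = (\<Sum>l\<in>J. \<beta> l * x l) - \<rho> j * x i" for x
    using IJ ij by (simp add: z \<sigma>\<beta>)
  have s\<rho>: "(\<Sum>l\<in>I. \<rho> l * x l) = \<rho> j * x j + (\<Sum>l\<in>J. \<rho> l * x l)" for x
    using IJ ij by (simp add: z)
  have sC: "(\<Sum>l\<in>I. C k l * x l) = (\<Sum>l\<in>J. C k l * x l)" for k x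
    using IJ ij by (simp add: z)
  have row: "(\<Sum>l\<in>I. attach_plane i j \<rho> \<beta> C k l * x l) =
      (\<Sum>l\<in>J. C k l * x l) + (\<rho> k * (\<Sum>l\<in>I. \<sigma> l * x l) - \<sigma> k * (\<Sum>l\<in>I. \<rho> l * x l)) / \<rho> j" for k x
    unfolding attach_plane_def \<sigma>_def[symmetric] sC[symmetric]
    by (simp add: distrib_right diff_divide_distrib left_diff_distrib sum.distrib sum_subtractf sum_distrib_left
        sum_divide_distrib mult.assoc)
  \<comment> \<open>Since \<open>\<rho> i = 0\<close>, \<open>\<sigma> i = - \<rho> j\<close> and
    \<open>\<sigma> j = 0\<close>, row \<open>i\<close> isolates the product with
    \<open>\<rho>\<close> and row \<open>j\<close> the product with \<open>\<sigma>\<close>.\<close>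
  have rad: "x \<in> matrix_radical I (attach_plane i j \<rho> \<beta> C) \<longleftrightarrow> x \<in> vecs I \<and>
      (\<Sum>l\<in>I. \<rho> l * x l) = 0 \<and> (\<Sum>l\<in>I. \<sigma> l * x l) = 0 \<and> (\<forall>k. (\<Sum>l\<in>J. C k l * x l) = 0)" for x
  proof
    assume "x \<in> matrix_radical I (attach_plane i j \<rho> \<beta> C)"
    then have x: "x \<in> vecs I" and r: "\<And>k. (\<Sum>l\<in>J. C k l * x l) +
        (\<rho> k * (\<Sum>l\<in>I. \<sigma> l * x l) - \<sigma> k * (\<Sum>l\<in>I. \<rho> l * x l)) / \<rho> j = 0"
      unfolding matrix_radical_def row by auto
    have "(\<Sum>l\<in>I. \<rho> l * x l) = 0" "(\<Sum>l\<in>I. \<sigma> l * x l) = 0"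
      using r[of i] r[of j] z \<rho>(2) by simp_all
    then show "x \<in> vecs I \<and>
      (\<Sum>l\<in>I. \<rho> l * x l) = 0 \<and> (\<Sum>l\<in>I. \<sigma> l * x l) = 0 \<and> (\<forall>k. (\<Sum>l\<in>J. C k l * x l) = 0)"
      using x r by simp
  qed (simp add: matrix_radical_def row)
  have cong: "(\<Sum>l\<in>J. f l * (x(i := a, j := b)) l) = (\<Sum>l\<in>J. f l * x l)"
    "(\<Sum>l\<in>J. f l * (x(i := a)) l) = (\<Sum>l\<in>J. f l * x l)" for f x a b
    by (intro sum.cong; use IJ in auto)+
  \<comment> \<open>The inverse solves the equations with \<open>\<sigma>\<close> and
    \<open>\<rho>\<close> for the coordinates at \<open>i\<close> and \<open>j\<close>.\<close>
  have "bij_betw (\<lambda>x. x(i := 0, j := 0)) (matrix_radical I (attach_plane i j \<rho> \<beta> C)) (matrix_radical J C)"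
  proof (rule bij_betw_byWitness[where
        f' = "\<lambda>y. y(i := (\<Sum>l\<in>J. \<beta> l * y l) / \<rho> j, j := - (\<Sum>l\<in>J. \<rho> l * y l) / \<rho> j)"])
    show "\<forall>x\<in>matrix_radical I (attach_plane i j \<rho> \<beta> C). (x(i := 0, j := 0))
        (i := (\<Sum>l\<in>J. \<beta> l * (x(i := 0, j := 0)) l) / \<rho> j, j := - (\<Sum>l\<in>J. \<rho> l * (x(i := 0, j := 0)) l) / \<rho> j) = x"
    proof
      fix x assume "x \<in> matrix_radical I (attach_plane i j \<rho> \<beta> C)"
      then have "(\<Sum>l\<in>J. \<beta> l * x l) = \<rho> j * x i" "(\<Sum>l\<in>J. \<rho> l * x l) = - (\<rho> j * x j)"
        unfolding rad s\<sigma> s\<rho> by (auto simp: eq_neg_iff_add_eq_0 add.commute)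
      then show "(x(i := 0, j := 0))
        (i := (\<Sum>l\<in>J. \<beta> l * (x(i := 0, j := 0)) l) / \<rho> j, j := - (\<Sum>l\<in>J. \<rho> l * (x(i := 0, j := 0)) l) / \<rho> j) = x"
        unfolding cong using \<rho>(2) by auto
    qed
    show "\<forall>y\<in>matrix_radical J C. (y(i := (\<Sum>l\<in>J. \<beta> l * y l) / \<rho> j, j := - (\<Sum>l\<in>J. \<rho> l * y l) / \<rho> j))
        (i := 0, j := 0) = y"
      using IJ by (auto simp: matrix_radical_def vecs_def fun_eq_iff)
    show "(\<lambda>x. x(i := 0, j := 0)) ` matrix_radical I (attach_plane i j \<rho> \<beta> C) \<subseteq> matrix_radical J C"
    proof clarify
      fix x assume "x \<in> matrix_radical I (attach_plane i j \<rho> \<beta> C)"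
      then have "x \<in> vecs I" "\<forall>k. (\<Sum>l\<in>J. C k l * x l) = 0"
        unfolding rad by auto
      then show "x(i := 0, j := 0) \<in> matrix_radical J C"
        unfolding matrix_radical_def mem_Collect_eq cong by (auto simp: vecs_def IJ)
    qed
    show "(\<lambda>y. y(i := (\<Sum>l\<in>J. \<beta> l * y l) / \<rho> j, j := - (\<Sum>l\<in>J. \<rho> l * y l) / \<rho> j)) ` matrix_radical J C
        \<subseteq> matrix_radical I (attach_plane i j \<rho> \<beta> C)"
    proof clarify
      fix y assume y: "y \<in> matrix_radical J C"
      show "y(i := (\<Sum>l\<in>J. \<beta> l * y l) / \<rho> j, j := - (\<Sum>l\<in>J. \<rho> l * y l) / \<rho> j)
          \<in> matrix_radical I (attach_plane i j \<rho> \<beta> C)"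
        unfolding rad s\<sigma> s\<rho> cong using y \<rho>(2) ij
        by (auto simp: matrix_radical_def vecs_def J_def)
    qed
  qed
  from bij_betw_same_card[OF this] show ?thesis by (simp add: J_def)
qed

text \<open>Removing the plane costs the space two dimensions while the radical keeps its size, so
  the rank drops by two.\<close>

lemma bij_attach_plane_rank:
  fixes \<rho> :: "nat \<Rightarrow> 'a::{finite, field}"
  assumes I: "finite I" and ij: "i \<in> I" "j \<in> I" "i \<noteq> j"
    and \<rho>: "\<rho> \<in> vecs (I - {i})" "\<rho> j \<noteq> 0"
  shows "bij_betw (\<lambda>(\<beta>, C). attach_plane i j \<rho> \<beta> C) (vecs (I - {i, j}) \<times> alternating_of_rank (I - {i, j}) r)
    {B \<in> alternating_of_rank I (r + 2). B i = \<rho>}"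
proof -
  let ?J = "I - {i, j}"
  note bij = bij_attach_plane[OF assms]
  have c: "card I = card ?J + 2"
    using card_Suc_Diff1[of I i] card_Suc_Diff1[of "I - {i}" j] I ij
    by (simp add: Diff_insert2[of I i "{j}"])
  have iff: "attach_plane i j \<rho> \<beta> C \<in> alternating_of_rank I (r + 2) \<longleftrightarrow> C \<in> alternating_of_rank ?J r"
    if "\<beta> \<in> vecs ?J" "C \<in> alternating_on ?J" for \<beta> C
  proof -
    have "attach_plane i j \<rho> \<beta> C \<in> alternating_on I"
      using bij_betwE[OF bij, rule_format, of "(\<beta>, C)"] that by auto
    then show ?thesis
      using that card_radical_attach_plane[OF assms that]
      by (simp add: alternating_of_rank_def c)
  qed
  show ?thesis
  proof (rule bij_betw_subset[OF bij])
    show "vecs ?J \<times> alternating_of_rank ?J r \<subseteq> vecs ?J \<times> alternating_on ?J"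
      by (auto dest: alternating_of_rankD)
    show "(\<lambda>(\<beta>, C). attach_plane i j \<rho> \<beta> C) ` (vecs ?J \<times> alternating_of_rank ?J r) =
      {B \<in> alternating_of_rank I (r + 2). B i = \<rho>}"
    proof (intro equalityI subsetI)
      fix B assume "B \<in> (\<lambda>(\<beta>, C). attach_plane i j \<rho> \<beta> C) ` (vecs ?J \<times> alternating_of_rank ?J r)"
      then obtain \<beta> C where B: "B = attach_plane i j \<rho> \<beta> C" "\<beta> \<in> vecs ?J" "C \<in> alternating_of_rank ?J r"
        by auto
      then show "B \<in> {B \<in> alternating_of_rank I (r + 2). B i = \<rho>}"
        using iff bij_betwE[OF bij, rule_format, of "(\<beta>, C)"] alternating_of_rankD[of C] by auto
    next
      fix B assume B: "B \<in> {B \<in> alternating_of_rank I (r + 2). B i = \<rho>}"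
      then have "B \<in> (\<lambda>(\<beta>, C). attach_plane i j \<rho> \<beta> C) ` (vecs ?J \<times> alternating_on ?J)"
        unfolding bij_betw_imp_surj_on[OF bij] by (auto dest: alternating_of_rankD)
      then obtain \<beta> C where "B = attach_plane i j \<rho> \<beta> C" "\<beta> \<in> vecs ?J" "C \<in> alternating_on ?J"
        by (elim imageE) auto
      then show "B \<in> (\<lambda>(\<beta>, C). attach_plane i j \<rho> \<beta> C) ` (vecs ?J \<times> alternating_of_rank ?J r)"
        using B iff by auto
    qed
  qed
qed

section \<open>Character sums over alternating matrices\<close>

lemma vecs_Diff: "vecs (I - J) = {x \<in> vecs I. \<forall>i\<in>J. x i = 0}"
  unfolding vecs_def by blast

lemma card_row_fibre:
  fixes \<rho> :: "nat \<Rightarrow> 'a::{finite, field}"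
  assumes I: "finite I" "i \<in> I" and \<rho>: "\<rho> \<in> vecs (I - {i})" "\<rho> j \<noteq> 0"
  shows "card {B \<in> alternating_of_rank I (r + 2). B i = \<rho>} =
     CARD('a) ^ (card I - 2) * card (alternating_of_rank (I - {i, j}) r :: (nat \<Rightarrow> nat \<Rightarrow> 'a) set)"
proof -
  have j: "j \<in> I" "i \<noteq> j" using \<rho> by (auto simp: vecs_def)
  have "card (I - {i, j}) = card I - 2"
    using I j by (simp add: card_Diff_subset numeral_2_eq_2)
  then show ?thesis
    using bij_betw_same_card[OF bij_attach_plane_rank[OF I j \<rho>, of r]] I
    by (simp add: card_cartesian_product card_vecs)
qed

lemma alternating_row_in_vecs: "B \<in> alternating_on I \<Longrightarrow> B i \<in> vecs (I - {i})"
  using alternating_on_outside[of B I i] alternating_on_diag[of B I i] by (auto simp: vecs_def)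

text \<open>Each removal of a hyperbolic plane lowers the rank by two, and the process can stop only
  at the zero matrix.\<close>

lemma even_rank:
  fixes B :: "nat \<Rightarrow> nat \<Rightarrow> 'a::{finite, field}"
  assumes "finite I" "B \<in> alternating_on I"
  shows "\<exists>s. B \<in> alternating_of_rank I (2 * s)"
  using assms
proof (induction "card I" arbitrary: I B rule: less_induct)
  case less
  show ?case
  proof (cases "B = (\<lambda>_ _. 0)")
    case True
    then show ?thesis using zero_in_alternating_of_rank[OF less.prems(1)] by (intro exI[of _ 0]) simp
  next
    case False
    then obtain i j where ij: "B i j \<noteq> 0" by (auto simp: fun_eq_iff)
    have *: "i \<in> I" "j \<in> I" "i \<noteq> j"
      using ij alternating_on_outside[OF less.prems(2)] alternating_on_diag[OF less.prems(2)] by auto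
    note bij = bij_attach_plane[OF less.prems(1) * alternating_row_in_vecs[OF less.prems(2)] ij]
    have "B \<in> (\<lambda>(\<beta>, C). attach_plane i j (B i) \<beta> C) ` (vecs (I - {i, j}) \<times> alternating_on (I - {i, j}))"
      unfolding bij_betw_imp_surj_on[OF bij] using less.prems by simp
    then obtain \<beta> C where B: "B = attach_plane i j (B i) \<beta> C" "\<beta> \<in> vecs (I - {i, j})"
        and C: "C \<in> alternating_on (I - {i, j})"
      by (elim imageE) auto
    have "card (I - {i, j}) < card I"
      using less.prems * by (intro psubset_card_mono) auto
    from less.hyps[OF this _ C] obtain s where s: "C \<in> alternating_of_rank (I - {i, j}) (2 * s)"
      using less.prems by auto
    note bij' = bij_attach_plane_rank[OF less.prems(1) * alternating_row_in_vecs[OF less.prems(2)] ij, of "2 * s"]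
    have "attach_plane i j (B i) \<beta> C \<in> alternating_of_rank I (2 * s + 2)"
      using bij_betwE[OF bij', rule_format, of "(\<beta>, C)"] B s by auto
    then show ?thesis using B by (intro exI[of _ "Suc s"]) simp
  qed
qed

text \<open>Classification by row \<open>i\<close>: the zero row contributes the matrices on
  \<open>I - {i}\<close>, every other row a fibre of one fixed size. The index \<open>j\<close> to
  split off depends on the row, hence the hypothesis \<open>c\<close> that the count is the same for
  all \<open>j\<close>.\<close>

lemma card_alternating_of_rank_step:
  fixes I :: "nat set"
  assumes I: "finite I" "i \<in> I" and c: "\<And>j. j \<in> I - {i} \<Longrightarrow>
      card (alternating_of_rank (I - {i, j}) r :: (nat \<Rightarrow> nat \<Rightarrow> 'a::{finite, field}) set) = N"
  shows "card (alternating_of_rank I (r + 2) :: (nat \<Rightarrow> nat \<Rightarrow> 'a) set) =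
    card (alternating_of_rank (I - {i}) (r + 2) :: (nat \<Rightarrow> nat \<Rightarrow> 'a) set) +
    (CARD('a) ^ (card I - 1) - 1) * (CARD('a) ^ (card I - 2) * N)"
proof -
  let ?R = "alternating_of_rank I (r + 2) :: (nat \<Rightarrow> nat \<Rightarrow> 'a) set"
  let ?V = "vecs (I - {i}) - {\<lambda>_. 0} :: (nat \<Rightarrow> 'a) set"
  have "?R = {B \<in> ?R. B i = (\<lambda>_. 0)} \<union> (\<Union>\<rho>\<in>?V. {B \<in> ?R. B i = \<rho>})"
    using alternating_row_in_vecs by (auto dest: alternating_of_rankD)
  then have "card ?R = card ({B \<in> ?R. B i = (\<lambda>_. 0)} \<union> (\<Union>\<rho>\<in>?V. {B \<in> ?R. B i = \<rho>}))" by simp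
  also have "\<dots> = card {B \<in> ?R. B i = (\<lambda>_. 0)} + card (\<Union>\<rho>\<in>?V. {B \<in> ?R. B i = \<rho>})"
    using I by (intro card_Un_disjoint) auto
  also have "card (\<Union>\<rho>\<in>?V. {B \<in> ?R. B i = \<rho>}) = (\<Sum>\<rho>\<in>?V. card {B \<in> ?R. B i = \<rho>})"
    using I by (intro card_UN_disjoint) auto
  also have "\<dots> = (\<Sum>\<rho>\<in>?V. CARD('a) ^ (card I - 2) * N)"
  proof (intro sum.cong refl)
    fix \<rho> assume \<rho>: "\<rho> \<in> ?V"
    then obtain j where j: "\<rho> j \<noteq> 0" by (auto simp: fun_eq_iff)
    then have "j \<in> I - {i}" using \<rho> by (auto simp: vecs_def)
    then show "card {B \<in> ?R. B i = \<rho>} = CARD('a) ^ (card I - 2) * N"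
      using card_row_fibre[OF I, of \<rho> j r] \<rho> j c by simp
  qed
  also have "\<dots> = (CARD('a) ^ (card I - 1) - 1) * (CARD('a) ^ (card I - 2) * N)"
    using I by (simp add: card_Diff_singleton card_vecs)
  finally show ?thesis unfolding alternating_zero_row[OF I] .
qed

lemma CARD_field_gt_1: "CARD('a::{finite, field}) > 1"
proof -
  have "card {0, 1 :: 'a} \<le> CARD('a)" by (intro card_mono) auto
  then show ?thesis by simp
qed

text \<open>\<open>card_alternating_of_rank_step\<close> and \<open>F_number_at_0_rec\<close> are
  the same recurrence in the size of \<open>I\<close>.\<close>

lemma card_alternating_of_rank:
  fixes I :: "nat set"
  assumes "finite I"
  shows "real (card (alternating_of_rank I (2 * s) :: (nat \<Rightarrow> nat \<Rightarrow> 'a::{finite, field}) set)) =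
    F_number CARD('a) (int (card I)) (int s) 0"
  using assms
proof (induction "card I" arbitrary: I s rule: less_induct)
  case less
  let ?q = "CARD('a)"
  note q = CARD_field_gt_1[where 'a = 'a]
  show ?case
  proof (cases s)
    case 0
    then show ?thesis
      using alternating_of_rank_0[OF less.prems, where 'a = 'a] F_number_rank_0[OF q, of 0] by simp
  next
    case (Suc s')
    show ?thesis
    proof (cases "I = {}")
      case True
      have "card (matrix_radical {} B) \<ge> 1" for B :: "nat \<Rightarrow> nat \<Rightarrow> 'a"
      proof -
        have "(\<lambda>_. 0) \<in> matrix_radical {} B" by (simp add: matrix_radical_def)
        moreover have "finite (matrix_radical {} B)"
          by (rule finite_subset[OF _ finite_vecs[of "{}"]]) (auto simp: matrix_radical_def)
        ultimately show ?thesis by (metis One_nat_def Suc_leI card_gt_0_iff empty_iff)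
      qed
      then have "(alternating_of_rank {} (2 * s) :: (nat \<Rightarrow> nat \<Rightarrow> 'a) set) = {}"
        using q Suc by (auto simp: alternating_of_rank_def)
      then show ?thesis using F_number_at_0_small[OF q, of 0 s'] True Suc by simp
    next
      case False
      then obtain i where i: "i \<in> I" by blast
      have ci: "card (I - {i}) = card I - 1" "card I \<ge> 1" "card (I - {i}) < card I"
        using less.prems i card_gt_0_iff[of I] by (auto simp: Suc_le_eq)
      have IH1: "real (card (alternating_of_rank (I - {i}) (2 * s) :: (nat \<Rightarrow> nat \<Rightarrow> 'a) set)) =
          F_number ?q (int (card I - 1)) (int s) 0"
        using less.hyps[OF ci(3), of s] less.prems unfolding ci(1) by simp
      \<comment> \<open>One natural number is needed for all \<open>j\<close>; it is recovered from
        the real value of F by rounding down. If \<open>I\<close> has one element there is no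
        \<open>j\<close>, and the factor \<open>q^0 - 1\<close> removes \<open>N\<close> from the
        recurrence.\<close>
      define N where "N = (if card I = 1 then 0 else nat \<lfloor>F_number ?q (int (card I - 2)) (int s') 0\<rfloor>)"
      have N: "card (alternating_of_rank (I - {i, j}) (2 * s') :: (nat \<Rightarrow> nat \<Rightarrow> 'a) set) = N"
        "card I \<noteq> 1 \<Longrightarrow> real N = F_number ?q (int (card I - 2)) (int s') 0" if "j \<in> I - {i}" for j
      proof -
        have "card (I - {i, j}) = card I - 2"
          using less.prems i that by (auto simp: card_Diff_subset numeral_2_eq_2)
        moreover have "card (I - {i, j}) < card I"
          using less.prems i by (intro psubset_card_mono) auto
        ultimately have F: "real (card (alternating_of_rank (I - {i, j}) (2 * s') :: (nat \<Rightarrow> nat \<Rightarrow> 'a) set)) =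
          F_number ?q (int (card I - 2)) (int s') 0"
          using less.hyps[of "I - {i, j}" s'] less.prems by simp
        have "card I \<noteq> 1"
          using that i by (auto simp: card_1_singleton_iff)
        then show "card (alternating_of_rank (I - {i, j}) (2 * s') :: (nat \<Rightarrow> nat \<Rightarrow> 'a) set) = N"
          by (simp only: N_def F[symmetric] floor_of_nat nat_int if_False)
        then show "real N = F_number ?q (int (card I - 2)) (int s') 0"
          using F by (simp only:)
      qed
      have step: "card (alternating_of_rank I (2 * s) :: (nat \<Rightarrow> nat \<Rightarrow> 'a) set) =
        card (alternating_of_rank (I - {i}) (2 * s) :: (nat \<Rightarrow> nat \<Rightarrow> 'a) set) +
        (?q ^ (card I - 1) - 1) * (?q ^ (card I - 2) * N)"
        using card_alternating_of_rank_step[OF less.prems i N(1)] Suc by simp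
      show ?thesis
      proof (cases "card I = 1")
        case True
        then show ?thesis
          using step IH1 F_number_at_0_small[OF q, of 0 s'] F_number_at_0_small[OF q, of 1 s'] Suc
          by simp
      next
        case False
        then obtain m where m: "card I = m + 2" using ci(2)
          by (metis One_nat_def add.commute le_antisym less_eqE not_less_eq_eq numeral_2_eq_2)
        then have "I - {i} \<noteq> {}" using ci by (metis One_nat_def add_2_eq_Suc' card.empty diff_Suc_1 nat.simps(3))
        then obtain j where j: "j \<in> I - {i}" by blast
        have q1: "real (?q ^ (m + 1) - 1) = real ?q ^ (m + 1) - 1"
          using q by (simp add: of_nat_diff)
        show ?thesis
          unfolding step of_nat_add of_nat_mult IH1 using N(2)[OF j False] q1
          unfolding m Suc F_number_at_0_rec[OF q] by simp
      qed
    qed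
  qed
qed

lemma sum_pairs:
  fixes h :: "nat \<Rightarrow> 'b::comm_monoid_add"
  shows "(\<Sum>l=1..2*r. h l) = (\<Sum>k=1..r. h (2*k - 1) + h (2*k))"
  by (induction r) (auto simp: add.assoc)

section \<open>Orthogonality of additive characters\<close>

context
  fixes \<chi> :: "'a::{finite, field} \<Rightarrow> complex"
  assumes \<chi>: "nontrivial_additive_character \<chi>"
begin

lemma char_0: "\<chi> 0 = 1" and char_add: "\<chi> (x + y) = \<chi> x * \<chi> y"
  using \<chi> by (auto simp: nontrivial_additive_character_def)

lemma sum_char_UNIV: "(\<Sum>t\<in>UNIV. \<chi> t) = 0"
proof -
  obtain x where x: "\<chi> x \<noteq> 1" using \<chi> by (auto simp: nontrivial_additive_character_def)
  have "(\<Sum>t\<in>UNIV. \<chi> t) = (\<Sum>t\<in>UNIV. \<chi> (t + x))"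
    by (rule sum.reindex_bij_witness[of _ "\<lambda>t. t + x" "\<lambda>t. t - x"]) auto
  also have "\<dots> = (\<Sum>t\<in>UNIV. \<chi> t) * \<chi> x"
    by (simp only: char_add sum_distrib_right)
  finally have "(\<Sum>t\<in>UNIV. \<chi> t) = (\<Sum>t\<in>UNIV. \<chi> t) * \<chi> x" .
  then show ?thesis using x by simp
qed

lemma sum_char_mult: "(\<Sum>t\<in>UNIV. \<chi> (c * t)) = (if c = 0 then of_nat CARD('a) else 0)"
proof (cases "c = 0")
  case False
  have "(\<Sum>t\<in>UNIV. \<chi> (c * t)) = (\<Sum>t\<in>UNIV. \<chi> t)"
    by (rule sum.reindex_bij_witness[of _ "\<lambda>t. t / c" "\<lambda>t. c * t"]) (use False in auto)
  then show ?thesis using False sum_char_UNIV by simp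
qed (simp add: char_0)

lemma sum_char_vecs:
  assumes "finite I"
  shows "(\<Sum>x\<in>vecs I. \<chi> (\<Sum>l\<in>I. c l * x l)) =
    (if \<forall>l\<in>I. c l = 0 then of_nat CARD('a) ^ card I else 0)"
  using assms
proof (induction rule: finite_induct)
  case empty
  have "vecs {} = {\<lambda>_. 0 :: 'a}" by (auto simp: vecs_def)
  then show ?case by (simp add: char_0)
next
  case (insert i I)
  have *: "(\<Sum>l\<in>I. c l * (x(i := t)) l) = (\<Sum>l\<in>I. c l * x l)" for x t
    by (intro sum.cong) (use insert in auto)
  have "(\<Sum>x\<in>vecs (insert i I). \<chi> (\<Sum>l\<in>insert i I. c l * x l)) =
    (\<Sum>t\<in>UNIV. \<Sum>x\<in>vecs I. \<chi> (c i * t) * \<chi> (\<Sum>l\<in>I. c l * x l))"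
    unfolding sum_vecs_insert[OF insert(2)] using insert by (simp add: * char_add del: fun_upd_apply) simp
  also have "\<dots> = (\<Sum>t\<in>UNIV. \<chi> (c i * t)) * (\<Sum>x\<in>vecs I. \<chi> (\<Sum>l\<in>I. c l * x l))"
    by (simp only: sum_product)
  also have "\<dots> = (if \<forall>l\<in>insert i I. c l = 0 then of_nat CARD('a) ^ card (insert i I) else 0)"
    unfolding sum_char_mult insert.IH using insert by auto
  finally show ?case .
qed

text \<open>This sum arises when \<open>attach_plane\<close> is inserted into the sum over pairs.
  The exponent is linear in \<open>\<beta>\<close>; its coefficient at an index is, up to sign and
  the factor 1/b, the value of \<open>\<rho>\<close> at the other index of the pair. Orthogonality
  therefore forces \<open>\<rho>\<close> to vanish on all pairs.\<close>

lemma sum_char_paired: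
  assumes J: "finite J" "{1..2*r} \<subseteq> J" and b: "b \<noteq> 0"
  shows "(\<Sum>\<beta>\<in>vecs J. \<chi> (\<Sum>k=1..r. (\<rho> (2*k - 1) * \<beta> (2*k) - \<beta> (2*k - 1) * \<rho> (2*k)) / b)) =
    (if \<forall>l\<in>{1..2*r}. \<rho> l = 0 then of_nat CARD('a) ^ card J else 0)"
proof -
  define c where "c l = (if l \<in> {1..2*r} then if even l then \<rho> (l - 1) / b else - \<rho> (l + 1) / b else 0)" for l
  have c: "(\<Sum>k=1..r. (\<rho> (2*k - 1) * \<beta> (2*k) - \<beta> (2*k - 1) * \<rho> (2*k)) / b) = (\<Sum>l\<in>J. c l * \<beta> l)" for \<beta>
  proof -
    have "(\<Sum>l\<in>J. c l * \<beta> l) = (\<Sum>l=1..2*r. c l * \<beta> l)"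
      using J by (intro sum.mono_neutral_right) (auto simp: c_def)
    also have "\<dots> = (\<Sum>k=1..r. (\<rho> (2*k - 1) * \<beta> (2*k) - \<beta> (2*k - 1) * \<rho> (2*k)) / b)"
      unfolding sum_pairs
    proof (intro sum.cong refl)
      fix k assume k: "k \<in> {1..r}"
      then obtain k' where "k = Suc k'" by (cases k) auto
      then show "c (2*k - 1) * \<beta> (2*k - 1) + c (2*k) * \<beta> (2*k) =
        (\<rho> (2*k - 1) * \<beta> (2*k) - \<beta> (2*k - 1) * \<rho> (2*k)) / b"
        using k by (simp add: c_def diff_divide_distrib)
    qed
    finally show ?thesis ..
  qed
  have ev: "l - 1 \<in> {1..2*r}" if "l \<in> {1..2*r}" "even l" for l
    using that by (auto elim!: evenE)
  have od: "l + 1 \<in> {1..2*r}" if l: "l \<in> {1..2*r}" "odd l" for l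
  proof -
    obtain k where k: "l = 2 * k + 1" using l(2) by (elim oddE)
    then have "k < r" using l by simp
    then show ?thesis using k by auto
  qed
  have "(\<forall>l\<in>J. c l = 0) \<longleftrightarrow> (\<forall>l\<in>{1..2*r}. \<rho> l = 0)"
  proof
    assume L: "\<forall>l\<in>J. c l = 0"
    show "\<forall>l\<in>{1..2*r}. \<rho> l = 0"
    proof
      fix l assume l: "l \<in> {1..2*r}"
      show "\<rho> l = 0"
      proof (cases "even l")
        case True
        then have l': "l - 1 \<in> {1..2*r}" "odd (l - 1)" "l - 1 + 1 = l" using l by (auto elim!: evenE)
        then have "c (l - 1) = 0" using L J by blast
        then show ?thesis using l' b by (simp add: c_def)
      next
        case False
        then have l': "l + 1 \<in> {1..2*r}" "even (l + 1)" "l + 1 - 1 = l" using od[OF l] by auto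
        then have "c (l + 1) = 0" using L J by blast
        then show ?thesis using l' b False by (simp add: c_def)
      qed
    qed
  next
    assume "\<forall>l\<in>{1..2*r}. \<rho> l = 0"
    then show "\<forall>l\<in>J. c l = 0" using ev od by (simp add: c_def)
  qed
  then show ?thesis unfolding c sum_char_vecs[OF J(1)] by simp
qed

text \<open>The step from \<open>r\<close> to \<open>Suc r\<close> multiplies each summand by \<chi>
  of the entry at the new pair. Writing this factor as 1 - (1 - \<chi>) leaves the sum for
  \<open>r\<close> minus a sum that sees only matrices with nonzero entry there, from which the
  plane of the pair can be split off. The outcome is \<open>F_number_rec\<close>.\<close>

lemma alternating_character_sum:
  fixes I :: "nat set"
  assumes "finite I" "{1..2*r} \<subseteq> I"
  shows "(\<Sum>B\<in>alternating_of_rank I (2 * s). \<chi> (\<Sum>k=1..r. B (2*k - 1) (2*k))) =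
    complex_of_real (F_number CARD('a) (int (card I)) (int s) (int r))"
  using assms
proof (induction r arbitrary: I s)
  case 0
  have "complex_of_real (real (card (alternating_of_rank I (2 * s) :: (nat \<Rightarrow> nat \<Rightarrow> 'a) set))) =
    complex_of_real (F_number CARD('a) (int (card I)) (int s) 0)"
    by (simp only: card_alternating_of_rank[OF 0(1)])
  then show ?case by (simp add: char_0)
next
  case (Suc r)
  note I = Suc.prems
  note q = CARD_field_gt_1[where 'a = 'a]
  define i j where "i = 2*r + 1" and "j = 2*r + 2"
  define J where "J = I - {i, j}"
  define K where "K = I - {1..2*r+2}"
  have ij: "i \<in> I" "j \<in> I" "i \<noteq> j" using I(2) by (auto simp: i_def j_def)
  have J: "finite J" "{1..2*r} \<subseteq> J" using I by (auto simp: J_def i_def j_def)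
  have sub: "{1..2*r} \<subseteq> I" using I by auto
  have cI: "card I = card K + (2 * r + 2)"
    using card_Diff_subset[of "{1..2*r+2}" I] card_mono[OF I(1) I(2)] I by (simp add: K_def)
  have cJ: "card J = card K + 2 * r"
    using cI I ij by (simp add: J_def card_Diff_subset)
  define g where "g B = \<chi> (\<Sum>k=1..r. B (2*k - 1) (2*k))" for B
  have g: "\<chi> (\<Sum>k=1..Suc r. B (2*k - 1) (2*k)) = g B - g B * (1 - \<chi> (B i j))" for B
    by (simp add: g_def char_add i_def j_def algebra_simps)
  \<comment> \<open>The exponent collects \<open>card J = card K + 2 * r\<close> from the choice of
    \<open>\<beta>\<close>, \<open>card K\<close> from the free part of the row, and 1 from the sum
    over \<open>\<rho> j\<close>.\<close>
  have main: "(\<Sum>B\<in>alternating_of_rank I (2 * s + 2). g B * (1 - \<chi> (B i j))) =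
     of_nat CARD('a) ^ (2 * card K + 2 * r + 1) *
     (\<Sum>C\<in>alternating_of_rank J (2 * s). g C)" for s
  proof -
    let ?R = "alternating_of_rank I (2 * s + 2) :: (nat \<Rightarrow> nat \<Rightarrow> 'a) set"
    define S where "S = (\<Sum>C\<in>alternating_of_rank J (2 * s). g C)"
    have "(\<Sum>B\<in>?R. g B * (1 - \<chi> (B i j))) =
      (\<Sum>\<rho>\<in>vecs (I - {i}). \<Sum>B\<in>{B \<in> ?R. B i = \<rho>}. g B * (1 - \<chi> (B i j)))"
      using I by (intro sum.group[symmetric]) (auto intro: alternating_row_in_vecs[OF alternating_of_rankD])
    also have "\<dots> = (\<Sum>\<rho>\<in>vecs (I - {i}). if \<forall>l\<in>{1..2*r}. \<rho> l = 0 then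
        (1 - \<chi> (\<rho> j)) * of_nat CARD('a) ^ card J * S else 0)"
    proof (intro sum.cong refl)
      fix \<rho> :: "nat \<Rightarrow> 'a" assume \<rho>: "\<rho> \<in> vecs (I - {i})"
      show "(\<Sum>B\<in>{B \<in> ?R. B i = \<rho>}. g B * (1 - \<chi> (B i j))) = (if \<forall>l\<in>{1..2*r}. \<rho> l = 0 then
        (1 - \<chi> (\<rho> j)) * of_nat CARD('a) ^ card J * S else 0)"
      proof (cases "\<rho> j = 0")
        case True
        then show ?thesis by (simp add: char_0)
      next
        case False
        note bij = bij_attach_plane_rank[OF I(1) ij \<rho> False, of "2 * s", folded J_def]
        have ga: "g (attach_plane i j \<rho> \<beta> C) =
            \<chi> (\<Sum>k=1..r. (\<rho> (2*k - 1) * \<beta> (2*k) - \<beta> (2*k - 1) * \<rho> (2*k)) / \<rho> j) * g C" for \<beta> C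
        proof -
          have "(\<Sum>k=1..r. attach_plane i j \<rho> \<beta> C (2*k - 1) (2*k)) = (\<Sum>k=1..r. C (2*k - 1) (2*k) +
             (\<rho> (2*k - 1) * \<beta> (2*k) - \<beta> (2*k - 1) * \<rho> (2*k)) / \<rho> j)"
            by (intro sum.cong) (auto simp: attach_plane_def i_def)
          then show ?thesis by (simp add: g_def char_add sum.distrib)
        qed
        have "(\<Sum>B\<in>{B \<in> ?R. B i = \<rho>}. g B * (1 - \<chi> (B i j))) =
          (\<Sum>B\<in>{B \<in> ?R. B i = \<rho>}. g B * (1 - \<chi> (\<rho> j)))"
          by (intro sum.cong) auto
        also have "\<dots> = (\<Sum>(\<beta>, C)\<in>vecs J \<times> alternating_of_rank J (2 * s). g (attach_plane i j \<rho> \<beta> C) * (1 - \<chi> (\<rho> j)))"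
          by (subst sum.reindex_bij_betw[OF bij, symmetric]) (simp add: case_prod_unfold)
        also have "\<dots> = (1 - \<chi> (\<rho> j)) * ((\<Sum>\<beta>\<in>vecs J.
            \<chi> (\<Sum>k=1..r. (\<rho> (2*k - 1) * \<beta> (2*k) - \<beta> (2*k - 1) * \<rho> (2*k)) / \<rho> j)) * S)"
          unfolding ga S_def sum_product sum.cartesian_product
          by (simp add: sum_distrib_left case_prod_unfold mult_ac)
        also have "\<dots> = (if \<forall>l\<in>{1..2*r}. \<rho> l = 0 then
            (1 - \<chi> (\<rho> j)) * of_nat CARD('a) ^ card J * S else 0)"
          unfolding sum_char_paired[OF J False] by simp
        finally show ?thesis .
      qed
    qed
    also have "\<dots> = (\<Sum>\<rho>\<in>{\<rho>\<in>vecs (I - {i}). \<forall>l\<in>{1..2*r}. \<rho> l = 0}.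
        (1 - \<chi> (\<rho> j)) * of_nat CARD('a) ^ card J * S)"
      using I by (intro sum.inter_filter[symmetric]) auto
    \<comment> \<open>The surviving rows are free exactly at \<open>j\<close> and on
      \<open>K\<close>.\<close>
    also have "{\<rho>\<in>vecs (I - {i}). \<forall>l\<in>{1..2*r}. \<rho> l = 0} = (vecs (insert j K) :: (nat \<Rightarrow> 'a) set)"
    proof -
      have "k \<in> insert j K \<longleftrightarrow> k \<in> I - {i} - {1..2*r}" for k
        using ij unfolding K_def i_def j_def by (cases "k \<in> I") force+
      then have "insert j K = I - {i} - {1..2*r}" by blast
      then show ?thesis by (simp only: vecs_Diff)
    qed
    also have "(\<Sum>\<rho>\<in>vecs (insert j K). (1 - \<chi> (\<rho> j)) * of_nat CARD('a) ^ card J * S) =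
      (\<Sum>t\<in>UNIV. 1 - \<chi> t) * (of_nat CARD('a) ^ card K * of_nat CARD('a) ^ card J * S)"
      using I unfolding sum_distrib_right
      by (subst sum_vecs_insert) (auto simp: K_def j_def card_vecs intro!: sum.cong)
    also have "(\<Sum>t\<in>UNIV. 1 - \<chi> t) = of_nat CARD('a)"
      by (simp add: sum_subtractf sum_char_UNIV)
    finally show ?thesis
      by (simp add: S_def cJ power_add mult_2 mult_2_right mult_ac)
  qed
  have gI: "(\<Sum>B\<in>alternating_of_rank I (2 * s). g B) =
      complex_of_real (F_number CARD('a) (int (card I)) (int s) (int r))" for s
    unfolding g_def using Suc.IH[OF I(1) sub] .
  have gJ: "(\<Sum>B\<in>alternating_of_rank J (2 * s). g B) =
      complex_of_real (F_number CARD('a) (int (card J)) (int s) (int r))" for s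
    unfolding g_def using Suc.IH[OF J] .
  show ?case
  proof (cases s)
    case 0
    then show ?thesis using F_number_rank_0[OF q, of "Suc r" "card I"] cI
      by (simp add: alternating_of_rank_0[OF I(1)] char_0 zdiv_int)
  next
    case (Suc s')
    have e: "2 * (card K + 2 * r) + 1 - 2 * r = 2 * card K + 2 * r + 1" by simp
    have cIJ: "card I = card J + 2" using cI cJ by simp
    have "(\<Sum>B\<in>alternating_of_rank I (2 * s). \<chi> (\<Sum>k=1..Suc r. B (2*k - 1) (2*k))) =
      (\<Sum>B\<in>alternating_of_rank I (2 * s). g B) - (\<Sum>B\<in>alternating_of_rank I (2 * s' + 2). g B * (1 - \<chi> (B i j)))"
      unfolding g sum_subtractf Suc by simp
    also have "\<dots> = complex_of_real (F_number CARD('a) (int (card I)) (int s) (int (Suc r)))"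
      unfolding main gI gJ Suc cIJ using F_number_rec[OF q, of r "card J" s'] cJ
      by (simp add: e add.commute[of "2 * r"] del: of_nat_Suc of_nat_add)
    finally show ?thesis .
  qed
qed

end

section \<open>Diagonals and Gauss sums in even characteristic\<close>

text \<open>Each unordered pair is counted once; over all ordered pairs the terms of a symmetric
  \<open>B\<close> would cancel in characteristic 2.\<close>

definition cross_terms :: "nat \<Rightarrow> (nat \<Rightarrow> nat \<Rightarrow> 'a::comm_ring) \<Rightarrow> (nat \<Rightarrow> 'a) \<Rightarrow> 'a" where
  "cross_terms m B x = (\<Sum>j=1..m. \<Sum>i=1..<j. B i j * x i * x j)"

definition matrix_quad ::
  "nat \<Rightarrow> (nat \<Rightarrow> nat \<Rightarrow> 'a::comm_ring_1) \<Rightarrow> (nat \<Rightarrow> 'a) \<Rightarrow> (nat \<Rightarrow> 'a) \<Rightarrow> 'a" where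
  "matrix_quad m B d x = (\<Sum>i=1..m. d i * (x i)\<^sup>2) + cross_terms m B x"

text \<open>For an alternating \<open>B\<close> in even characteristic this decides the rank of the
  form: it is the rank of \<open>B\<close> if the condition holds and one more otherwise.\<close>

definition vanishes_on_radical ::
  "nat \<Rightarrow> (nat \<Rightarrow> nat \<Rightarrow> 'a::comm_ring_1) \<Rightarrow> (nat \<Rightarrow> 'a) \<Rightarrow> bool" where
  "vanishes_on_radical m B d \<longleftrightarrow> (\<forall>x\<in>matrix_radical {1..m} B. matrix_quad m B d x = 0)"

definition gauss_sum ::
  "('a::comm_ring_1 \<Rightarrow> complex) \<Rightarrow> nat \<Rightarrow> (nat \<Rightarrow> nat \<Rightarrow> 'a) \<Rightarrow> (nat \<Rightarrow> 'a) \<Rightarrow> complex" where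
  "gauss_sum \<chi> m B d = (\<Sum>x\<in>vecs {1..m}. \<chi> (matrix_quad m B d x))"

lemma matrix_quad_scale: "matrix_quad m B d (\<lambda>i. c * x i) = c\<^sup>2 * matrix_quad m B d x"
  by (simp add: matrix_quad_def cross_terms_def sum_distrib_left distrib_left power_mult_distrib
      power2_eq_square mult_ac)

lemma radical_add:
  "x \<in> matrix_radical I B \<Longrightarrow> y \<in> matrix_radical I B \<Longrightarrow> (\<lambda>i. x i + y i) \<in> matrix_radical I B"
  by (simp add: matrix_radical_def vecs_def distrib_left sum.distrib)

lemma radical_scale:
  fixes B :: "nat \<Rightarrow> nat \<Rightarrow> 'a::comm_ring"
  assumes "x \<in> matrix_radical I B"
  shows "(\<lambda>i. c * x i) \<in> matrix_radical I B"
proof -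
  have "(\<Sum>j\<in>I. B i j * (c * x j)) = c * (\<Sum>j\<in>I. B i j * x j)" for i
    by (simp add: sum_distrib_left mult.left_commute)
  then show ?thesis using assms by (simp add: matrix_radical_def vecs_def)
qed

lemma finite_radical [simp]:
  "finite I \<Longrightarrow> finite (matrix_radical I B :: (nat \<Rightarrow> 'a::{finite, semiring_0}) set)"
  by (rule finite_subset[OF _ finite_vecs[of I]]) (auto simp: matrix_radical_def)

section \<open>Characteristic 2 and quadratic forms on the radical\<close>

context
  assumes even_card: "even CARD('a::finite_field)"
begin

text \<open>-1 equals its q-th power, which is 1 because q is even.\<close>

lemma neg_eq_self: "- x = (x :: 'a)"
proof -
  have "(- 1 :: 'a) = (- 1) ^ CARD('a)" using finite_field_power_card_eq_same[of "- 1 :: 'a"] by simp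
  also have "\<dots> = 1" using even_card by simp
  finally have "- 1 = (1 :: 'a)" .
  then have "- 1 * x = 1 * x" by (simp only:)
  then show ?thesis by simp
qed

lemma add_self: "x + x = (0 :: 'a)"
proof -
  have "x + x = x + - x" by (simp only: neg_eq_self)
  then show ?thesis by simp
qed

lemma add_self_left: "x + (x + y) = (y :: 'a)"
  by (simp add: add_self flip: add.assoc)

lemma diff_eq_add: "x - y = x + (y :: 'a)"
  unfolding diff_conv_add_uminus neg_eq_self ..

lemma square_add: "(x + y)\<^sup>2 = x\<^sup>2 + (y :: 'a)\<^sup>2"
proof -
  have "2 * x * y = 0" unfolding mult_2 distrib_right by (rule add_self)
  then show ?thesis by (simp add: power2_sum)
qed

text \<open>\<open>x = x^q\<close> is the square of \<open>x^(q/2)\<close>.\<close>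

lemma square_surj: "\<exists>y. y\<^sup>2 = (x :: 'a)"
proof -
  obtain h where h: "CARD('a) = 2 * h" using even_card by (elim evenE)
  have "(x ^ h)\<^sup>2 = x ^ CARD('a)" unfolding h mult.commute[of 2 h] power_mult ..
  then show ?thesis using finite_field_power_card_eq_same[of x] by auto
qed

lemma square_eq_iff: "x\<^sup>2 = y\<^sup>2 \<longleftrightarrow> x = (y :: 'a)"
proof
  assume "x\<^sup>2 = y\<^sup>2"
  then have "(x + y)\<^sup>2 = 0" by (simp add: square_add add_self)
  then show "x = y" using neg_eq_self[of y] by (simp add: add_eq_0_iff2)
qed simp

lemma cross_terms_add:
  fixes B :: "nat \<Rightarrow> nat \<Rightarrow> 'a"
  assumes "B \<in> alternating_on I"
  shows "cross_terms m B (\<lambda>i. x i + y i) =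
    cross_terms m B x + cross_terms m B y + (\<Sum>i=1..m. \<Sum>j=1..m. B i j * x i * y j)"
proof (induction m)
  case 0
  then show ?case by (simp add: cross_terms_def)
next
  case (Suc m)
  have Suc_cross: "cross_terms (Suc m) B x = cross_terms m B x + (\<Sum>i=1..m. B i (Suc m) * x i * x (Suc m))" for x
    unfolding cross_terms_def by (simp add: atLeastLessThanSuc_atLeastAtMost)
  have sym: "B i j = B j i" for i j
    using alternating_on_swap[OF assms, of i j] neg_eq_self by simp
  have "(\<Sum>i=1..Suc m. \<Sum>j=1..Suc m. B i j * x i * y j) = (\<Sum>i=1..m. \<Sum>j=1..m. B i j * x i * y j) +
     (\<Sum>i=1..m. B i (Suc m) * x i * y (Suc m)) + (\<Sum>i=1..m. B i (Suc m) * x (Suc m) * y i)"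
    using alternating_on_diag[OF assms] sym[of "Suc m"] by (simp add: sum.distrib add.assoc)
  then show ?case unfolding Suc_cross Suc
    by (simp add: distrib_left distrib_right sum.distrib mult_ac add_ac)
qed

lemma matrix_quad_add:
  fixes B :: "nat \<Rightarrow> nat \<Rightarrow> 'a"
  assumes "B \<in> alternating_on I"
  shows "matrix_quad m B d (\<lambda>i. x i + y i) =
    matrix_quad m B d x + matrix_quad m B d y + (\<Sum>i=1..m. \<Sum>j=1..m. B i j * x i * y j)"
  unfolding matrix_quad_def cross_terms_add[OF assms]
  by (simp add: square_add distrib_left sum.distrib add_ac)

lemma matrix_quad_add_radical:
  fixes B :: "nat \<Rightarrow> nat \<Rightarrow> 'a"
  assumes "B \<in> alternating_on I" "z \<in> matrix_radical {1..m} B"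
  shows "matrix_quad m B d (\<lambda>i. x i + z i) = matrix_quad m B d x + matrix_quad m B d z"
proof -
  have "(\<Sum>i=1..m. \<Sum>j=1..m. B i j * x i * z j) = (\<Sum>i=1..m. x i * (\<Sum>j=1..m. B i j * z j))"
    by (simp add: sum_distrib_left mult_ac)
  then show ?thesis using assms(2) unfolding matrix_quad_add[OF assms(1)] matrix_radical_def by simp
qed

text \<open>On the radical the form is additive and takes every value, since it is not identically
  zero there and every scalar is a square. Its zero set therefore has index q: \<open>w c\<close> is
  a chosen radical vector of value \<open>c\<close>, and translation by it identifies the
  fibres.\<close>

lemma card_singular_radical:
  fixes B :: "nat \<Rightarrow> nat \<Rightarrow> 'a"
  assumes B: "B \<in> alternating_on {1..m}" and nv: "\<not> vanishes_on_radical m B d"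
  shows "card (matrix_radical {1..m} B) =
     CARD('a) * card {x \<in> matrix_radical {1..m} B. matrix_quad m B d x = 0}"
proof -
  let ?R = "matrix_radical {1..m} B" and ?Q = "matrix_quad m B d"
  obtain z where z: "z \<in> ?R" "?Q z \<noteq> 0" using nv by (auto simp: vanishes_on_radical_def)
  define w where "w c = (SOME w. w \<in> ?R \<and> ?Q w = c)" for c
  have w: "w c \<in> ?R \<and> ?Q (w c) = c" for c
  proof -
    obtain a where "a\<^sup>2 = c / ?Q z" using square_surj by blast
    then have "(\<lambda>i. a * z i) \<in> ?R \<and> ?Q (\<lambda>i. a * z i) = c"
      using z radical_scale[OF z(1)] by (simp add: matrix_quad_scale)
    then show ?thesis unfolding w_def by (rule someI[of "\<lambda>w. w \<in> ?R \<and> ?Q w = c"])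
  qed
  have "bij_betw (\<lambda>(c, x) i. x i + w c i) (UNIV \<times> {x \<in> ?R. ?Q x = 0}) ?R"
  proof (rule bij_betw_byWitness[where f' = "\<lambda>x. (?Q x, \<lambda>i. x i + w (?Q x) i)"])
    have *: "?Q (\<lambda>i. x i + w c i) = ?Q x + c" for x c
      using matrix_quad_add_radical[OF B, of "w c" m d x] w[of c] by simp
    show "\<forall>p\<in>UNIV \<times> {x \<in> ?R. ?Q x = 0}. (?Q ((\<lambda>(c, x) i. x i + w c i) p),
        \<lambda>i. (\<lambda>(c, x) i. x i + w c i) p i + w (?Q ((\<lambda>(c, x) i. x i + w c i) p)) i) = p"
      by (auto simp: * add.assoc add_self)
    show "\<forall>x\<in>?R. (\<lambda>(c, x) i. x i + w c i) (?Q x, \<lambda>i. x i + w (?Q x) i) = x"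
      by (auto simp: add.assoc add_self)
    show "(\<lambda>(c, x) i. x i + w c i) ` (UNIV \<times> {x \<in> ?R. ?Q x = 0}) \<subseteq> ?R"
      using w by (auto intro: radical_add)
    show "(\<lambda>x. (?Q x, \<lambda>i. x i + w (?Q x) i)) ` ?R \<subseteq> UNIV \<times> {x \<in> ?R. ?Q x = 0}"
      using w by (auto intro: radical_add simp: * add_self)
  qed
  from bij_betw_same_card[OF this] show ?thesis by (simp add: card_cartesian_product)
qed

section \<open>Character sums over radicals and diagonals\<close>

context
  fixes \<chi> :: "'a \<Rightarrow> complex"
  assumes \<chi>: "nontrivial_additive_character \<chi>"
begin

text \<open>The shift permutes the summands and multiplies the sum by \<open>\<chi> c\<close>, which
  differs from 1.\<close>

lemma sum_shift_invariant:
  fixes f :: "'b \<Rightarrow> 'a"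
  assumes "bij_betw h A A" "\<And>x. x \<in> A \<Longrightarrow> f (h x) = f x + c" "\<chi> c \<noteq> 1"
  shows "(\<Sum>x\<in>A. \<chi> (f x)) = 0"
proof -
  have "(\<Sum>x\<in>A. \<chi> (f x)) = (\<Sum>x\<in>A. \<chi> (f (h x)))"
    by (rule sum.reindex_bij_betw[OF assms(1), symmetric])
  also have "\<dots> = (\<Sum>x\<in>A. \<chi> (f x) * \<chi> c)"
    using assms(2) by (simp add: char_add[OF \<chi>])
  also have "\<dots> = (\<Sum>x\<in>A. \<chi> (f x)) * \<chi> c" by (simp only: sum_distrib_right)
  finally show ?thesis using assms(3) by simp
qed

text \<open>Scaling by a square root moves a nonzero value of the form to any prescribed value, in
  particular to one where \<chi> is not 1.\<close>

lemma radical_char_witness: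
  fixes B :: "nat \<Rightarrow> nat \<Rightarrow> 'a"
  assumes "\<not> vanishes_on_radical m B d"
  obtains z where "z \<in> matrix_radical {1..m} B" "\<chi> (matrix_quad m B d z) \<noteq> 1"
proof -
  obtain z where z: "z \<in> matrix_radical {1..m} B" "matrix_quad m B d z \<noteq> 0"
    using assms by (auto simp: vanishes_on_radical_def)
  obtain t where t: "\<chi> t \<noteq> 1" using \<chi> by (auto simp: nontrivial_additive_character_def)
  obtain a where "a\<^sup>2 = t / matrix_quad m B d z" using square_surj by blast
  then have "matrix_quad m B d (\<lambda>i. a * z i) = t" using z by (simp add: matrix_quad_scale)
  then show thesis using that[of "\<lambda>i. a * z i"] radical_scale[OF z(1)] t by simp
qed

lemma bij_betw_shift:
  assumes "\<And>x. x \<in> A \<Longrightarrow> (\<lambda>i. x i + z i) \<in> A"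
  shows "bij_betw (\<lambda>x i. x i + z i :: 'a) A A"
  by (rule bij_betw_byWitness[where f' = "\<lambda>x i. x i + z i"]) (use assms in \<open>auto simp: add.assoc add_self\<close>)

text \<open>On the radical the form is additive, so \<chi> composed with it is a character there,
  and orthogonality applies.\<close>

lemma sum_radical_char:
  fixes B :: "nat \<Rightarrow> nat \<Rightarrow> 'a"
  assumes B: "B \<in> alternating_on {1..m}"
  shows "(\<Sum>x\<in>matrix_radical {1..m} B. \<chi> (matrix_quad m B d x)) =
     (if vanishes_on_radical m B d then of_nat (card (matrix_radical {1..m} B)) else 0)"
proof (cases "vanishes_on_radical m B d")
  case True
  then show ?thesis by (simp add: vanishes_on_radical_def char_0[OF \<chi>])
next
  case False
  obtain z where z: "z \<in> matrix_radical {1..m} B" "\<chi> (matrix_quad m B d z) \<noteq> 1"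
    using radical_char_witness[OF False] .
  have "(\<Sum>x\<in>matrix_radical {1..m} B. \<chi> (matrix_quad m B d x)) = 0"
    by (rule sum_shift_invariant[where h = "\<lambda>x i. x i + z i", OF _ _ z(2)])
      (use z in \<open>auto intro!: bij_betw_shift radical_add matrix_quad_add_radical[OF B]\<close>)
  then show ?thesis using False by simp
qed

lemma gauss_sum_eq_0:
  fixes B :: "nat \<Rightarrow> nat \<Rightarrow> 'a"
  assumes B: "B \<in> alternating_on {1..m}" and nv: "\<not> vanishes_on_radical m B d"
  shows "gauss_sum \<chi> m B d = 0"
proof -
  obtain z where z: "z \<in> matrix_radical {1..m} B" "\<chi> (matrix_quad m B d z) \<noteq> 1"
    using radical_char_witness[OF nv] .
  show ?thesis unfolding gauss_sum_def
    by (rule sum_shift_invariant[where h = "\<lambda>x i. x i + z i", OF _ _ z(2)])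
      (use z in \<open>auto intro!: bij_betw_shift matrix_quad_add_radical[OF B] simp: matrix_radical_def vecs_def\<close>)
qed

context
  fixes m :: nat and z0 :: "nat \<Rightarrow> 'a"
  assumes z0: "z0 \<in> vecs {1..m}" "\<And>i. (z0 i)\<^sup>2 = z0 i"
begin

text \<open>The exponent is affine in \<open>d\<close>, with coefficients
  \<open>(z i)\<^sup>2 + z0 i\<close>. As the entries of \<open>z0\<close> are idempotent, these are
  the squares of \<open>z i + z0 i\<close>, so orthogonality singles out
  \<open>z = z0\<close>.\<close>

lemma sum_diag_char:
  assumes "z \<in> vecs {1..m}"
  shows "(\<Sum>d\<in>vecs {1..m}. \<chi> (matrix_quad m B d z) * \<chi> (\<Sum>i=1..m. d i * z0 i)) =
    (if z = z0 then of_nat CARD('a) ^ m * \<chi> (cross_terms m B z0) else 0)"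
proof -
  have "(\<Sum>d\<in>vecs {1..m}. \<chi> (matrix_quad m B d z) * \<chi> (\<Sum>i=1..m. d i * z0 i)) =
    \<chi> (cross_terms m B z) * (\<Sum>d\<in>vecs {1..m}. \<chi> (\<Sum>i=1..m. ((z i)\<^sup>2 + z0 i) * d i))"
    by (simp add: matrix_quad_def char_add[OF \<chi>] sum_distrib_left distrib_left distrib_right sum.distrib mult_ac)
  moreover have "(\<forall>i\<in>{1..m}. (z i)\<^sup>2 + z0 i = 0) \<longleftrightarrow> z = z0"
  proof
    assume a: "\<forall>i\<in>{1..m}. (z i)\<^sup>2 + z0 i = 0"
    have "z i = z0 i" for i
    proof (cases "i \<in> {1..m}")
      case True
      then have "(z i)\<^sup>2 + (z0 i)\<^sup>2 = 0" using a z0(2)[of i] by simp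
      then have "(z i)\<^sup>2 = (z0 i)\<^sup>2" using neg_eq_self[of "(z0 i)\<^sup>2"] by (simp add: add_eq_0_iff2)
      then show ?thesis by (simp add: square_eq_iff)
    qed (use assms z0(1) in \<open>simp add: vecs_def\<close>)
    then show "z = z0" ..
  next
    assume "z = z0"
    then show "\<forall>i\<in>{1..m}. (z i)\<^sup>2 + z0 i = 0" using z0(2) by (simp add: add_self)
  qed
  ultimately show ?thesis
    using sum_char_vecs[OF \<chi>, of "{1..m}" "\<lambda>i. (z i)\<^sup>2 + z0 i"] by auto
qed

lemma sum_all_diagonals:
  "(\<Sum>d\<in>vecs {1..m}. \<chi> (\<Sum>i=1..m. d i * z0 i)) = (if z0 = (\<lambda>_. 0) then of_nat CARD('a) ^ m else 0)"
  using sum_diag_char[of "\<lambda>_. 0" "\<lambda>_ _. 0"]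
  by (auto simp: matrix_quad_def cross_terms_def char_0[OF \<chi>])

text \<open>After exchanging the sums only \<open>z = z0\<close> contributes. The result does not
  depend on \<open>B\<close>, which is why the Gauss part of a P-number runs over all alternating
  matrices of a given rank.\<close>

lemma sum_gauss_sum:
  assumes "cross_terms m B z0 = 0"
  shows "(\<Sum>d\<in>vecs {1..m}. gauss_sum \<chi> m B d * \<chi> (\<Sum>i=1..m. d i * z0 i)) = of_nat CARD('a) ^ m"
proof -
  have "(\<Sum>d\<in>vecs {1..m}. gauss_sum \<chi> m B d * \<chi> (\<Sum>i=1..m. d i * z0 i)) =
    (\<Sum>z\<in>vecs {1..m}. \<Sum>d\<in>vecs {1..m}. \<chi> (matrix_quad m B d z) * \<chi> (\<Sum>i=1..m. d i * z0 i))"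
    unfolding gauss_sum_def sum_distrib_right by (rule sum.swap)
  also have "\<dots> = (\<Sum>z\<in>vecs {1..m}. if z = z0 then of_nat CARD('a) ^ m else 0)"
    by (intro sum.cong refl) (subst sum_diag_char, auto simp: assms char_0[OF \<chi>])
  finally show ?thesis using z0(1) by simp
qed

text \<open>The indicator of vanishing is the sum of \<chi> over the radical divided by the size of
  the radical. Exchanging the sums leaves only \<open>z = z0\<close>, provided that it lies in the
  radical, and q^m divided by that size is \<open>q^r\<close>.\<close>

lemma sum_vanishing_diagonals:
  assumes B: "B \<in> alternating_of_rank {1..m} r" and c: "cross_terms m B z0 = 0"
  shows "(\<Sum>d\<in>{d\<in>vecs {1..m}. vanishes_on_radical m B d}. \<chi> (\<Sum>i=1..m. d i * z0 i)) =
    (if z0 \<in> matrix_radical {1..m} B then of_nat CARD('a) ^ r else 0)"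
proof -
  let ?R = "matrix_radical {1..m} B"
  let ?N = "of_nat (card ?R) :: complex"
  let ?S = "\<Sum>d\<in>{d\<in>vecs {1..m}. vanishes_on_radical m B d}. \<chi> (\<Sum>i=1..m. d i * z0 i)"
  note Ba = alternating_of_rankD[OF B]
  have "?N * ?S = (\<Sum>d\<in>vecs {1..m}. if vanishes_on_radical m B d then ?N * \<chi> (\<Sum>i=1..m. d i * z0 i) else 0)"
    unfolding sum_distrib_left by (rule sum.inter_filter) simp
  also have "\<dots> = (\<Sum>d\<in>vecs {1..m}. (\<Sum>z\<in>?R. \<chi> (matrix_quad m B d z)) * \<chi> (\<Sum>i=1..m. d i * z0 i))"
    unfolding sum_radical_char[OF Ba] by (intro sum.cong) auto
  also have "\<dots> = (\<Sum>z\<in>?R. \<Sum>d\<in>vecs {1..m}. \<chi> (matrix_quad m B d z) * \<chi> (\<Sum>i=1..m. d i * z0 i))"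
    unfolding sum_distrib_right by (rule sum.swap)
  also have "\<dots> = (\<Sum>z\<in>?R. if z = z0 then of_nat CARD('a) ^ m else 0)"
    by (intro sum.cong refl) (subst sum_diag_char, auto simp: matrix_radical_def c char_0[OF \<chi>])
  also have "\<dots> = (if z0 \<in> ?R then of_nat CARD('a) ^ m else 0)" by simp
  also have "\<dots> = ?N * (if z0 \<in> ?R then of_nat CARD('a) ^ r else 0)"
    using B by (simp add: alternating_of_rank_def flip: of_nat_power of_nat_mult)
  finally have eq: "?N * ?S = ?N * (if z0 \<in> ?R then of_nat CARD('a) ^ r else 0)" .
  have "?N \<noteq> 0"
  proof -
    have "(\<lambda>_. 0) \<in> ?R" by (simp add: matrix_radical_def)
    then show ?thesis by (auto simp: card_eq_0_iff)
  qed
  from iffD1[OF mult_left_cancel[OF this] eq] show ?thesis .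
qed

end

end

end

section \<open>Coordinates of quadratic forms\<close>

lemma power_card_inject: "CARD('a::{finite, field}) ^ i = CARD('a) ^ j \<longleftrightarrow> i = j"
  using CARD_field_gt_1[where 'a = 'a] by (simp add: power_inject_exp)

lemma vector_space_field: "vector_space ((*) :: 'a::field \<Rightarrow> 'a \<Rightarrow> 'a)"
  by unfold_locales (simp_all add: algebra_simps)

lemma vecs_eqI: "x \<in> vecs I \<Longrightarrow> y \<in> vecs I \<Longrightarrow> (\<And>i. i \<in> I \<Longrightarrow> x i = y i) \<Longrightarrow> x = y"
  unfolding vecs_def by (auto simp: fun_eq_iff) metis

lemma matrix_quad_cong:
  assumes "\<And>i. i \<in> {1..m} \<Longrightarrow> x i = y i"
  shows "matrix_quad m B d x = matrix_quad m B d y"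
  unfolding matrix_quad_def cross_terms_def
  by (intro arg_cong2[where f = "(+)"] sum.cong refl) (use assms in auto)

lemma sum_mult_delta:
  fixes f :: "'b \<Rightarrow> 'c::semiring_1"
  assumes "finite A" "j \<in> A"
  shows "(\<Sum>l\<in>A. f l * (if l = j then 1 else 0)) = f j"
  using assms by (subst sum.remove[of A j]) (auto intro!: sum.neutral)

locale finite_form_space = vector_space scale
  for scale :: "'a::finite_field \<Rightarrow> 'v::ab_group_add \<Rightarrow> 'v" +
  assumes dim_pos: "vdim scale \<ge> 1"
begin

abbreviation dim_V :: nat where "dim_V \<equiv> vdim scale"

section \<open>Bases, sizes of subspaces and codimensions\<close>

definition lincomb :: "nat \<Rightarrow> (nat \<Rightarrow> 'v) \<Rightarrow> (nat \<Rightarrow> 'a) \<Rightarrow> 'v" where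
  "lincomb n b x = (\<Sum>i=1..n. scale (x i) (b i))"

lemma lincomb_add: "lincomb n b (\<lambda>i. x i + y i) = lincomb n b x + lincomb n b y"
  by (simp add: lincomb_def scale_left_distrib sum.distrib)

lemma lincomb_scale: "lincomb n b (\<lambda>i. c * x i) = scale c (lincomb n b x)"
  by (simp add: lincomb_def scale_sum_right)

lemma lincomb_diff: "lincomb n b (\<lambda>i. x i - y i) = lincomb n b x - lincomb n b y"
  by (simp add: lincomb_def scale_left_diff_distrib sum_subtractf)

lemma lincomb_cong: "(\<And>i. i \<in> {1..n} \<Longrightarrow> x i = y i) \<Longrightarrow> (\<And>i. i \<in> {1..n} \<Longrightarrow> b i = c i) \<Longrightarrow> lincomb n b x = lincomb n c y"
  unfolding lincomb_def by (intro sum.cong) auto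

lemma lincomb_unit: "t \<in> {1..n} \<Longrightarrow> lincomb n b (\<lambda>i. if i = t then c else 0) = scale c (b t)"
  unfolding lincomb_def by (subst sum.remove[of _ t]) (auto intro!: sum.neutral)

lemma lincomb_inj_imp_independent:
  assumes "\<And>x. lincomb n b x = 0 \<Longrightarrow> \<forall>i\<in>{1..n}. x i = 0"
  shows "inj_on b {1..n}" "independent (b ` {1..n})"
proof -
  show inj: "inj_on b {1..n}"
  proof (rule inj_onI, rule ccontr)
    fix i j assume ij: "i \<in> {1..n}" "j \<in> {1..n}" "b i = b j" "i \<noteq> j"
    let ?x = "\<lambda>k. (if k = i then 1 else 0) - (if k = j then 1 else (0 :: 'a))"
    have "lincomb n b ?x = 0"
      unfolding lincomb_diff using ij by (simp add: lincomb_unit)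
    from bspec[OF assms[OF this] ij(1)] ij(4) show False by simp
  qed
  show "independent (b ` {1..n})"
  proof (rule independent_if_scalars_zero)
    fix f v assume f: "(\<Sum>x\<in>b ` {1..n}. scale (f x) x) = 0" and "v \<in> b ` {1..n}"
    then obtain i where i: "v = b i" "i \<in> {1..n}" by blast
    have "lincomb n b (\<lambda>i. f (b i)) = 0"
      using f unfolding lincomb_def sum.reindex[OF inj] comp_def .
    from bspec[OF assms[OF this] i(2)] show "f v = 0" using i by simp
  qed simp
qed

text \<open>Independent vectors give unique coordinates on their span; comparing sizes of both sides
  stands in for dimension arguments.\<close>

lemma lincomb_bij_span:
  assumes "inj_on b {1..n}" "independent (b ` {1..n})"
  shows "bij_betw (lincomb n b) (vecs {1..n}) (span (b ` {1..n}))"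
proof (rule bij_betw_imageI)
  have zero: "x i = 0" if "lincomb n b x = 0" "i \<in> {1..n}" for x i
  proof -
    have "(\<Sum>v\<in>b ` {1..n}. scale (x (the_inv_into {1..n} b v)) v) = lincomb n b x"
      unfolding sum.reindex[OF assms(1)] lincomb_def comp_def
      by (intro sum.cong refl) (simp only: the_inv_into_f_f[OF assms(1)])
    then have "(\<Sum>v\<in>b ` {1..n}. scale (x (the_inv_into {1..n} b v)) v) = 0" using that(1) by simp
    then have "x (the_inv_into {1..n} b (b i)) = 0"
      using that(2) by (intro independentD[OF assms(2)]) auto
    then show ?thesis using that(2) by (simp only: the_inv_into_f_f[OF assms(1)])
  qed
  show "inj_on (lincomb n b) (vecs {1..n})"
  proof (rule inj_onI)
    fix x y assume xy: "x \<in> vecs {1..n}" "y \<in> vecs {1..n}" "lincomb n b x = lincomb n b y"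
    then have "lincomb n b (\<lambda>i. x i - y i) = 0" by (simp add: lincomb_diff)
    from zero[OF this] show "x = y" using xy by (intro vecs_eqI) auto
  qed
  show "lincomb n b ` vecs {1..n} = span (b ` {1..n})"
  proof
    show "lincomb n b ` vecs {1..n} \<subseteq> span (b ` {1..n})"
      unfolding lincomb_def by (intro image_subsetI span_sum span_scale span_base imageI)
    show "span (b ` {1..n}) \<subseteq> lincomb n b ` vecs {1..n}"
    proof
      fix v assume "v \<in> span (b ` {1..n})"
      then obtain f where v: "v = (\<Sum>x\<in>b ` {1..n}. scale (f x) x)"
        by (subst (asm) span_finite) auto
      then have "v = lincomb n b (\<lambda>i. if i \<in> {1..n} then f (b i) else 0)"
        unfolding lincomb_def sum.reindex[OF assms(1)] comp_def by simp
      then show "v \<in> lincomb n b ` vecs {1..n}"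
        by (rule image_eqI[where f = "lincomb n b"]) (simp add: vecs_def)
    qed
  qed
qed

lemma subspace_enum:
  assumes W: "subspace W" and fin: "\<And>B. B \<subseteq> W \<Longrightarrow> independent B \<Longrightarrow> finite B"
  obtains b where "bij_betw (lincomb (dim W) b) (vecs {1..dim W}) W"
    "inj_on b {1..dim W}" "independent (b ` {1..dim W})"
proof -
  obtain B where B: "B \<subseteq> W" "independent B" "W \<subseteq> span B" "card B = dim W"
    using basis_exists by blast
  then have "finite B" using fin by blast
  then obtain b where "bij_betw b {1..card B} B"
    using ex_bij_betw_nat_finite_1 by blast
  then have b: "inj_on b {1..dim W}" "b ` {1..dim W} = B"
    using B by (auto simp: bij_betw_def)
  have "W = span B" using B W by (simp add: span_subspace)
  then show thesis using that[of b] lincomb_bij_span[OF b(1)] B b by simp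
qed

lemma finite_UNIV_V: "finite (UNIV :: 'v set)" and card_UNIV_V: "CARD('v) = CARD('a) ^ dim_V"
proof -
  obtain B :: "'v set" where B: "B \<subseteq> UNIV" "independent B" "UNIV \<subseteq> span B" "card B = dim UNIV"
    by (rule basis_exists)
  \<comment> \<open>\<open>card\<close> is 0 on infinite sets, so a positive dimension makes the
    basis finite.\<close>
  have "finite B" using B(4) dim_pos by (simp add: vdim_def card_ge_0_finite)
  then obtain b where "bij_betw b {1..card B} B"
    using ex_bij_betw_nat_finite_1 by blast
  then have b: "inj_on b {1..dim_V}" "b ` {1..dim_V} = B"
    using B by (auto simp: bij_betw_def vdim_def)
  have bij: "bij_betw (lincomb dim_V b) (vecs {1..dim_V}) UNIV"
    using lincomb_bij_span[OF b(1), unfolded b(2), OF B(2)] B(3) by (simp only: top.extremum_unique)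
  show "finite (UNIV :: 'v set)" using bij_betw_finite[OF bij] by simp
  show "CARD('v) = CARD('a) ^ dim_V" using bij_betw_same_card[OF bij] by (simp add: card_vecs)
qed

lemma finite_V [simp]: "finite (A :: 'v set)"
  using finite_UNIV_V by (rule rev_finite_subset) simp

lemma subspace_enumE:
  assumes W: "subspace W"
  obtains b where "bij_betw (lincomb (dim W) b) (vecs {1..dim W}) W"
    "inj_on b {1..dim W}" "independent (b ` {1..dim W})"
  using subspace_enum[OF W] by auto

lemma card_subspace:
  assumes "subspace W"
  shows "card W = CARD('a) ^ dim W" "dim W \<le> dim_V"
proof -
  obtain b where "bij_betw (lincomb (dim W) b) (vecs {1..dim W}) W"
    using subspace_enumE[OF assms] .
  from bij_betw_same_card[OF this] show c: "card W = CARD('a) ^ dim W" by (simp add: card_vecs)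
  have "card W \<le> CARD('v)" by (intro card_mono) (use finite_UNIV_V in auto)
  then show "dim W \<le> dim_V"
    unfolding c card_UNIV_V using CARD_field_gt_1[where 'a = 'a] by (rule power_le_imp_le_exp[rotated])
qed

text \<open>Sizes of subspaces are powers of q, so a codimension can be read off from an equation
  between cardinalities, the form in which ranks of matrices are encoded.\<close>

lemma codim_eq_iff:
  assumes "subspace W"
  shows "dim_V - dim W = r \<longleftrightarrow> card W * CARD('a) ^ r = CARD('a) ^ dim_V"
  unfolding card_subspace(1)[OF assms] power_add[symmetric] power_card_inject
  using card_subspace(2)[OF assms] by auto

lemma is_basisI:
  assumes "\<And>x. lincomb dim_V b x = 0 \<Longrightarrow> \<forall>i\<in>{1..dim_V}. x i = 0"
  shows "is_basis scale b"
proof -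
  note ind = lincomb_inj_imp_independent[OF assms]
  have "card (span (b ` {1..dim_V})) = CARD('v)"
    using bij_betw_same_card[OF lincomb_bij_span[OF ind]] by (simp add: card_vecs card_UNIV_V)
  then have "span (b ` {1..dim_V}) = UNIV"
    using finite_UNIV_V by (intro card_subset_eq) auto
  then show ?thesis using ind unfolding is_basis_def by blast
qed

context
  fixes b assumes b: "is_basis scale b"
begin

lemma basis_facts: "inj_on b {1..dim_V}" "independent (b ` {1..dim_V})" "span (b ` {1..dim_V}) = UNIV"
  using b unfolding is_basis_def by auto

lemma lincomb_bij: "bij_betw (lincomb dim_V b) (vecs {1..dim_V}) UNIV"
  using lincomb_bij_span[OF basis_facts(1,2)] unfolding basis_facts(3) .

lemma lincomb_coords [simp]: "lincomb dim_V b (coords scale b v) = v"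
proof -
  have "(\<Sum>x\<in>b ` {1..dim_V}. scale (representation (b ` {1..dim_V}) v x) x) = v"
    using basis_facts by (intro sum_representation_eq) auto
  then show ?thesis unfolding lincomb_def coords_def sum.reindex[OF basis_facts(1)] by simp
qed

lemma lincomb_eq_iff: "lincomb dim_V b x = lincomb dim_V b y \<longleftrightarrow> (\<forall>i\<in>{1..dim_V}. x i = y i)"
proof
  let ?r = "\<lambda>x i. if i \<in> {1..dim_V} then x i else 0"
  assume "lincomb dim_V b x = lincomb dim_V b y"
  then have "lincomb dim_V b (?r x) = lincomb dim_V b (?r y)"
    using lincomb_cong[of dim_V "?r x" x b b] lincomb_cong[of dim_V "?r y" y b b] by simp
  then have "?r x = ?r y"
    by (rule inj_onD[OF bij_betw_imp_inj_on[OF lincomb_bij]]) (auto simp: vecs_def)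
  then show "\<forall>i\<in>{1..dim_V}. x i = y i" by meson
qed (auto intro: lincomb_cong)

lemma coords_lincomb [simp]: "i \<in> {1..dim_V} \<Longrightarrow> coords scale b (lincomb dim_V b x) i = x i"
  using lincomb_eq_iff[of "coords scale b (lincomb dim_V b x)" x] by simp

lemma coords_add: "coords scale b (v + w) i = coords scale b v i + coords scale b w i"
  unfolding coords_def using basis_facts by (subst representation_add) auto

lemma coords_scale: "coords scale b (scale c v) i = c * coords scale b v i"
  unfolding coords_def using basis_facts by (subst representation_scale) auto

lemma coords_basis: "i \<in> {1..dim_V} \<Longrightarrow> j \<in> {1..dim_V} \<Longrightarrow> coords scale b (b i) j = (if j = i then 1 else 0)"
  using coords_lincomb[of j "\<lambda>k. if k = i then 1 else 0"] by (simp add: lincomb_unit)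

end

section \<open>Bilinear and quadratic forms on the space\<close>

lemma symmetric_bilinearI:
  assumes "\<And>x y. S x y = S y x" "\<And>x y z. S (x + y) z = S x z + S y z"
    "\<And>c x z. S (scale c x) z = c * S x z"
  shows "S \<in> symmetric_bilinear_forms scale"
proof -
  have "Vector_Spaces.linear scale (*) (\<lambda>x. S x y)" for y
    unfolding Vector_Spaces.linear_iff by (simp add: vector_space_axioms vector_space_field assms(2,3))
  moreover from this have "Vector_Spaces.linear scale (*) (\<lambda>y. S x y)" for x
    using assms(1) by presburger
  ultimately show ?thesis using assms(1) unfolding symmetric_bilinear_forms_def by blast
qed

context
  fixes S assumes S: "S \<in> symmetric_bilinear_forms scale"
begin

lemma form_sym: "S x y = S y x"
  using S unfolding symmetric_bilinear_forms_def by blast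

lemma form_add_left: "S (x + y) z = S x z + S y z"
  using S unfolding symmetric_bilinear_forms_def Vector_Spaces.linear_iff by blast

lemma form_scale_left: "S (scale c x) z = c * S x z"
  using S unfolding symmetric_bilinear_forms_def Vector_Spaces.linear_iff by blast

lemma form_add_right: "S z (x + y) = S z x + S z y"
  using form_add_left[of x y z] by (simp only: form_sym[of z])

lemma form_scale_right: "S z (scale c x) = c * S z x"
  using form_scale_left[of c x z] by (simp only: form_sym[of z])

lemma form_0 [simp]: "S 0 y = 0" "S y 0 = 0"
  using form_scale_left[of 0 0 y] form_scale_right[of y 0 0] by auto

lemma form_sum_left: "S (sum f A) y = (\<Sum>i\<in>A. S (f i) y)"
  by (induction A rule: infinite_finite_induct) (auto simp: form_add_left)

lemma form_sum_right: "S y (sum f A) = (\<Sum>i\<in>A. S y (f i))"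
  by (induction A rule: infinite_finite_induct) (auto simp: form_add_right)

lemma form_lincomb_left: "S (lincomb n b x) y = (\<Sum>i=1..n. x i * S (b i) y)"
  by (simp add: lincomb_def form_sum_left form_scale_left)

lemma form_lincomb_right: "S y (lincomb n b x) = (\<Sum>i=1..n. x i * S y (b i))"
  by (simp add: lincomb_def form_sum_right form_scale_right)

lemma subspace_radical: "subspace {x. \<forall>y. S x y = 0}"
  by (auto simp: subspace_def form_add_left form_scale_left)

lemma sym_rank_iff: "sym_rank scale S = r \<longleftrightarrow> card {x. \<forall>y. S x y = 0} * CARD('a) ^ r = CARD('a) ^ dim_V"
  unfolding sym_rank_def by (rule codim_eq_iff[OF subspace_radical])

end

lemma quadratic_formsD:
  assumes "Q \<in> quadratic_forms scale"
  shows "Q (scale c x) = c\<^sup>2 * Q x" "polar Q \<in> symmetric_bilinear_forms scale"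
    "Q (x + y) = Q x + Q y + polar Q x y"
  using assms by (auto simp: quadratic_forms_def polar_def)

lemma quad_0: "Q \<in> quadratic_forms scale \<Longrightarrow> Q 0 = 0"
  using quadratic_formsD(1)[of Q 0 0] by simp

lemma quad_lincomb:
  assumes Q: "Q \<in> quadratic_forms scale"
  shows "Q (lincomb n b x) = matrix_quad n (\<lambda>i j. polar Q (b i) (b j)) (\<lambda>i. Q (b i)) x"
proof (induction n)
  case 0
  then show ?case by (simp add: lincomb_def matrix_quad_def cross_terms_def quad_0[OF Q])
next
  case (Suc n)
  note [simp] = quadratic_formsD[OF Q]
  have "Q (lincomb (Suc n) b x) = Q (lincomb n b x + scale (x (Suc n)) (b (Suc n)))"
    by (simp add: lincomb_def)
  also have "\<dots> = Q (lincomb n b x) + (x (Suc n))\<^sup>2 * Q (b (Suc n)) +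
    (\<Sum>i=1..n. x (Suc n) * (x i * polar Q (b i) (b (Suc n))))"
    by (simp only: quadratic_formsD[OF Q] form_lincomb_left[OF quadratic_formsD(2)[OF Q]]
        form_scale_right[OF quadratic_formsD(2)[OF Q]] sum_distrib_left)
  also have "\<dots> = matrix_quad (Suc n) (\<lambda>i j. polar Q (b i) (b j)) (\<lambda>i. Q (b i)) x"
    unfolding Suc matrix_quad_def cross_terms_def
    by (simp add: atLeastLessThanSuc_atLeastAtMost mult_ac)
  finally show ?case .
qed

lemma subspace_quad_radical:
  assumes Q: "Q \<in> quadratic_forms scale"
  shows "subspace {x. (\<forall>y. polar Q x y = 0) \<and> Q x = 0}"
  using form_0[OF quadratic_formsD(2)[OF Q]]
  by (auto simp: subspace_def quad_0[OF Q] quadratic_formsD[OF Q] form_add_left[OF quadratic_formsD(2)[OF Q]]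
      form_scale_left[OF quadratic_formsD(2)[OF Q]])

lemma quad_rank_iff:
  assumes "Q \<in> quadratic_forms scale"
  shows "quad_rank scale Q = r \<longleftrightarrow>
    card {x. (\<forall>y. polar Q x y = 0) \<and> Q x = 0} * CARD('a) ^ r = CARD('a) ^ dim_V"
  unfolding quad_rank_def by (rule codim_eq_iff[OF subspace_quad_radical[OF assms]])

text \<open>The hypotheses \<open>ind\<close> and \<open>gen\<close> make \<open>x\<close> a basis
  modulo \<open>K\<close>; a basis of \<open>K\<close> completes it. In the applications
  \<open>K\<close> is a radical, and the last conclusion then expresses the rank.\<close>

lemma basis_extending:
  assumes K: "subspace K"
    and ind: "\<And>c. lincomb n x c \<in> K \<Longrightarrow> \<forall>i\<in>{1..n}. c i = 0"
    and gen: "\<And>v. \<exists>c. v - lincomb n x c \<in> K"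
  obtains b where "is_basis scale b" "\<And>i. i \<in> {1..n} \<Longrightarrow> b i = x i"
    "\<And>i. i \<in> {n+1..dim_V} \<Longrightarrow> b i \<in> K" "n \<le> dim_V" "card K * CARD('a) ^ n = CARD('a) ^ dim_V"
proof -
  obtain k where k: "bij_betw (lincomb (dim K) k) (vecs {1..dim K}) K"
    "inj_on k {1..dim K}" "independent (k ` {1..dim K})"
    using subspace_enumE[OF K] .
  have "bij_betw (\<lambda>(c, w). lincomb n x c + w) (vecs {1..n} \<times> K) UNIV"
  proof (rule bij_betw_imageI)
    show "inj_on (\<lambda>(c, w). lincomb n x c + w) (vecs {1..n} \<times> K)"
    proof (rule inj_onI, clarify)
      fix c w c' w' assume c: "c \<in> vecs {1..n}" "c' \<in> vecs {1..n}" and w: "w \<in> K" "w' \<in> K"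
        and eq: "lincomb n x c + w = lincomb n x c' + w'"
      then have "lincomb n x (\<lambda>i. c i - c' i) = w' - w"
        by (simp add: lincomb_diff algebra_simps)
      then have "\<forall>i\<in>{1..n}. c i - c' i = 0"
        using w subspace_diff[OF K] by (intro ind) simp
      then have "c = c'" using c by (intro vecs_eqI) auto
      then show "c = c' \<and> w = w'" using eq by simp
    qed
    have "v \<in> (\<lambda>(c, w). lincomb n x c + w) ` (vecs {1..n} \<times> K)" for v
    proof -
      obtain c where c: "v - lincomb n x c \<in> K" using gen by blast
      let ?c = "\<lambda>i. if i \<in> {1..n} then c i else 0"
      have "lincomb n x ?c = lincomb n x c" by (rule lincomb_cong) auto
      moreover have "?c \<in> vecs {1..n}" by (simp add: vecs_def)
      ultimately show ?thesis using c by (intro image_eqI[of _ _ "(?c, v - lincomb n x c)"]) auto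
    qed
    then show "(\<lambda>(c, w). lincomb n x c + w) ` (vecs {1..n} \<times> K) = UNIV" by blast
  qed
  from bij_betw_same_card[OF this] have cK: "CARD('a) ^ n * card K = CARD('a) ^ dim_V"
    by (simp add: card_cartesian_product card_vecs card_UNIV_V)
  then have nd: "n + dim K = dim_V"
    unfolding card_subspace(1)[OF K] power_add[symmetric] power_card_inject .
  define b where "b i = (if i \<le> n then x i else k (i - n))" for i
  have split: "lincomb dim_V b c = lincomb n x c + lincomb (dim K) k (\<lambda>i. c (i + n))" for c
  proof -
    have "{1..dim_V} = {1..n} \<union> {1+n..dim K + n}" "{1..n} \<inter> {1+n..dim K + n} = {}"
      using nd by auto
    then have "lincomb dim_V b c = (\<Sum>i=1..n. scale (c i) (b i)) + (\<Sum>i=1+n..dim K + n. scale (c i) (b i))"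
      unfolding lincomb_def by (simp add: sum.union_disjoint)
    also have "(\<Sum>i=1+n..dim K + n. scale (c i) (b i)) = lincomb (dim K) k (\<lambda>i. c (i + n))"
      unfolding lincomb_def sum.shift_bounds_cl_nat_ivl by (intro sum.cong) (auto simp: b_def)
    finally show ?thesis by (simp add: lincomb_def b_def)
  qed
  have inK: "lincomb (dim K) k c \<in> K" for c
  proof -
    let ?c = "\<lambda>i. if i \<in> {1..dim K} then c i else 0"
    have "lincomb (dim K) k c = lincomb (dim K) k ?c" by (rule lincomb_cong) auto
    then show ?thesis using bij_betwE[OF k(1), rule_format, of ?c] by (simp add: vecs_def)
  qed
  have "is_basis scale b"
  proof (rule is_basisI)
    fix c assume 0: "lincomb dim_V b c = 0"
    then have "lincomb n x c = - lincomb (dim K) k (\<lambda>i. c (i + n))"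
      unfolding split by (simp add: eq_neg_iff_add_eq_0)
    then have c1: "\<forall>i\<in>{1..n}. c i = 0" using ind inK subspace_neg[OF K] by simp
    then have "lincomb n x c = 0" by (simp add: lincomb_def)
    then have l0: "lincomb (dim K) k (\<lambda>i. c (i + n)) = 0" using 0 split by simp
    let ?c = "\<lambda>i. if i \<in> {1..dim K} then c (i + n) else 0"
    have "lincomb (dim K) k ?c = lincomb (dim K) k (\<lambda>_. 0)"
      using l0 lincomb_cong[of "dim K" ?c "\<lambda>i. c (i + n)" k k] by (simp add: lincomb_def)
    then have "?c = (\<lambda>_. 0)"
      by (rule inj_onD[OF bij_betw_imp_inj_on[OF k(1)]]) (auto simp: vecs_def)
    then have c2: "c (i + n) = 0" if "i \<in> {1..dim K}" for i using that by meson
    show "\<forall>i\<in>{1..dim_V}. c i = 0"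
    proof
      fix i assume i: "i \<in> {1..dim_V}"
      show "c i = 0"
      proof (cases "i \<le> n")
        case False
        then have "i - n \<in> {1..dim K}" "i - n + n = i" using i nd by auto
        then show ?thesis using c2[of "i - n"] by simp
      qed (use c1 i in auto)
    qed
  qed
  moreover have "b i = x i" if "i \<in> {1..n}" for i using that by (simp add: b_def)
  moreover have "b i \<in> K" if i: "i \<in> {n+1..dim_V}" for i
  proof -
    have "i - n \<in> {1..dim K}" using i nd by auto
    then have "k (i - n) = lincomb (dim K) k (\<lambda>j. if j = i - n then 1 else 0)" by (simp add: lincomb_unit)
    then show ?thesis using i inK by (simp add: b_def)
  qed
  ultimately show thesis using that nd cK by (simp add: mult.commute)
qed

end

locale even_form_space = finite_form_space +
  assumes even_card: "even CARD('a)"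
begin

lemmas neg_eq_self = neg_eq_self[OF even_card] and add_self = add_self[OF even_card]
  and diff_eq_add = diff_eq_add[OF even_card]

text \<open>Both \<open>x + x\<close> and \<open>Q x + Q x\<close> vanish. This is why polarizations
  are alternating and not merely symmetric.\<close>

lemma polar_self: "Q \<in> quadratic_forms scale \<Longrightarrow> polar Q x x = 0"
proof -
  assume Q: "Q \<in> quadratic_forms scale"
  have "Q (x + x) = Q (scale (1 + 1) x)" by (simp only: scale_left_distrib scale_one)
  also have "\<dots> = 0" using add_self[of 1] quad_0[OF Q] by simp
  finally show ?thesis by (simp add: polar_def diff_eq_add add_self)
qed

section \<open>Quadratic forms as pairs of an alternating matrix and a diagonal\<close>

definition form_of :: "(nat \<Rightarrow> 'b) \<Rightarrow> (nat \<Rightarrow> nat \<Rightarrow> 'a) \<Rightarrow> (nat \<Rightarrow> 'a) \<Rightarrow> 'b \<Rightarrow> 'a" where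
  "form_of b B d v = matrix_quad dim_V B d (coords scale b v)"

context
  fixes b assumes b: "is_basis scale b"
begin

lemma polar_form_of:
  assumes "B \<in> alternating_on I"
  shows "polar (form_of b B d) v w = (\<Sum>i=1..dim_V. \<Sum>j=1..dim_V. B i j * coords scale b v i * coords scale b w j)"
proof -
  have "form_of b B d (v + w) = matrix_quad dim_V B d (\<lambda>i. coords scale b v i + coords scale b w i)"
    unfolding form_of_def coords_add[OF b, abs_def] ..
  then show ?thesis unfolding polar_def matrix_quad_add[OF even_card assms]
    by (simp add: form_of_def)
qed

lemma form_of_quadratic:
  assumes B: "B \<in> alternating_on I"
  shows "form_of b B d \<in> quadratic_forms scale"
proof -
  have sym: "B i j = B j i" for i j
    using alternating_on_swap[OF B, of i j] neg_eq_self by simp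
  have "polar (form_of b B d) \<in> symmetric_bilinear_forms scale"
  proof (rule symmetric_bilinearI)
    show "polar (form_of b B d) v w = polar (form_of b B d) w v" for v w
      by (simp add: polar_def add_ac)
  qed (simp_all add: polar_form_of[OF B] coords_add[OF b] coords_scale[OF b] distrib_left distrib_right
      sum.distrib sum_distrib_left mult_ac)
  moreover have "form_of b B d (scale c v) = c\<^sup>2 * form_of b B d v" for c v
    unfolding form_of_def using matrix_quad_scale[of dim_V B d c "coords scale b v"]
    by (simp add: coords_scale[OF b, abs_def])
  ultimately show ?thesis by (simp add: quadratic_forms_def)
qed

lemma form_of_lincomb: "form_of b B d (lincomb dim_V b x) = matrix_quad dim_V B d x"
  unfolding form_of_def by (rule matrix_quad_cong) (simp add: coords_lincomb[OF b])

lemma polar_form_of_basis: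
  assumes B: "B \<in> alternating_on I" and "i \<in> {1..dim_V}" "j \<in> {1..dim_V}"
  shows "polar (form_of b B d) (b i) (b j) = B i j"
proof -
  have "(\<Sum>k=1..dim_V. \<Sum>l=1..dim_V. B k l * (if k = i then 1 else 0) * (if l = j then 1 else 0)) = B i j"
  proof -
    have "(\<Sum>k=1..dim_V. \<Sum>l=1..dim_V. B k l * (if k = i then 1 else 0) * (if l = j then 1 else 0)) =
        (\<Sum>k=1..dim_V. B k j * (if k = i then 1 else 0))"
      by (intro sum.cong refl sum_mult_delta finite_atLeastAtMost assms(3))
    also have "\<dots> = B i j" by (intro sum_mult_delta finite_atLeastAtMost assms(2))
    finally show ?thesis .
  qed
  moreover have "polar (form_of b B d) (b i) (b j) =
     (\<Sum>k=1..dim_V. \<Sum>l=1..dim_V. B k l * (if k = i then 1 else 0) * (if l = j then 1 else 0))"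
    unfolding polar_form_of[OF B] using assms by (intro sum.cong refl) (simp add: coords_basis[OF b])
  ultimately show ?thesis by simp
qed

lemma form_of_basis:
  assumes "i \<in> {1..dim_V}"
  shows "form_of b B d (b i) = d i"
proof -
  have "form_of b B d (b i) = matrix_quad dim_V B d (\<lambda>k. if k = i then 1 else 0)"
    using form_of_lincomb[of B d "\<lambda>k. if k = i then 1 else 0"] assms by (simp add: lincomb_unit)
  moreover have "cross_terms dim_V B (\<lambda>k. if k = i then 1 else 0) = 0"
    unfolding cross_terms_def by (intro sum.neutral ballI) auto
  moreover have "(\<Sum>k=1..dim_V. d k * (if k = i then 1 else 0)\<^sup>2) = d i"
    using assms by (subst sum.remove[of _ i]) (auto intro!: sum.neutral)
  ultimately show ?thesis by (simp add: matrix_quad_def)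
qed

text \<open>A quadratic form is determined by its polarization and its values on a basis, and both
  can be prescribed freely. Sums over forms thus become double sums over \<open>B\<close> and
  \<open>d\<close>.\<close>

lemma bij_form_of:
  "bij_betw (\<lambda>(B, d). form_of b B d) (alternating_on {1..dim_V} \<times> vecs {1..dim_V}) (quadratic_forms scale)"
proof (rule bij_betw_imageI)
  show "inj_on (\<lambda>(B, d). form_of b B d) (alternating_on {1..dim_V} \<times> vecs {1..dim_V})"
  proof (rule inj_onI, clarify)
    fix B d B' d' assume B: "B \<in> alternating_on {1..dim_V}" "B' \<in> alternating_on {1..dim_V}"
      and d: "d \<in> vecs {1..dim_V}" "d' \<in> vecs {1..dim_V}" and eq: "form_of b B d = form_of b B' d'"
    have "B i j = B' i j" for i j
    proof (cases "i \<in> {1..dim_V} \<and> j \<in> {1..dim_V}")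
      case True
      then show ?thesis using polar_form_of_basis[OF B(1), of i j d] polar_form_of_basis[OF B(2), of i j d'] eq by simp
    next
      case False
      then have "i \<notin> {1..dim_V} \<or> j \<notin> {1..dim_V}" by simp
      then show ?thesis by (simp only: alternating_on_outside[OF B(1)] alternating_on_outside[OF B(2)])
    qed
    moreover have "d = d'"
      using form_of_basis[of _ B d] form_of_basis[of _ B' d'] eq d by (intro vecs_eqI) auto
    ultimately show "B = B' \<and> d = d'" by blast
  qed
  show "(\<lambda>(B, d). form_of b B d) ` (alternating_on {1..dim_V} \<times> vecs {1..dim_V}) = quadratic_forms scale"
  proof
    show "(\<lambda>(B, d). form_of b B d) ` (alternating_on {1..dim_V} \<times> vecs {1..dim_V}) \<subseteq> quadratic_forms scale"
      using form_of_quadratic by auto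
    show "quadratic_forms scale \<subseteq> (\<lambda>(B, d). form_of b B d) ` (alternating_on {1..dim_V} \<times> vecs {1..dim_V})"
    proof
      fix Q assume Q: "Q \<in> quadratic_forms scale"
      define B where "B i j = (if i \<in> {1..dim_V} \<and> j \<in> {1..dim_V} then polar Q (b i) (b j) else 0)" for i j
      define d where "d i = (if i \<in> {1..dim_V} then Q (b i) else 0)" for i
      have "B \<in> alternating_on {1..dim_V}"
        unfolding alternating_on_def B_def using polar_self[OF Q] form_sym[OF quadratic_formsD(2)[OF Q]]
        by (auto simp: add_self)
      moreover have "d \<in> vecs {1..dim_V}" by (simp add: d_def vecs_def)
      moreover have "Q v = form_of b B d v" for v
      proof -
        have "Q v = Q (lincomb dim_V b (coords scale b v))" by (simp add: lincomb_coords[OF b])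
        also have "\<dots> = matrix_quad dim_V (\<lambda>i j. polar Q (b i) (b j)) (\<lambda>i. Q (b i)) (coords scale b v)"
          by (rule quad_lincomb[OF Q])
        also have "\<dots> = form_of b B d v"
          unfolding form_of_def matrix_quad_def cross_terms_def
          by (intro arg_cong2[where f = "(+)"] sum.cong refl) (auto simp: B_def d_def)
        finally show ?thesis .
      qed
      ultimately show "Q \<in> (\<lambda>(B, d). form_of b B d) ` (alternating_on {1..dim_V} \<times> vecs {1..dim_V})"
        by (intro image_eqI[of _ _ "(B, d)"]) auto
    qed
  qed
qed

lemma polar_form_of_eq_0:
  assumes B: "B \<in> alternating_on {1..dim_V}"
  shows "(\<forall>w. polar (form_of b B d) (lincomb dim_V b x) w = 0) \<longleftrightarrow> (\<forall>i. (\<Sum>j=1..dim_V. B i j * x j) = 0)"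
proof -
  have sym: "B i j = B j i" for i j
    using alternating_on_swap[OF B, of i j] neg_eq_self by simp
  have polar: "polar (form_of b B d) (lincomb dim_V b x) w = (\<Sum>j=1..dim_V. coords scale b w j * (\<Sum>i=1..dim_V. B j i * x i))" for w
  proof -
    have "polar (form_of b B d) (lincomb dim_V b x) w =
      (\<Sum>i=1..dim_V. \<Sum>j=1..dim_V. B i j * x i * coords scale b w j)"
      unfolding polar_form_of[OF B] by (intro sum.cong refl) (simp add: coords_lincomb[OF b])
    also have "\<dots> = (\<Sum>j=1..dim_V. \<Sum>i=1..dim_V. B i j * x i * coords scale b w j)"
      by (rule sum.swap)
    finally show ?thesis by (simp add: sum_distrib_left sym mult_ac)
  qed
  show ?thesis
  proof
    assume a: "\<forall>w. polar (form_of b B d) (lincomb dim_V b x) w = 0"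
    show "\<forall>i. (\<Sum>j=1..dim_V. B i j * x j) = 0"
    proof
      fix i
      show "(\<Sum>j=1..dim_V. B i j * x j) = 0"
      proof (cases "i \<in> {1..dim_V}")
        case True
        have "0 = (\<Sum>j=1..dim_V. coords scale b (b i) j * (\<Sum>k=1..dim_V. B j k * x k))"
          using a unfolding polar by simp
        also have "\<dots> = (\<Sum>j=1..dim_V. (if j = i then 1 else 0) * (\<Sum>k=1..dim_V. B j k * x k))"
          by (intro sum.cong refl) (simp add: coords_basis[OF b True])
        also have "\<dots> = (\<Sum>j=1..dim_V. B i j * x j)"
          using True by (subst sum.remove[of _ i]) (auto intro!: sum.neutral)
        finally show ?thesis by simp
      qed (use alternating_on_outside[OF B] in simp)
    qed
  qed (simp add: polar)
qed

lemma form_of_radical: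
  assumes B: "B \<in> alternating_on {1..dim_V}"
  shows "lincomb dim_V b x \<in> {v. (\<forall>w. polar (form_of b B d) v w = 0) \<and> form_of b B d v = 0} \<longleftrightarrow>
    (\<forall>i. (\<Sum>j=1..dim_V. B i j * x j) = 0) \<and> matrix_quad dim_V B d x = 0"
  by (simp only: mem_Collect_eq polar_form_of_eq_0[OF B] form_of_lincomb)

lemma card_form_of_radical:
  assumes B: "B \<in> alternating_on {1..dim_V}"
  shows "card {v. (\<forall>w. polar (form_of b B d) v w = 0) \<and> form_of b B d v = 0} =
    card {x \<in> matrix_radical {1..dim_V} B. matrix_quad dim_V B d x = 0}"
proof -
  let ?V = "{v. (\<forall>w. polar (form_of b B d) v w = 0) \<and> form_of b B d v = 0}"
  let ?X = "{x \<in> matrix_radical {1..dim_V} B. matrix_quad dim_V B d x = 0}"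
  have "bij_betw (lincomb dim_V b) ?X ?V"
  proof (rule bij_betw_subset[OF lincomb_bij[OF b]])
    show "lincomb dim_V b ` ?X = ?V"
    proof (intro equalityI subsetI)
      fix v assume "v \<in> lincomb dim_V b ` ?X"
      then obtain x where "v = lincomb dim_V b x" "x \<in> ?X" by blast
      then show "v \<in> ?V" by (simp only: form_of_radical[OF B]) (simp add: matrix_radical_def)
    next
      fix v assume v: "v \<in> ?V"
      have "v \<in> lincomb dim_V b ` vecs {1..dim_V}" using bij_betw_imp_surj_on[OF lincomb_bij[OF b]] by simp
      then obtain x where x: "v = lincomb dim_V b x" "x \<in> vecs {1..dim_V}" by blast
      then have "x \<in> ?X" using v by (simp only: form_of_radical[OF B]) (simp add: matrix_radical_def)
      then show "v \<in> lincomb dim_V b ` ?X" using x by blast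
    qed
  qed (auto simp: matrix_radical_def)
  from bij_betw_same_card[OF this] show ?thesis by simp
qed

text \<open>The radical of the form is the zero set of the form in the radical of \<open>B\<close>:
  all of it, or a subspace of index q. Hence the rank is that of \<open>B\<close> or one more, and
  since \<open>B\<close> has even rank the parity decides which.\<close>

lemma quad_rank_form_of:
  assumes B: "B \<in> alternating_on {1..dim_V}"
  shows "quad_rank scale (form_of b B d) = 2 * s \<longleftrightarrow>
      B \<in> alternating_of_rank {1..dim_V} (2 * s) \<and> vanishes_on_radical dim_V B d"
    and "quad_rank scale (form_of b B d) = 2 * s + 1 \<longleftrightarrow>
      B \<in> alternating_of_rank {1..dim_V} (2 * s) \<and> \<not> vanishes_on_radical dim_V B d"
proof -
  let ?R = "matrix_radical {1..dim_V} B"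
  let ?X = "{x \<in> ?R. matrix_quad dim_V B d x = 0}"
  let ?q = "CARD('a)"
  have rank: "quad_rank scale (form_of b B d) = r \<longleftrightarrow> card ?X * ?q ^ r = ?q ^ dim_V" for r
    unfolding quad_rank_iff[OF form_of_quadratic[OF B]] card_form_of_radical[OF B] ..
  have B_rank: "B \<in> alternating_of_rank {1..dim_V} r \<longleftrightarrow> card ?R * ?q ^ r = ?q ^ dim_V" for r
    using B by (simp add: alternating_of_rank_def)
  obtain t where "B \<in> alternating_of_rank {1..dim_V} (2 * t)"
    using even_rank[OF _ B] by auto
  then have t: "card ?R * ?q ^ (2 * t) = ?q ^ dim_V" unfolding B_rank .
  have R0: "card ?R > 0" using t by (intro Nat.gr0I) auto
  have eq_t: "card ?R * ?q ^ r = ?q ^ dim_V \<longleftrightarrow> r = 2 * t" for r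
    using t R0 power_card_inject[of r "2 * t", where 'a = 'a] by (metis mult_cancel1 not_gr_zero)
  have "(quad_rank scale (form_of b B d) = 2 * s \<longleftrightarrow> s = t \<and> vanishes_on_radical dim_V B d) \<and>
    (quad_rank scale (form_of b B d) = 2 * s + 1 \<longleftrightarrow> s = t \<and> \<not> vanishes_on_radical dim_V B d)"
  proof (cases "vanishes_on_radical dim_V B d")
    case True
    then have XR: "?X = ?R" by (auto simp: vanishes_on_radical_def)
    have "2 * s + 1 \<noteq> 2 * t" by presburger
    then show ?thesis unfolding rank XR eq_t using True by simp
  next
    case False
    have RX: "card ?R = ?q * card ?X" by (rule card_singular_radical[OF even_card B False])
    have X_rank: "card ?X * ?q ^ r = ?q ^ dim_V \<longleftrightarrow> r = Suc (2 * t)" for r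
    proof (cases r)
      \<comment> \<open>Exponent 0 is treated separately because otherwise \<open>eq_t\<close> is
        applied to the predecessor of \<open>r\<close>.\<close>
      case 0
      have "card ?X < ?q ^ dim_V"
      proof -
        have "card ?X < card ?R" using RX R0 CARD_field_gt_1[where 'a = 'a] by simp
        also have "card ?R \<le> ?q ^ dim_V" using t by (metis One_nat_def R0 Suc_leI mult.right_neutral mult_le_mono2 not_gr_zero power_not_zero zero_less_card_finite)
        finally show ?thesis .
      qed
      then show ?thesis using 0 by simp
    next
      case (Suc r')
      then show ?thesis using eq_t[of r'] unfolding RX by (simp add: mult_ac)
    qed
    have "2 * s \<noteq> Suc (2 * t)" by presburger
    then show ?thesis unfolding rank X_rank using False by simp
  qed
  then show "quad_rank scale (form_of b B d) = 2 * s \<longleftrightarrow>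
      B \<in> alternating_of_rank {1..dim_V} (2 * s) \<and> vanishes_on_radical dim_V B d"
    "quad_rank scale (form_of b B d) = 2 * s + 1 \<longleftrightarrow>
      B \<in> alternating_of_rank {1..dim_V} (2 * s) \<and> \<not> vanishes_on_radical dim_V B d"
    unfolding B_rank eq_t by auto
qed

lemma sum_over_quadratic_forms:
  "(\<Sum>Q\<in>{Q \<in> quadratic_forms scale. P Q}. h Q) =
    (\<Sum>B\<in>alternating_on {1..dim_V}. \<Sum>d\<in>{d \<in> vecs {1..dim_V}. P (form_of b B d)}. h (form_of b B d))"
proof -
  let ?A = "alternating_on {1..dim_V} :: (nat \<Rightarrow> nat \<Rightarrow> 'a) set" and ?D = "vecs {1..dim_V} :: (nat \<Rightarrow> 'a) set"
  have fin: "finite ?A" by (rule finite_alternating_on) simp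
  have "finite (quadratic_forms scale)"
    using bij_betw_finite[OF bij_form_of] fin by simp
  then have "(\<Sum>Q\<in>{Q \<in> quadratic_forms scale. P Q}. h Q) = (\<Sum>Q\<in>quadratic_forms scale. if P Q then h Q else 0)"
    by (rule sum.inter_filter)
  also have "\<dots> = (\<Sum>(B, d)\<in>?A \<times> ?D. if P (form_of b B d) then h (form_of b B d) else 0)"
    by (subst sum.reindex_bij_betw[OF bij_form_of, symmetric]) (intro sum.cong, auto)
  also have "\<dots> = (\<Sum>B\<in>?A. \<Sum>d\<in>?D. if P (form_of b B d) then h (form_of b B d) else 0)"
    by (rule sum.cartesian_product[symmetric])
  also have "\<dots> = (\<Sum>B\<in>?A. \<Sum>d\<in>{d \<in> ?D. P (form_of b B d)}. h (form_of b B d))"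
    by (intro sum.cong refl sum.inter_filter[symmetric]) simp
  finally show ?thesis .
qed

end

end

section \<open>Hyperbolic and elliptic planes\<close>

lemma hyperbolic_quad_cong:
  assumes "\<And>i. i \<in> {1..2*s} \<Longrightarrow> x i = y i"
  shows "hyperbolic_quad s x = hyperbolic_quad s y"
  unfolding hyperbolic_quad_def by (intro sum.cong refl arg_cong2[where f = "(*)"] assms) auto

lemma hyperbolic_quad_Suc: "hyperbolic_quad (Suc s) x = hyperbolic_quad s x + x (2*s + 1) * x (2*s + 2)"
  by (simp add: hyperbolic_quad_def)

lemma elliptic_quad_Suc:
  "elliptic_quad l (Suc s) x = hyperbolic_quad s x +
     ((x (2*s + 1))\<^sup>2 + x (2*s + 1) * x (2*s + 2) + l * (x (2*s + 2))\<^sup>2)"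
  by (simp add: elliptic_quad_def hyperbolic_quad_def add.assoc)

lemma plane_removal:
  assumes "finite I" "{1..2 * Suc s} \<subseteq> I"
  obtains J where "I = insert (2*s + 1) (insert (2*s + 2) J)" "2*s + 1 \<notin> J" "2*s + 2 \<notin> J"
    "finite J" "{1..2*s} \<subseteq> J" "card I = card J + 2"
proof
  let ?J = "I - {2*s + 1, 2*s + 2}"
  show "I = insert (2*s + 1) (insert (2*s + 2) ?J)" using assms by auto
  show J: "2*s + 1 \<notin> ?J" "2*s + 2 \<notin> ?J" "finite ?J" "{1..2*s} \<subseteq> ?J" using assms by auto
  have "card (insert (2*s + 1) (insert (2*s + 2) ?J)) = card ?J + 2" using J by simp
  then show "card I = card ?J + 2" using \<open>I = insert (2*s + 1) (insert (2*s + 2) ?J)\<close> by simp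
qed

text \<open>An invertible linear substitution of the first \<open>n\<close> variables. It acts on
  sequences over all natural numbers and fixes the other entries, so that substitutions for
  different \<open>n\<close> compose; over a field the trivial kernel expresses
  invertibility.\<close>

definition coordinate_change :: "nat \<Rightarrow> ((nat \<Rightarrow> 'a::comm_ring_1) \<Rightarrow> nat \<Rightarrow> 'a) \<Rightarrow> bool" where
  "coordinate_change n T \<longleftrightarrow> (\<forall>x y. T (\<lambda>i. x i + y i) = (\<lambda>i. T x i + T y i)) \<and>
     (\<forall>c x. T (\<lambda>i. c * x i) = (\<lambda>i. c * T x i)) \<and>
     (\<forall>x. (\<forall>i. T x i = 0) \<longrightarrow> (\<forall>i. x i = 0)) \<and> (\<forall>x i. i \<notin> {1..n} \<longrightarrow> T x i = x i)"

text \<open>An orthogonal sum of binary forms with middle coefficient 1, the shape of a form of even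
  rank in a symplectic basis of its polarization.\<close>

definition diagonal_planes :: "(nat \<Rightarrow> 'a::comm_ring_1) \<Rightarrow> nat \<Rightarrow> (nat \<Rightarrow> 'a) \<Rightarrow> 'a" where
  "diagonal_planes a s x = (\<Sum>k=1..s. a (2*k - 1) * (x (2*k - 1))\<^sup>2 + x (2*k - 1) * x (2*k) + a (2*k) * (x (2*k))\<^sup>2)"

section \<open>Artin-Schreier equations and character sums of planes\<close>

context
  assumes even_card: "even CARD('a::finite_field)"
begin

lemma CHAR_eq_2: "CHAR('a) = 2"
proof (rule CHAR_eq_posI)
  show "of_nat 2 = (0 :: 'a)" using add_self[OF even_card, of "1 :: 'a"] by simp
  fix x :: nat assume "0 < x" "x < 2"
  then have "x = 1" by simp
  then show "of_nat x \<noteq> (0 :: 'a)" by simp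
qed simp

text \<open>A largest subset that contains 0, is closed under addition and has 2-power size must be
  everything, because joining its translate by a missing \<open>x\<close> doubles it. The exponent
  is needed to evaluate \<open>absolute_trace\<close>.\<close>

lemma card_power_of_2: "\<exists>k. CARD('a) = 2 ^ k"
proof -
  define P where "P H \<longleftrightarrow> (0 :: 'a) \<in> H \<and> (\<forall>x\<in>H. \<forall>y\<in>H. x + y \<in> H) \<and> (\<exists>k. card H = 2 ^ k)" for H
  have "P {0}" by (auto simp: P_def intro: exI[of _ 0])
  then have "\<exists>H. P H \<and> (\<forall>H'. P H' \<longrightarrow> card H' \<le> card H)"
    by (intro ex_has_greatest_nat[where b = "Suc CARD('a)"]) (simp_all add: less_Suc_eq_le card_mono)
  then obtain H where H: "P H" and max: "\<And>H'. P H' \<Longrightarrow> card H' \<le> card H" by blast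
  then obtain k where k: "card H = 2 ^ k" unfolding P_def by blast
  have "H = UNIV"
  proof (rule ccontr)
    assume "H \<noteq> UNIV"
    then obtain x where x: "x \<notin> H" by blast
    have disj: "H \<inter> (+) x ` H = {}"
    proof (rule ccontr)
      assume "H \<inter> (+) x ` H \<noteq> {}"
      then obtain h where h: "h \<in> H" "x + h \<in> H" by blast
      then have "(x + h) + h \<in> H" using H unfolding P_def by blast
      then show False using x by (simp add: add.assoc add_self[OF even_card])
    qed
    have "card (H \<union> (+) x ` H) = card H + card ((+) x ` H)"
      by (rule card_Un_disjoint) (use disj in auto)
    then have c: "card (H \<union> (+) x ` H) = 2 ^ Suc k"
      by (simp add: card_image k)
    have xx: "x + a + (x + b) = a + b" for a b
      using add_self[OF even_card, of x] by (metis add.assoc add.commute add.left_neutral)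
    have "u + v \<in> H \<union> (+) x ` H" if uv: "u \<in> H \<union> (+) x ` H" "v \<in> H \<union> (+) x ` H" for u v
    proof -
      have cl: "a + b \<in> H" if "a \<in> H" "b \<in> H" for a b using H that unfolding P_def by blast
      obtain u' where u': "u' \<in> H" "u = u' \<or> u = x + u'" using uv by blast
      obtain v' where v': "v' \<in> H" "v = v' \<or> v = x + v'" using uv by blast
      have "u + v = u' + v' \<or> u + v = x + (u' + v')"
        using u'(2) v'(2) xx[of u' v'] by (auto simp: add_ac)
      then show ?thesis using cl[OF u'(1) v'(1)] by auto
    qed
    then have "P (H \<union> (+) x ` H)" using H c unfolding P_def by blast
    from max[OF this] show False unfolding c k by simp
  qed
  then show ?thesis using k by auto
qed

text \<open>The trace of \<open>t\<^sup>2 + t\<close> telescopes to \<open>t^q + t\<close>, and this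
  is \<open>t + t = 0\<close>.\<close>

lemma absolute_trace_artin_schreier: "absolute_trace (t\<^sup>2 + t :: 'a) = 0"
proof -
  obtain e where e: "CARD('a) = 2 ^ e" using card_power_of_2 by blast
  have m: "multiplicity CHAR('a) CARD('a) = e"
    by (simp add: CHAR_eq_2 e multiplicity_prime_power[of "2 :: nat"])
  have add: "(x + y) ^ (2 ^ i) = x ^ (2 ^ i) + y ^ (2 ^ i)" for x y :: 'a and i
    by (induction i) (simp_all add: power_mult square_add[OF even_card] mult.commute[of 2])
  have "absolute_trace (t\<^sup>2 + t) = (\<Sum>i<e. t ^ (2 ^ Suc i) + t ^ (2 ^ i))"
    unfolding absolute_trace_def m unfolding CHAR_eq_2 by (simp add: add power_mult)
  also have "\<dots> = t ^ (2 ^ e) + t"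
  proof (induction e)
    case 0
    then show ?case by (simp add: add_self[OF even_card])
  next
    case (Suc e)
    have "(t ^ (2 ^ e) + t) + (t ^ (2 ^ Suc e) + t ^ (2 ^ e)) = t ^ (2 ^ Suc e) + t + (t ^ (2 ^ e) + t ^ (2 ^ e))"
      by (simp only: add_ac)
    then show ?case unfolding sum.lessThan_Suc Suc add_self[OF even_card] by simp
  qed
  also have "t ^ (2 ^ e) = t"
    using finite_field_power_card_eq_same[of t] by (simp add: e)
  also have "t + t = 0" by (rule add_self[OF even_card])
  finally show ?thesis .
qed

context
  fixes lam :: 'a
  assumes lam: "absolute_trace lam = 1"
begin

lemma lam_not_artin_schreier: "t\<^sup>2 + t \<noteq> lam"
  using absolute_trace_artin_schreier[of t] lam by auto

text \<open>The map from \<open>t\<close> to \<open>t\<^sup>2 + t\<close> is additive with fibres of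
  at most two elements, so its image \<open>U\<close> has at least q/2 elements. The translate of
  \<open>U\<close> by \<open>lam\<close> is disjoint from \<open>U\<close>; hence the two fill the
  field.\<close>

lemma artin_schreier_cosets: "\<exists>t. c + (t\<^sup>2 + t) = 0 \<or> c + (t\<^sup>2 + t) = lam"
proof -
  define U where "U = range (\<lambda>t :: 'a. t\<^sup>2 + t)"
  have f_add: "(s + t)\<^sup>2 + (s + t) = (s\<^sup>2 + s) + (t\<^sup>2 + t)" for s t :: 'a
    by (simp add: square_add[OF even_card] add_ac)
  have fibre: "card {t. t\<^sup>2 + t = u} \<le> 2" for u :: 'a
  proof (cases "\<exists>t. t\<^sup>2 + t = u")
    case True
    then obtain t where t: "t\<^sup>2 + t = u" by blast
    have "{t. t\<^sup>2 + t = u} \<subseteq> {t, t + 1}"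
    proof
      fix s assume "s \<in> {t. t\<^sup>2 + t = u}"
      then have "(s + t)\<^sup>2 + (s + t) = 0" using t by (simp add: f_add add_self[OF even_card])
      then have "(s + t) * (s + t + 1) = 0" by (simp add: power2_eq_square algebra_simps)
      then have "s + t = 0 \<or> s + t + 1 = 0" by simp
      moreover have "s = (s + t) + t" by (simp add: add.assoc add_self[OF even_card])
      moreover have "s = (s + t + 1) + (t + 1)"
      proof -
        have "(s + t + 1) + (t + 1) = s + (t + t) + (1 + 1)" by (simp only: add_ac)
        then show ?thesis by (simp only: add_self[OF even_card] add_0_right)
      qed
      ultimately show "s \<in> {t, t + 1}" by (metis add_0_left insertCI)
    qed
    then have "card {t. t\<^sup>2 + t = u} \<le> card {t, t + 1}" by (intro card_mono) auto
    then show ?thesis by simp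
  qed simp
  have "CARD('a) = card (\<Union>u\<in>U. {t. t\<^sup>2 + t = u})" by (intro arg_cong[where f = card]) (auto simp: U_def)
  also have "\<dots> \<le> (\<Sum>u\<in>U. card {t. t\<^sup>2 + t = u})" by (rule card_UN_le) (simp add: U_def)
  also have "\<dots> \<le> (\<Sum>u\<in>U. 2)" by (intro sum_mono fibre)
  finally have U2: "CARD('a) \<le> 2 * card U" by simp
  have "U \<inter> (+) lam ` U = {}"
  proof (rule ccontr)
    assume "U \<inter> (+) lam ` U \<noteq> {}"
    then obtain s t where "s\<^sup>2 + s = lam + (t\<^sup>2 + t)" by (auto simp: U_def)
    then have "(s + t)\<^sup>2 + (s + t) = lam" by (simp add: f_add add.assoc add_self[OF even_card])
    then show False using lam_not_artin_schreier by blast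
  qed
  then have "card (U \<union> (+) lam ` U) = 2 * card U"
    by (subst card_Un_disjoint) (auto simp: card_image U_def)
  then have "card (U \<union> (+) lam ` U) \<ge> CARD('a)" using U2 by simp
  then have "U \<union> (+) lam ` U = UNIV" by (metis card_seteq finite_class.finite_UNIV subset_UNIV)
  then have "c \<in> U \<or> c \<in> (+) lam ` U" by blast
  then obtain t where "c = t\<^sup>2 + t \<or> c = lam + (t\<^sup>2 + t)" by (auto simp: U_def)
  then have "c + (t\<^sup>2 + t) = 0 \<or> c + (t\<^sup>2 + t) = lam"
    by (elim disjE) (simp_all only: add.assoc[of lam] add_self[OF even_card] add_0_right simp_thms)
  then show ?thesis ..
qed

text \<open>A zero with \<open>y \<noteq> 0\<close> would represent \<open>lam\<close> as
  \<open>t\<^sup>2 + t\<close> for \<open>t = x / y\<close>.\<close>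

lemma anisotropic:
  assumes "(x :: 'a)\<^sup>2 + x * y + lam * y\<^sup>2 = 0"
  shows "x = 0 \<and> y = 0"
proof (cases "y = 0")
  case False
  then have "(x / y)\<^sup>2 + x / y + lam = 0"
    using assms by (simp add: field_simps power2_eq_square)
  then have "(x / y)\<^sup>2 + x / y = - lam" by (simp only: eq_neg_iff_add_eq_0)
  then show ?thesis using lam_not_artin_schreier neg_eq_self[OF even_card] by simp
qed (use assms in simp)

context
  fixes \<chi> :: "'a \<Rightarrow> complex"
  assumes \<chi>: "nontrivial_additive_character \<chi>"
begin

lemma hyperbolic_plane_sum: "(\<Sum>x\<in>UNIV. \<Sum>y\<in>UNIV. \<chi> (x * y)) = of_nat CARD('a)"
  by (simp add: sum_char_mult[OF \<chi>])

text \<open>Since every element is a square, the norm form represents all nonzero values equally often.\<close>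

lemma elliptic_plane_sum:
  "(\<Sum>x\<in>UNIV. \<Sum>y\<in>UNIV. \<chi> (x\<^sup>2 + x * y + lam * y\<^sup>2)) = - of_nat CARD('a)"
proof -
  let ?q = "CARD('a)"
  define N where "N = (\<lambda>(x :: 'a, y). x\<^sup>2 + x * y + lam * y\<^sup>2)"
  define c where "c v = card {p. N p = v}" for v
  have c0: "c 0 = 1"
  proof -
    have "{p. N p = 0} = {(0, 0)}" by (auto simp: N_def dest: anisotropic)
    then show ?thesis by (simp add: c_def)
  qed
  have c1: "c v = c 1" if "v \<noteq> 0" for v
  proof -
    obtain r where r: "r\<^sup>2 = v" using square_surj[OF even_card] by blast
    then have r0: "r \<noteq> 0" using that by auto
    have N: "N (r * x, r * y) = v * N (x, y)" for x y
      by (simp add: N_def r[symmetric] power2_eq_square algebra_simps)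
    have "bij_betw (\<lambda>(x, y). (r * x, r * y)) {p. N p = 1} {p. N p = v}"
    proof (rule bij_betw_byWitness[where f' = "\<lambda>(x, y). (x / r, y / r)"])
      show "(\<lambda>(x, y). (x / r, y / r)) ` {p. N p = v} \<subseteq> {p. N p = 1}"
      proof (intro image_subsetI)
        fix p assume p: "p \<in> {p. N p = v}"
        obtain x y where xy: "p = (x, y)" by (cases p)
        have "v * N (x / r, y / r) = v * 1" using N[of "x / r" "y / r"] r0 p xy by simp
        then show "(\<lambda>(x, y). (x / r, y / r)) p \<in> {p. N p = 1}" using that xy by simp
      qed
    qed (use r0 N in auto)
    from bij_betw_same_card[OF this] show ?thesis by (simp add: c_def)
  qed
  have group: "(\<Sum>p\<in>UNIV. h (N p)) = (\<Sum>v\<in>UNIV. of_nat (c v) * h v)" for h :: "'a \<Rightarrow> complex"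
  proof -
    have "(\<Sum>p\<in>UNIV. h (N p)) = (\<Sum>v\<in>UNIV. \<Sum>p\<in>{p. N p = v}. h (N p))"
      using sum.group[of UNIV UNIV N "\<lambda>p. h (N p)"] by simp
    also have "\<dots> = (\<Sum>v\<in>UNIV. of_nat (c v) * h v)"
      by (intro sum.cong refl) (simp add: c_def)
    finally show ?thesis .
  qed
  have split: "(\<Sum>v\<in>UNIV. of_nat (c v) * h v) = h 0 + of_nat (c 1) * ((\<Sum>v\<in>UNIV. h v) - h 0)"
    for h :: "'a \<Rightarrow> complex"
  proof -
    have "(\<Sum>v\<in>UNIV - {0}. of_nat (c v) * h v) = of_nat (c 1) * (\<Sum>v\<in>UNIV - {0}. h v)"
      unfolding sum_distrib_left
    proof (intro sum.cong refl)
      fix v :: 'a assume "v \<in> UNIV - {0}"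
      then have "c v = c 1" by (intro c1) simp
      then show "of_nat (c v) * h v = of_nat (c 1) * h v" by (simp only:)
    qed
    then show ?thesis by (simp add: sum.remove[of UNIV "0 :: 'a"] c0)
  qed
  \<comment> \<open>The constant function counts all q^2 pairs, so
    \<open>1 + c 1 * (q - 1) = q^2\<close> and each nonzero value is taken q + 1 times.\<close>
  have "of_nat (?q * ?q) = (1 :: complex) + of_nat (c 1) * (of_nat ?q - 1)"
  proof -
    have "of_nat (?q * ?q) = (\<Sum>p\<in>(UNIV :: ('a \<times> 'a) set). 1 :: complex)"
      by (simp add: card_cartesian_product flip: UNIV_Times_UNIV)
    then show ?thesis using group[of "\<lambda>_. 1"] split[of "\<lambda>_. 1"] by simp
  qed
  then have "(of_nat (c 1) - (of_nat ?q + 1)) * (of_nat ?q - 1) = (0 :: complex)"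
    by (simp add: algebra_simps)
  moreover have "of_nat ?q - 1 \<noteq> (0 :: complex)"
  proof -
    have "(of_nat ?q :: complex) \<noteq> of_nat 1"
      unfolding of_nat_eq_iff using CARD_field_gt_1[where 'a = 'a] by simp
    then show ?thesis by simp
  qed
  ultimately have c: "of_nat (c 1) = (of_nat ?q + 1 :: complex)" by simp
  have "(\<Sum>x\<in>UNIV. \<Sum>y\<in>UNIV. \<chi> (x\<^sup>2 + x * y + lam * y\<^sup>2)) = (\<Sum>p\<in>UNIV. \<chi> (N p))"
    by (simp add: sum.cartesian_product N_def case_prod_unfold)
  also have "\<dots> = - of_nat ?q"
    unfolding group split by (simp add: c sum_char_UNIV[OF \<chi>] char_0[OF \<chi>])
  finally show ?thesis .
qed

lemma sum_vecs_insert2: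
  fixes f :: "(nat \<Rightarrow> 'a) \<Rightarrow> 'a"
  assumes "i \<notin> I" "j \<notin> I" "i \<noteq> j" and f: "\<And>x a b. x \<in> vecs I \<Longrightarrow> f (x(j := b, i := a)) = h x + k a b"
  shows "(\<Sum>x\<in>vecs (insert i (insert j I)). \<chi> (f x)) =
    (\<Sum>a\<in>UNIV. \<Sum>b\<in>UNIV. \<chi> (k a b)) * (\<Sum>x\<in>vecs I. \<chi> (h x))"
proof -
  have "(\<Sum>x\<in>vecs (insert i (insert j I)). \<chi> (f x)) =
    (\<Sum>a\<in>UNIV. \<Sum>b\<in>UNIV. \<Sum>x\<in>vecs I. \<chi> (f (x(j := b, i := a))))"
    using assms(1-3) by (simp add: sum_vecs_insert)
  also have "\<dots> = (\<Sum>a\<in>UNIV. \<Sum>b\<in>UNIV. \<Sum>x\<in>vecs I. \<chi> (k a b) * \<chi> (h x))"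
    by (intro sum.cong refl) (simp add: f char_add[OF \<chi>] del: fun_upd_apply)
  finally show ?thesis by (simp only: sum_distrib_right, simp only: sum_distrib_left)
qed

text \<open>Each hyperbolic plane contributes q where two free variables contribute q^2; multiplying
  by \<open>q^s\<close> avoids a division.\<close>

lemma hyperbolic_sum:
  assumes "finite I" "{1..2*s} \<subseteq> I"
  shows "(\<Sum>x\<in>vecs I. \<chi> (hyperbolic_quad s x)) * of_nat CARD('a) ^ s = of_nat CARD('a) ^ card I"
  using assms
proof (induction s arbitrary: I)
  case 0
  then show ?case by (simp add: hyperbolic_quad_def char_0[OF \<chi>] card_vecs)
next
  case (Suc s)
  obtain J where J: "I = insert (2*s + 1) (insert (2*s + 2) J)" "2*s + 1 \<notin> J" "2*s + 2 \<notin> J"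
    "finite J" "{1..2*s} \<subseteq> J" "card I = card J + 2" using plane_removal[OF Suc.prems] .
  have "(\<Sum>x\<in>vecs I. \<chi> (hyperbolic_quad (Suc s) x)) =
    (\<Sum>a\<in>UNIV. \<Sum>b\<in>UNIV. \<chi> (a * b)) * (\<Sum>x\<in>vecs J. \<chi> (hyperbolic_quad s x))"
    unfolding J(1)
  proof (rule sum_vecs_insert2)
    fix x :: "nat \<Rightarrow> 'a" and a b
    have "hyperbolic_quad s (x(2*s + 2 := b, 2*s + 1 := a)) = hyperbolic_quad s x"
      by (rule hyperbolic_quad_cong) auto
    then show "hyperbolic_quad (Suc s) (x(2*s + 2 := b, 2*s + 1 := a)) = hyperbolic_quad s x + a * b"
      unfolding hyperbolic_quad_Suc by simp
  qed (use J in auto)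
  then show ?case
    using Suc.IH[OF J(4,5)] unfolding hyperbolic_plane_sum J(6) by (simp add: algebra_simps power2_eq_square)
qed

text \<open>The last plane contributes -q in place of q, the others are hyperbolic.\<close>

lemma elliptic_sum:
  assumes "finite I" "{1..2*s} \<subseteq> I" "s \<ge> 1"
  shows "(\<Sum>x\<in>vecs I. \<chi> (elliptic_quad lam s x)) * of_nat CARD('a) ^ s = - (of_nat CARD('a) ^ card I)"
proof -
  obtain s' where s: "s = Suc s'" using assms(3) by (cases s) auto
  obtain J where J: "I = insert (2*s' + 1) (insert (2*s' + 2) J)" "2*s' + 1 \<notin> J" "2*s' + 2 \<notin> J"
    "finite J" "{1..2*s'} \<subseteq> J" "card I = card J + 2" using plane_removal assms(1,2) unfolding s .
  have "(\<Sum>x\<in>vecs I. \<chi> (elliptic_quad lam (Suc s') x)) =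
    (\<Sum>a\<in>UNIV. \<Sum>b\<in>UNIV. \<chi> (a\<^sup>2 + a * b + lam * b\<^sup>2)) * (\<Sum>x\<in>vecs J. \<chi> (hyperbolic_quad s' x))"
    unfolding J(1)
  proof (rule sum_vecs_insert2)
    fix x :: "nat \<Rightarrow> 'a" and a b
    have "hyperbolic_quad s' (x(2*s' + 2 := b, 2*s' + 1 := a)) = hyperbolic_quad s' x"
      by (rule hyperbolic_quad_cong) auto
    then show "elliptic_quad lam (Suc s') (x(2*s' + 2 := b, 2*s' + 1 := a)) =
        hyperbolic_quad s' x + (a\<^sup>2 + a * b + lam * b\<^sup>2)"
      unfolding elliptic_quad_Suc by simp
  qed (use J in auto)
  then show ?thesis
    using hyperbolic_sum[OF J(4,5)] unfolding elliptic_plane_sum J(6) s by (simp add: algebra_simps power2_eq_square)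
qed

end

section \<open>Reduction to hyperbolic and elliptic normal forms\<close>

lemma coordinate_change_comp:
  assumes "coordinate_change n T" "coordinate_change n' T'" "n \<le> n'"
  shows "coordinate_change n' (\<lambda>x. T (T' x))"
  unfolding coordinate_change_def
proof (intro conjI allI impI)
  fix x i assume "\<forall>i. T (T' x) i = 0"
  then show "x i = 0" using assms unfolding coordinate_change_def by meson
qed (use assms in \<open>auto simp: coordinate_change_def\<close>)

text \<open>If \<open>a = 0\<close>, adding \<open>b * y\<close> to \<open>x\<close> removes the
  last term. Otherwise scaling by a square root of \<open>a\<close> yields x^2 + xy + ab y^2; adding
  \<open>u * y\<close> to \<open>x\<close> changes the last coefficient by
  \<open>u\<^sup>2 + u\<close>, which brings it to 0 or \<open>lam\<close>. The number
  \<open>p * t + q * r\<close> is the determinant of the substitution.\<close>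

lemma binary_normal_form:
  fixes a b :: 'a
  obtains p q r t where "p * t + q * r \<noteq> 0"
    "(\<forall>x y. a * (p * x + q * y)\<^sup>2 + (p * x + q * y) * (r * x + t * y) + b * (r * x + t * y)\<^sup>2 = x * y) \<or>
     (\<forall>x y. a * (p * x + q * y)\<^sup>2 + (p * x + q * y) * (r * x + t * y) + b * (r * x + t * y)\<^sup>2 =
        x\<^sup>2 + x * y + lam * y\<^sup>2)"
proof -
  have two: "z + z = 0" "z + (z + w) = w" for z w :: 'a
    using add_self[OF even_card] add_self_left[OF even_card] by auto
  show thesis
  proof (cases "a = 0")
    case True
    have "a * (1 * x + b * y)\<^sup>2 + (1 * x + b * y) * (0 * x + 1 * y) + b * (0 * x + 1 * y)\<^sup>2 = x * y" for x y
      by (simp add: True distrib_right power2_eq_square add.assoc two mult.assoc)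
    then show thesis by (intro that[of 1 1 b 0]) auto
  next
    case False
    obtain r where r: "r\<^sup>2 = a" using square_surj[OF even_card] by blast
    then have r0: "r \<noteq> 0" using False by auto
    have scaled: "a * (x / r)\<^sup>2 + (x / r) * (r * y) + b * (r * y)\<^sup>2 = x\<^sup>2 + x * y + a * b * y\<^sup>2" for x y
      using r0 by (simp add: r[symmetric] power_divide power_mult_distrib algebra_simps)
    have shift: "(x + u * y)\<^sup>2 + (x + u * y) * y + a * b * y\<^sup>2 = x\<^sup>2 + x * y + (a * b + (u\<^sup>2 + u)) * y\<^sup>2" for x y u
      by (simp add: square_add[OF even_card] power_mult_distrib power2_eq_square[of y] distrib_right distrib_left add_ac mult_ac)
    obtain u where u: "a * b + (u\<^sup>2 + u) = 0 \<or> a * b + (u\<^sup>2 + u) = lam" using artin_schreier_cosets by blast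
    then show thesis
    proof
      assume "a * b + (u\<^sup>2 + u) = lam"
      then have "a * ((x + u * y) / r)\<^sup>2 + ((x + u * y) / r) * (r * y) + b * (r * y)\<^sup>2 = x\<^sup>2 + x * y + lam * y\<^sup>2" for x y
        unfolding scaled shift by simp
      then show thesis using r0 by (intro that[of "1 / r" r "u / r" 0]) (auto simp: add_divide_distrib)
    next
      assume 0: "a * b + (u\<^sup>2 + u) = 0"
      \<comment> \<open>With last coefficient 0 the form is \<open>x * (x + y)\<close>; substituting
        \<open>x + y\<close> for \<open>y\<close> turns it into \<open>x * y\<close>.\<close>
      have "a * ((x + u * (x + y)) / r)\<^sup>2 + ((x + u * (x + y)) / r) * (r * (x + y)) + b * (r * (x + y))\<^sup>2 = x * y" for x y
        unfolding scaled shift 0 by (simp add: power2_eq_square distrib_left two)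
      then have "a * ((1 + u) / r * x + u / r * y)\<^sup>2 + ((1 + u) / r * x + u / r * y) * (r * x + r * y) +
          b * (r * x + r * y)\<^sup>2 = x * y" for x y
        by (simp add: add_divide_distrib distrib_left distrib_right add_ac)
      moreover have "(1 + u) / r * r + u / r * r \<noteq> 0" using r0 by (simp add: add.assoc two)
      ultimately show thesis by (intro that[of "(1 + u) / r" r "u / r" r]) auto
    qed
  qed
qed

text \<open>Origin of the substitution that trades two elliptic planes for two hyperbolic ones: let
  \<open>p\<close> and \<open>r\<close> be the sums of the first and of the second coordinates of
  the two planes. The common terms cancel, leaving \<open>p * (p + Y) + r * (X + lam * r)\<close>,
  where \<open>Y\<close> is the second coordinate in the first plane and \<open>X\<close> the first
  coordinate in the second plane; the two cofactors are \<open>q\<close> and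
  \<open>t\<close>.\<close>

lemma two_elliptic_planes:
  "((p + lam * r + t) :: 'a)\<^sup>2 + (p + lam * r + t) * (p + q) + lam * (p + q)\<^sup>2 +
   ((lam * r + t)\<^sup>2 + (lam * r + t) * (p + q + r) + lam * (p + q + r)\<^sup>2) = p * q + r * t"
proof -
  have "((p + lam * r + t) :: 'a)\<^sup>2 + (p + lam * r + t) * (p + q) + lam * (p + q)\<^sup>2 +
   ((lam * r + t)\<^sup>2 + (lam * r + t) * (p + q + r) + lam * (p + q + r)\<^sup>2) =
    p * q + r * t + (p\<^sup>2 + p\<^sup>2) + (lam * r * (lam * r) + lam * r * (lam * r)) + (t * t + t * t) +
    (lam * r * p + lam * r * p) + (lam * r * q + lam * r * q) + (t * p + t * p) + (t * q + t * q) +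
    (lam * (p * p) + lam * (p * p)) + (lam * (q * q) + lam * (q * q)) + (lam * r * r + lam * r * r)"
    unfolding square_add[OF even_card] by (simp add: power2_eq_square algebra_simps)
  then show ?thesis unfolding add_self[OF even_card] by simp
qed

text \<open>Planes are normalized one at a time. Two elliptic planes become two hyperbolic ones, so
  at most one elliptic plane remains, and it is kept in the last position.\<close>

lemma diagonal_planes_normal_form:
  "\<exists>T. coordinate_change (2*s) T \<and> ((\<forall>x. diagonal_planes a s (T x) = hyperbolic_quad s x) \<or>
      s \<ge> 1 \<and> (\<forall>x. diagonal_planes a s (T x) = elliptic_quad lam s x))"
proof (induction s)
  case 0
  have "coordinate_change 0 (\<lambda>x. x)" by (simp add: coordinate_change_def)
  then show ?case by (intro exI[of _ "\<lambda>x. x"]) (simp add: diagonal_planes_def hyperbolic_quad_def)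
next
  case (Suc s)
  then obtain T where T: "coordinate_change (2*s) T" and
    Ts: "(\<forall>x. diagonal_planes a s (T x) = hyperbolic_quad s x) \<or>
      s \<ge> 1 \<and> (\<forall>x. diagonal_planes a s (T x) = elliptic_quad lam s x)" by blast
  let ?i = "2*s + 1" and ?j = "2*s + 2"
  obtain p q r t where det: "p * t + q * r \<noteq> 0" and
    pqrt: "(\<forall>x y. a ?i * (p * x + q * y)\<^sup>2 + (p * x + q * y) * (r * x + t * y) + a ?j * (r * x + t * y)\<^sup>2 = x * y) \<or>
     (\<forall>x y. a ?i * (p * x + q * y)\<^sup>2 + (p * x + q * y) * (r * x + t * y) + a ?j * (r * x + t * y)\<^sup>2 =
        x\<^sup>2 + x * y + lam * y\<^sup>2)"
    using binary_normal_form[of "a ?i" "a ?j"] .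
  define T0 where "T0 x = x(?i := p * x ?i + q * x ?j, ?j := r * x ?i + t * x ?j)" for x :: "nat \<Rightarrow> 'a"
  have T0: "coordinate_change (2 * Suc s) T0"
    unfolding coordinate_change_def
  proof (intro conjI allI impI)
    fix x i assume 0: "\<forall>i. T0 x i = 0"
    then have e: "p * x ?i + q * x ?j = 0" "r * x ?i + t * x ?j = 0"
      using 0[rule_format, of ?i] 0[rule_format, of ?j] by (simp_all add: T0_def)
    \<comment> \<open>Cramer's rule with determinant \<open>p * t + q * r\<close>; the terms
      occurring twice vanish.\<close>
    have "(p * t + q * r) * x ?i = t * (p * x ?i + q * x ?j) + q * (r * x ?i + t * x ?j)"
      using add_self[OF even_card, of "t * q * x ?j"] by (simp add: algebra_simps)
    then have xi: "x ?i = 0" using det unfolding e by simp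
    have "(p * t + q * r) * x ?j = r * (p * x ?i + q * x ?j) + p * (r * x ?i + t * x ?j)"
      using add_self[OF even_card, of "r * p * x ?i"] by (simp add: algebra_simps)
    then have xj: "x ?j = 0" using det unfolding e by simp
    show "x i = 0" using xi xj 0[rule_format, of i] by (cases "i = ?i \<or> i = ?j") (auto simp: T0_def)
  qed (auto simp: T0_def fun_eq_iff algebra_simps)
  have T_fix: "T x ?i = x ?i" "T x ?j = x ?j" for x using T by (auto simp: coordinate_change_def)
  have T0_low: "hyperbolic_quad s (T0 x) = hyperbolic_quad s x" for x
    by (rule hyperbolic_quad_cong) (auto simp: T0_def)
  have T0_low': "elliptic_quad lam s (T0 x) = elliptic_quad lam s x" if s1: "s \<ge> 1" for x
  proof -
    obtain s' where "s = Suc s'" using s1 by (cases s) auto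
    moreover have "hyperbolic_quad s' (T0 x) = hyperbolic_quad s' x" if "s = Suc s'"
      by (rule hyperbolic_quad_cong) (use that in \<open>auto simp: T0_def\<close>)
    ultimately show ?thesis by (simp add: elliptic_quad_Suc) (simp add: T0_def)
  qed
  define U where "U x = T (T0 x)" for x
  have U: "coordinate_change (2 * Suc s) U"
    unfolding U_def by (rule coordinate_change_comp[OF T T0]) simp
  define E where "E x y = a ?i * (p * x + q * y)\<^sup>2 + (p * x + q * y) * (r * x + t * y) + a ?j * (r * x + t * y)\<^sup>2" for x y
  have dU: "diagonal_planes a (Suc s) (U x) = diagonal_planes a s (T (T0 x)) + E (x ?i) (x ?j)" for x
    unfolding U_def diagonal_planes_def E_def by (simp add: T_fix[simplified]) (simp add: T0_def)
  from Ts show ?case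
  proof
    assume h: "\<forall>x. diagonal_planes a s (T x) = hyperbolic_quad s x"
    show ?case using pqrt unfolding E_def[symmetric]
      by (intro exI[of _ U] conjI U) (auto simp: dU h T0_low hyperbolic_quad_Suc elliptic_quad_Suc)
  next
    assume "s \<ge> 1 \<and> (\<forall>x. diagonal_planes a s (T x) = elliptic_quad lam s x)"
    then have s1: "s \<ge> 1" and h: "\<And>x. diagonal_planes a s (T x) = elliptic_quad lam s x" by auto
    obtain s' where s': "s = Suc s'" using s1 by (cases s) auto
    let ?k = "2*s' + 1" and ?l = "2*s' + 2"
    from pqrt[folded E_def] show ?case
    proof
      assume E: "\<forall>x y. E x y = x * y"
      \<comment> \<open>Exchange of the elliptic plane at \<open>?k\<close>, \<open>?l\<close> with
        the new hyperbolic plane, which puts the elliptic one last.\<close>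
      define W where "W x = x(?k := x ?i, ?l := x ?j, ?i := x ?k, ?j := x ?l)" for x :: "nat \<Rightarrow> 'a"
      have W: "coordinate_change (2 * Suc s) W"
        unfolding coordinate_change_def
      proof (intro conjI allI impI)
        fix x i assume 0: "\<forall>i. W x i = 0"
        show "x i = 0"
          using 0[rule_format, of ?k] 0[rule_format, of ?l] 0[rule_format, of ?i] 0[rule_format, of ?j] 0[rule_format, of i]
          by (auto simp: W_def s' split: if_splits)
      qed (auto simp: W_def s' fun_eq_iff)
      have W_low: "hyperbolic_quad s' (W x) = hyperbolic_quad s' x" for x
        by (rule hyperbolic_quad_cong) (auto simp: W_def s')
      have "diagonal_planes a (Suc s) (U (W x)) = elliptic_quad lam (Suc s) x" for x
        unfolding dU E[rule_format] h T0_low'[OF s1] elliptic_quad_Suc[of _ s]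
        unfolding s' elliptic_quad_Suc hyperbolic_quad_Suc W_low by (simp add: W_def s' add_ac)
      then show ?thesis using coordinate_change_comp[OF U W] by (intro exI[of _ "\<lambda>x. U (W x)"]) auto
    next
      assume E: "\<forall>x y. E x y = x\<^sup>2 + x * y + lam * y\<^sup>2"
      \<comment> \<open>The substitution of \<open>two_elliptic_planes\<close>, whose
        \<open>p\<close>, \<open>q\<close>, \<open>r\<close>, \<open>t\<close> are the entries at
        \<open>?k\<close>, \<open>?l\<close>, \<open>?i\<close>, \<open>?j\<close>.\<close>
      define W where "W x = x(?k := x ?k + lam * x ?i + x ?j, ?l := x ?k + x ?l,
          ?i := lam * x ?i + x ?j, ?j := x ?k + x ?l + x ?i)" for x :: "nat \<Rightarrow> 'a"
      have W: "coordinate_change (2 * Suc s) W"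
        unfolding coordinate_change_def
      proof (intro conjI allI impI)
        fix x i assume 0: "\<forall>i. W x i = 0"
        have e: "x ?k + (lam * x ?i + x ?j) = 0" "x ?k + x ?l = 0" "lam * x ?i + x ?j = 0" "x ?k + x ?l + x ?i = 0"
          using 0[rule_format, of ?k] 0[rule_format, of ?l] 0[rule_format, of ?i] 0[rule_format, of ?j]
          by (auto simp: W_def s' add.assoc split: if_splits)
        have "x ?k = 0" using e(1) unfolding e(3) by simp
        moreover have "x ?i = 0" using e(4) unfolding e(2) by simp
        ultimately have "x ?k = 0" "x ?l = 0" "x ?i = 0" "x ?j = 0" using e by auto
        then show "x i = 0" using 0[rule_format, of i]
          by (cases "i = ?k \<or> i = ?l \<or> i = ?i \<or> i = ?j") (auto simp: W_def)
      qed (auto simp: W_def s' fun_eq_iff algebra_simps)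
      have W_low: "hyperbolic_quad s' (W x) = hyperbolic_quad s' x" for x
        by (rule hyperbolic_quad_cong) (auto simp: W_def s')
      have "diagonal_planes a (Suc s) (U (W x)) = hyperbolic_quad (Suc s) x" for x
      proof -
        have "diagonal_planes a (Suc s) (U (W x)) = hyperbolic_quad s' x +
          (((x ?k + lam * x ?i + x ?j))\<^sup>2 + (x ?k + lam * x ?i + x ?j) * (x ?k + x ?l) + lam * (x ?k + x ?l)\<^sup>2 +
   ((lam * x ?i + x ?j)\<^sup>2 + (lam * x ?i + x ?j) * (x ?k + x ?l + x ?i) + lam * (x ?k + x ?l + x ?i)\<^sup>2))"
          unfolding dU E[rule_format] h T0_low'[OF s1] unfolding s' elliptic_quad_Suc W_low
          by (simp add: W_def s' add.assoc)
        then show ?thesis unfolding two_elliptic_planes unfolding s' hyperbolic_quad_Suc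
          by (simp add: add_ac)
      qed
      then show ?thesis using coordinate_change_comp[OF U W] by (intro exI[of _ "\<lambda>x. U (W x)"]) auto
    qed
  qed
qed

end

end

section \<open>Types of quadratic forms\<close>

lemma hyperbolic_quad_scale: "hyperbolic_quad s (\<lambda>i. c * x i) = c\<^sup>2 * hyperbolic_quad s x"
  by (simp add: hyperbolic_quad_def sum_distrib_left power2_eq_square mult_ac)

lemma elliptic_quad_scale: "elliptic_quad l s (\<lambda>i. c * x i) = c\<^sup>2 * elliptic_quad l s x"
  by (simp add: elliptic_quad_def sum_distrib_left power2_eq_square distrib_left mult_ac)

lemma elliptic_quad_cong:
  assumes "\<And>i. i \<in> {1..2*s} \<Longrightarrow> x i = y i" "s \<ge> 1"
  shows "elliptic_quad l s x = elliptic_quad l s y"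
proof -
  obtain s' where s: "s = Suc s'" using assms(2) by (cases s) auto
  have "hyperbolic_quad s' x = hyperbolic_quad s' y"
    by (rule hyperbolic_quad_cong, rule assms(1)) (auto simp: s)
  then show ?thesis using assms(1) by (simp add: s elliptic_quad_Suc)
qed

lemma diagonal_planes_cong:
  assumes "\<And>i. i \<in> {1..2*s} \<Longrightarrow> x i = y i"
  shows "diagonal_planes a s x = diagonal_planes a s y"
proof -
  have "x (2*k - 1) = y (2*k - 1) \<and> x (2*k) = y (2*k)" if "k \<in> {1..s}" for k
    using that by (intro conjI assms) auto
  then show ?thesis unfolding diagonal_planes_def by (intro sum.cong refl) (simp del: One_nat_def)
qed

section \<open>Hyperbolic families and symplectic bases\<close>

definition partner :: "nat \<Rightarrow> nat" where
  "partner i = (if even i then i - 1 else i + 1)"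

lemma partner_in: "i \<in> {1..2*r} \<Longrightarrow> partner i \<in> {1..2*r}"
proof (cases "even i")
  case False
  assume i: "i \<in> {1..2*r}"
  obtain k where k: "i = 2 * k + 1" using False by (elim oddE)
  then have "k < r" using i by simp
  then show ?thesis using k by (simp add: partner_def)
qed (auto simp: partner_def elim!: evenE)

lemma partner_partner: "i \<ge> 1 \<Longrightarrow> partner (partner i) = i"
  by (cases "even i") (auto simp: partner_def elim!: evenE oddE)

lemma partner_eq_iff: "i \<ge> 1 \<Longrightarrow> j \<ge> 1 \<Longrightarrow> j = partner i \<longleftrightarrow> i = partner j"
  using partner_partner by metis

lemma partner_less_iff: "i \<ge> 1 \<Longrightarrow> i < j \<Longrightarrow> j = partner i \<longleftrightarrow> even j \<and> i = j - 1"
  by (cases "even i") (auto simp: partner_def)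

lemma sum_partner:
  fixes f :: "nat \<Rightarrow> nat \<Rightarrow> 'b::comm_monoid_add"
  shows "(\<Sum>i=1..2*r. f i (partner i)) = (\<Sum>k=1..r. f (2*k - 1) (2*k) + f (2*k) (2*k - 1))"
  unfolding sum_pairs by (intro sum.cong refl) (auto simp: partner_def)

context finite_form_space
begin

text \<open>The image basis under \<open>L\<close>, divided by \<open>\<gamma>\<close>. With
  \<open>\<gamma>\<^sup>2\<close> the inverse of the scalar of an equivalence, the choice of basis
  absorbs both the scalar and \<open>L\<close>.\<close>

lemma transport_basis:
  assumes b: "is_basis scale b" and L: "L \<in> GL scale" and \<gamma>: "\<gamma> \<noteq> 0"
  obtains b' where "is_basis scale b'"
    "\<And>v i. i \<in> {1..dim_V} \<Longrightarrow> coords scale b' (L v) i = \<gamma> * coords scale b v i"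
proof -
  have L_add: "L (x + y) = L x + L y" and L_scale: "L (scale c x) = scale c (L x)" for x y c
    using L unfolding GL_def Vector_Spaces.linear_iff by auto
  have L0: "L 0 = 0" using L_scale[of 0 0] by simp
  have inj: "inj L" using L by (auto simp: GL_def bij_def)
  define b' where "b' i = scale (inverse \<gamma>) (L (b i))" for i
  have L_sum: "L (sum f A) = (\<Sum>i\<in>A. L (f i))" for f :: "nat \<Rightarrow> 'v" and A
    by (induction A rule: infinite_finite_induct) (simp_all add: L0 L_add)
  have lc: "lincomb n b' x = scale (inverse \<gamma>) (L (lincomb n b x))" for n x
    by (simp add: lincomb_def b'_def L_sum L_scale scale_sum_right mult.commute)
  have b': "is_basis scale b'"
  proof (rule is_basisI)
    fix x assume "lincomb dim_V b' x = 0"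
    then have "L (lincomb dim_V b x) = L 0" using \<gamma> by (simp add: lc L0)
    then have "lincomb dim_V b x = 0" by (rule injD[OF inj])
    then have "lincomb dim_V b x = lincomb dim_V b (\<lambda>_. 0)" by (simp add: lincomb_def)
    then show "\<forall>i\<in>{1..dim_V}. x i = 0" by (simp only: lincomb_eq_iff[OF b])
  qed
  moreover have "coords scale b' (L v) i = \<gamma> * coords scale b v i" if "i \<in> {1..dim_V}" for v i
  proof -
    have "lincomb dim_V b' (\<lambda>i. \<gamma> * coords scale b v i) = L v"
      using \<gamma> by (simp add: lincomb_scale) (simp add: lc lincomb_coords[OF b])
    then show ?thesis using coords_lincomb[OF b' that, of "\<lambda>i. \<gamma> * coords scale b v i"] by simp
  qed
  ultimately show thesis by (rule that)
qed

lemma id_in_GL: "(\<lambda>x. x) \<in> GL scale"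
  unfolding GL_def Vector_Spaces.linear_iff by (simp add: vector_space_axioms bij_def)

lemma GL_surj: "L \<in> GL scale \<Longrightarrow> \<exists>v. L v = w"
  unfolding GL_def by (auto simp: bij_def surj_def) metis

lemma quad_rank_0: "quad_rank scale (\<lambda>_. 0) = 0"
  by (simp add: quad_rank_def polar_def vdim_def)

lemma quad_rank_le: "quad_rank scale Q \<le> dim_V"
  by (simp add: quad_rank_def)

lemma obtain_basis: obtains b where "is_basis scale b"
proof -
  obtain b where b: "bij_betw (lincomb dim_V b) (vecs {1..dim_V}) UNIV"
    "inj_on b {1..dim_V}" "independent (b ` {1..dim_V})"
    unfolding vdim_def by (rule subspace_enumE[OF subspace_UNIV])
  have "span (b ` {1..dim_V}) = UNIV"
    using bij_betw_imp_surj_on[OF b(1)] bij_betw_imp_surj_on[OF lincomb_bij_span[OF b(2,3)]] by simp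
  then show thesis using that b unfolding is_basis_def by blast
qed

definition hyperbolic_family :: "('v \<Rightarrow> 'v \<Rightarrow> 'a) \<Rightarrow> nat \<Rightarrow> (nat \<Rightarrow> 'v) \<Rightarrow> bool" where
  "hyperbolic_family S r x \<longleftrightarrow>
     (\<forall>i\<in>{1..2*r}. \<forall>j\<in>{1..2*r}. S (x i) (x j) = (if j = partner i then 1 else 0))"

text \<open>Pairing with a member of the family extracts the coefficient at the partner index, which
  makes hyperbolic families linearly independent.\<close>

lemma hyperbolic_family_coeff:
  assumes S: "S \<in> symmetric_bilinear_forms scale" and x: "hyperbolic_family S r x" and j: "j \<in> {1..2*r}"
  shows "S (lincomb (2*r) x c) (x j) = c (partner j)"
proof -
  have "S (lincomb (2*r) x c) (x j) = (\<Sum>i=1..2*r. c i * (if i = partner j then 1 else 0))"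
    unfolding form_lincomb_left[OF S]
  proof (intro sum.cong refl arg_cong2[where f = "(*)"])
    fix i assume i: "i \<in> {1..2*r}"
    then have "j = partner i \<longleftrightarrow> i = partner j" using j by (intro partner_eq_iff) auto
    then show "S (x i) (x j) = (if i = partner j then 1 else 0)"
      using x i j unfolding hyperbolic_family_def by simp
  qed
  then show ?thesis using partner_in[OF j] by (simp add: sum_mult_delta)
qed

lemma hyperbolic_family_bound:
  assumes S: "S \<in> symmetric_bilinear_forms scale" and x: "hyperbolic_family S r x"
  shows "2 * r \<le> dim_V"
proof -
  have "\<forall>i\<in>{1..2*r}. c i = 0" if "lincomb (2*r) x c = 0" for c
  proof
    fix i assume i: "i \<in> {1..2*r}"
    have "c (partner (partner i)) = 0"
      using hyperbolic_family_coeff[OF S x partner_in[OF i], of c] that by (simp add: form_0[OF S])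
    then show "c i = 0" using i by (simp add: partner_partner)
  qed
  note ind = lincomb_inj_imp_independent[OF this]
  have "CARD('a) ^ (2 * r) = card (span (x ` {1..2*r}))"
    using bij_betw_same_card[OF lincomb_bij_span[OF ind]] by (simp add: card_vecs)
  also have "\<dots> \<le> CARD('v)" by (intro card_mono) (use finite_UNIV_V in auto)
  finally show ?thesis
    unfolding card_UNIV_V using CARD_field_gt_1[where 'a = 'a] power_le_imp_le_exp by blast
qed

end

context even_form_space
begin

text \<open>The dimension bounds the length of hyperbolic families, so a longest one exists. If the
  projections of two vectors to its orthogonal complement had a nonzero product, they could be
  appended after scaling; hence every projection lies in the radical.\<close>

lemma maximal_hyperbolic_family:
  assumes S: "S \<in> symmetric_bilinear_forms scale" and alt: "\<And>x. S x x = 0"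
  obtains r x where "hyperbolic_family S r x"
    "\<And>v w. S (v - lincomb (2*r) x (\<lambda>i. S v (x (partner i)))) w = 0"
proof -
  have "\<exists>x. hyperbolic_family S 0 x" by (simp add: hyperbolic_family_def)
  moreover have "\<forall>r. (\<exists>x. hyperbolic_family S r x) \<longrightarrow> r \<le> dim_V"
    using hyperbolic_family_bound[OF S] by (metis le_add1 le_trans mult_2)
  ultimately obtain r where r: "\<exists>x. hyperbolic_family S r x" and
    max: "\<And>r'. (\<exists>x. hyperbolic_family S r' x) \<Longrightarrow> r' \<le> r"
    using ex_has_greatest_nat[of "\<lambda>r. \<exists>x. hyperbolic_family S r x" 0 id "Suc dim_V"] by (auto simp: less_Suc_eq_le)
  obtain x where x: "hyperbolic_family S r x" using r by blast
  \<comment> \<open>Projection to the orthogonal complement of the family: the coefficient at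
    \<open>i\<close> is the product with the partner of \<open>x i\<close>.\<close>
  define pr where "pr v = v - lincomb (2*r) x (\<lambda>i. S v (x (partner i)))" for v
  note sadd = form_add_left[OF S] form_add_right[OF S] form_scale_left[OF S] form_scale_right[OF S]
  have pr_orth: "S (pr v) (x j) = 0" if j: "j \<in> {1..2*r}" for v j
  proof -
    have "S v (x j) = S (pr v + lincomb (2*r) x (\<lambda>i. S v (x (partner i)))) (x j)" by (simp add: pr_def)
    also have "\<dots> = S (pr v) (x j) + S v (x j)"
      using j unfolding sadd hyperbolic_family_coeff[OF S x j] by (simp add: partner_partner)
    finally show ?thesis by simp
  qed
  have pr_pr: "S (pr v) (pr w) = 0" for v w
  proof (rule ccontr)
    assume nz: "S (pr v) (pr w) \<noteq> 0"
    define y where "y = scale (inverse (S (pr v) (pr w))) (pr w)"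
    define x' where "x' = x(2*r + 1 := pr v, 2*r + 2 := y)"
    have 1: "S (pr v) y = 1" "S y (pr v) = 1"
      using nz form_sym[OF S, of y "pr v"] by (auto simp: y_def sadd)
    have o: "S (pr v) (x j) = 0" "S y (x j) = 0" "S (x j) (pr v) = 0" "S (x j) y = 0" if "j \<in> {1..2*r}" for j
      using pr_orth[OF that] form_sym[OF S, of "x j"] by (auto simp: y_def sadd)
    have "hyperbolic_family S (Suc r) x'"
      unfolding hyperbolic_family_def
    proof (intro ballI)
      fix i j assume "i \<in> {1..2 * Suc r}" "j \<in> {1..2 * Suc r}"
      then have "i \<in> {1..2*r} \<or> i = 2*r + 1 \<or> i = 2*r + 2" "j \<in> {1..2*r} \<or> j = 2*r + 1 \<or> j = 2*r + 2" by auto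
      moreover have "partner (2*r + 1) = 2*r + 2" "partner (2*r + 2) = 2*r + 1" by (auto simp: partner_def)
      moreover have "x' k = x k" if "k \<in> {1..2*r}" for k using that by (auto simp: x'_def)
      moreover have "x' (2*r + 1) = pr v" "x' (2*r + 2) = y" by (auto simp: x'_def)
      moreover have "k \<noteq> 2*r + 1" "k \<noteq> 2*r + 2" if "k \<in> {1..2*r}" for k using that by auto
      moreover have "partner i \<in> {1..2*r}" if "i \<in> {1..2*r}" using partner_in[OF that] .
      moreover have "S (x i) (x j) = (if j = partner i then 1 else 0)" if "i \<in> {1..2*r}" "j \<in> {1..2*r}"
        using x that unfolding hyperbolic_family_def by blast
      ultimately show "S (x' i) (x' j) = (if j = partner i then 1 else 0)"
        using alt[of "pr v"] alt[of y] 1 o by (elim disjE) (simp_all del: One_nat_def; metis)+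
    qed
    then show False using max[of "Suc r"] by auto
  qed
  have "S (pr v) w = 0" for v w
  proof -
    have "w = pr w + lincomb (2*r) x (\<lambda>i. S w (x (partner i)))" by (simp add: pr_def)
    then have "S (pr v) w = S (pr v) (pr w) + S (pr v) (lincomb (2*r) x (\<lambda>i. S w (x (partner i))))"
      by (metis sadd(2))
    also have "\<dots> = 0" unfolding form_lincomb_right[OF S] using pr_pr pr_orth by simp
    finally show ?thesis .
  qed
  then show thesis using that[OF x] unfolding pr_def by blast
qed

lemma symplectic_basis:
  assumes S: "S \<in> symmetric_bilinear_forms scale" and alt: "\<And>x. S x x = 0"
  obtains b r where "is_basis scale b" "2 * r \<le> dim_V"
    "card {x. \<forall>y. S x y = 0} * CARD('a) ^ (2 * r) = CARD('a) ^ dim_V"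
    "hyperbolic_family S r b" "\<And>i y. i \<in> {2*r + 1..dim_V} \<Longrightarrow> S (b i) y = 0"
proof -
  obtain r x where x: "hyperbolic_family S r x"
    and pr: "\<And>v w. S (v - lincomb (2*r) x (\<lambda>i. S v (x (partner i)))) w = 0"
    using maximal_hyperbolic_family[OF S alt] by blast
  have ind: "\<forall>i\<in>{1..2*r}. c i = 0" if "lincomb (2*r) x c \<in> {x. \<forall>y. S x y = 0}" for c
  proof
    fix i assume i: "i \<in> {1..2*r}"
    have "c (partner (partner i)) = 0"
      using hyperbolic_family_coeff[OF S x partner_in[OF i], of c] that by simp
    then show "c i = 0" using i by (simp add: partner_partner)
  qed
  obtain b where b: "is_basis scale b" "\<And>i. i \<in> {1..2*r} \<Longrightarrow> b i = x i"
    "\<And>i. i \<in> {2*r+1..dim_V} \<Longrightarrow> b i \<in> {x. \<forall>y. S x y = 0}" "2*r \<le> dim_V"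
    "card {x. \<forall>y. S x y = 0} * CARD('a) ^ (2*r) = CARD('a) ^ dim_V"
  proof (rule basis_extending[OF subspace_radical[OF S] ind])
    show "\<exists>c. v - lincomb (2*r) x c \<in> {x. \<forall>y. S x y = 0}" for v using pr by blast
  qed blast+
  have "hyperbolic_family S r b" using x b(2) by (simp add: hyperbolic_family_def)
  then show thesis using that b by blast
qed

text \<open>The condition \<open>vanishes_on_radical\<close>, which even rank implies, stated
  without coordinates.\<close>

lemma vanishes_on_polar_radical:
  assumes Q: "Q \<in> quadratic_forms scale" and rank: "quad_rank scale Q = 2 * s"
    and v: "\<And>w. polar Q v w = 0"
  shows "Q v = 0"
proof -
  obtain b where b: "is_basis scale b" by (rule obtain_basis)
  obtain B d where B: "B \<in> alternating_on {1..dim_V}" and Q': "Q = form_of b B d"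
  proof -
    have "Q \<in> (\<lambda>(B, d). form_of b B d) ` (alternating_on {1..dim_V} \<times> vecs {1..dim_V})"
      unfolding bij_betw_imp_surj_on[OF bij_form_of[OF b]] by (rule Q)
    then show thesis using that by (elim imageE) auto
  qed
  have van: "vanishes_on_radical dim_V B d" using rank unfolding Q' quad_rank_form_of(1)[OF b B] by blast
  obtain x where x: "x \<in> vecs {1..dim_V}" "v = lincomb dim_V b x"
    using bij_betw_imp_surj_on[OF lincomb_bij[OF b]] by blast
  have "x \<in> matrix_radical {1..dim_V} B"
    using v x polar_form_of_eq_0[OF b B, of d x] unfolding Q' by (simp add: matrix_radical_def)
  then show ?thesis using van unfolding Q' x(2) form_of_lincomb[OF b] vanishes_on_radical_def by blast
qed

text \<open>In a symplectic basis of the polarization the cross terms reduce to one product per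
  plane, and because the rank is even the basis vectors in the radical have value 0.\<close>

lemma quad_diagonal_planes:
  assumes Q: "Q \<in> quadratic_forms scale" and rank: "quad_rank scale Q = 2 * s"
  obtains b a where "is_basis scale b" "\<And>v. Q v = diagonal_planes a s (coords scale b v)"
proof -
  note P = quadratic_formsD(2)[OF Q]
  obtain b r where b: "is_basis scale b" "2 * r \<le> dim_V"
    and card_rad: "card {x. \<forall>y. polar Q x y = 0} * CARD('a) ^ (2 * r) = CARD('a) ^ dim_V"
    and fam: "hyperbolic_family (polar Q) r b" and rad: "\<And>i y. i \<in> {2*r + 1..dim_V} \<Longrightarrow> polar Q (b i) y = 0"
    using symplectic_basis[OF P polar_self[OF Q]] by blast
  have "{x. (\<forall>y. polar Q x y = 0) \<and> Q x = 0} = {x. \<forall>y. polar Q x y = 0}"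
    using vanishes_on_polar_radical[OF Q rank] by blast
  then have "quad_rank scale Q = 2 * r"
    unfolding quad_rank_iff[OF Q] using card_rad by simp
  then have s: "s = r" using rank by simp
  have Qb: "Q (b i) = 0" if "i \<in> {2*r + 1..dim_V}" for i
    using vanishes_on_polar_radical[OF Q rank, of "b i"] rad[OF that] by simp
  have rad': "polar Q y (b i) = 0" if "i \<in> {2*r + 1..dim_V}" for i y
    using rad[OF that, of y] form_sym[OF P, of y "b i"] by simp
  have split: "(\<Sum>i=1..dim_V. f i) = (\<Sum>i=1..2*r. f i)" if "\<And>i. i \<in> {2*r + 1..dim_V} \<Longrightarrow> f i = 0" for f :: "nat \<Rightarrow> 'a"
    using b(2) that by (intro sum.mono_neutral_right) auto
  have "Q v = diagonal_planes (\<lambda>i. Q (b i)) s (coords scale b v)" for v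
  proof -
    let ?c = "coords scale b v"
    have "Q v = Q (lincomb dim_V b ?c)" by (simp add: lincomb_coords[OF b(1)])
    also have "\<dots> = (\<Sum>i=1..dim_V. Q (b i) * (?c i)\<^sup>2) + (\<Sum>j=1..dim_V. \<Sum>i=1..<j. polar Q (b i) (b j) * ?c i * ?c j)"
      unfolding quad_lincomb[OF Q] matrix_quad_def cross_terms_def ..
    also have "(\<Sum>i=1..dim_V. Q (b i) * (?c i)\<^sup>2) = (\<Sum>i=1..2*r. Q (b i) * (?c i)\<^sup>2)"
      by (rule split) (simp add: Qb)
    also have "(\<Sum>j=1..dim_V. \<Sum>i=1..<j. polar Q (b i) (b j) * ?c i * ?c j) =
      (\<Sum>j=1..2*r. \<Sum>i=1..<j. polar Q (b i) (b j) * ?c i * ?c j)"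
      by (rule split) (simp add: rad')
    also have "\<dots> = (\<Sum>j=1..2*r. if even j then ?c (j - 1) * ?c j else 0)"
    proof (intro sum.cong refl)
      fix j assume j: "j \<in> {1..2*r}"
      have "(\<Sum>i=1..<j. polar Q (b i) (b j) * ?c i * ?c j) = (\<Sum>i=1..<j. if even j \<and> i = j - 1 then ?c i * ?c j else 0)"
        using fam j by (intro sum.cong refl) (auto simp: hyperbolic_family_def partner_less_iff)
      also have "\<dots> = (if even j then ?c (j - 1) * ?c j else 0)"
      proof (cases "even j")
        case True
        then have "j - 1 \<in> {1..<j}" using j by (auto elim!: evenE)
        then show ?thesis using True by (simp del: One_nat_def)
      qed simp
      finally show "(\<Sum>i=1..<j. polar Q (b i) (b j) * ?c i * ?c j) = (if even j then ?c (j - 1) * ?c j else 0)" .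
    qed
    also have "(\<Sum>i=1..2*r. Q (b i) * (?c i)\<^sup>2) + (\<Sum>j=1..2*r. if even j then ?c (j - 1) * ?c j else 0) =
      diagonal_planes (\<lambda>i. Q (b i)) s ?c"
      unfolding sum_pairs diagonal_planes_def s sum.distrib[symmetric]
      by (intro sum.cong refl) (auto simp: add_ac)
    finally show ?thesis .
  qed
  then show thesis using that b by blast
qed

section \<open>Existence of a type and its detection by the Gauss sum\<close>

context
  fixes lam :: 'a
  assumes lam: "absolute_trace lam = 1"
begin

text \<open>The new basis vectors have the images under \<open>T\<close> of the unit vectors as old
  coordinates. The witness \<open>x\<close> truncates the new coordinates, because
  \<open>coords\<close> is meaningful only up to the dimension while \<open>T\<close> may read every
  index.\<close>

lemma coordinate_change_basis:
  assumes b: "is_basis scale b" and T: "coordinate_change n T" and n: "n \<le> dim_V"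
  obtains b' where "is_basis scale b'"
    "\<And>v. \<exists>x. (\<forall>i\<in>{1..dim_V}. coords scale b' v i = x i \<and> coords scale b v i = T x i)"
proof -
  have T_add: "T (\<lambda>i. x i + y i) = (\<lambda>i. T x i + T y i)" for x y
    using T unfolding coordinate_change_def by blast
  have T_scale: "T (\<lambda>i. c * x i) = (\<lambda>i. c * T x i)" for c x
    using T unfolding coordinate_change_def by blast
  have T_inj: "\<forall>i. T x i = 0 \<Longrightarrow> x i = 0" for x i
    using T unfolding coordinate_change_def by blast
  have T_fix: "i \<notin> {1..n} \<Longrightarrow> T x i = x i" for x i
    using T unfolding coordinate_change_def by blast
  define e where "e i = (\<lambda>k. if k = i then 1 else 0 :: 'a)" for i :: nat
  define tr where "tr n x = (\<lambda>k. if k \<in> {1..n} then x k else 0 :: 'a)" for n :: nat and x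
  define b' where "b' i = lincomb dim_V b (T (e i))" for i
  have lc: "lincomb k b' x = lincomb dim_V b (T (tr k x))" for k x
  proof (induction k)
    case 0
    have "T (\<lambda>i. 0) = (\<lambda>i. 0)" using T_scale[of 0 "\<lambda>_. 0"] by simp
    then show ?case by (simp add: lincomb_def tr_def)
  next
    case (Suc k)
    have "tr (Suc k) x = (\<lambda>i. tr k x i + x (Suc k) * e (Suc k) i)"
      by (auto simp: tr_def e_def fun_eq_iff)
    then have "lincomb dim_V b (T (tr (Suc k) x)) = lincomb dim_V b (T (tr k x)) + scale (x (Suc k)) (b' (Suc k))"
      by (simp only: T_add T_scale lincomb_add lincomb_scale b'_def)
    moreover have "lincomb (Suc k) b' x = lincomb k b' x + scale (x (Suc k)) (b' (Suc k))"
      by (simp add: lincomb_def)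
    ultimately show ?case using Suc by simp
  qed
  have b': "is_basis scale b'"
  proof (rule is_basisI)
    fix x assume "lincomb dim_V b' x = 0"
    then have "lincomb dim_V b (T (tr dim_V x)) = lincomb dim_V b (\<lambda>_. 0)" by (simp add: lc) (simp add: lincomb_def)
    then have 0: "\<forall>i\<in>{1..dim_V}. T (tr dim_V x) i = 0" by (simp only: lincomb_eq_iff[OF b])
    have "T (tr dim_V x) i = 0" for i
    proof (cases "i \<in> {1..dim_V}")
      case False
      then have "i \<notin> {1..n}" using n by auto
      then show ?thesis using False by (simp add: T_fix) (auto simp: tr_def)
    qed (use 0 in blast)
    then have "tr dim_V x i = 0" for i using T_inj by blast
    then show "\<forall>i\<in>{1..dim_V}. x i = 0" unfolding tr_def by metis
  qed
  have "\<exists>x. (\<forall>i\<in>{1..dim_V}. coords scale b' v i = x i \<and> coords scale b v i = T x i)" for v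
  proof (intro exI ballI conjI)
    let ?x = "tr dim_V (coords scale b' v)"
    fix i assume i: "i \<in> {1..dim_V}"
    show "coords scale b' v i = ?x i" using i by (simp add: tr_def)
    have "v = lincomb dim_V b' (coords scale b' v)" by (simp add: lincomb_coords[OF b'])
    then have "v = lincomb dim_V b (T ?x)" unfolding lc .
    then show "coords scale b v i = T ?x i" using coords_lincomb[OF b i, of "T ?x"] by simp
  qed
  then show thesis using that b' by blast
qed

lemma quad_type_exists:
  assumes Q: "Q \<in> quadratic_forms scale" and rank: "quad_rank scale Q = 2 * s" and s: "s \<ge> 1"
  shows "quad_has_type scale lam Q 1 \<or> quad_has_type scale lam Q (-1)"
proof -
  have sm: "2 * s \<le> dim_V" using rank quad_rank_le[of Q] by simp
  obtain b a where b: "is_basis scale b" and Qb: "\<And>v. Q v = diagonal_planes a s (coords scale b v)"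
    using quad_diagonal_planes[OF Q rank] by blast
  obtain T where T: "coordinate_change (2*s) T" and
    Ts: "(\<forall>x. diagonal_planes a s (T x) = hyperbolic_quad s x) \<or>
      s \<ge> 1 \<and> (\<forall>x. diagonal_planes a s (T x) = elliptic_quad lam s x)"
    using diagonal_planes_normal_form[OF even_card lam, of s a] by blast
  obtain b' where b': "is_basis scale b'" and
    c: "\<And>v. \<exists>x. (\<forall>i\<in>{1..dim_V}. coords scale b' v i = x i \<and> coords scale b v i = T x i)"
    using coordinate_change_basis[OF b T sm] by blast
  have "Q v = hyperbolic_quad s (coords scale b' v)" if h: "\<forall>x. diagonal_planes a s (T x) = hyperbolic_quad s x" for v
  proof -
    obtain x where x: "\<And>i. i \<in> {1..2*s} \<Longrightarrow> coords scale b' v i = x i" "\<And>i. i \<in> {1..2*s} \<Longrightarrow> coords scale b v i = T x i"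
      using c[of v] sm by auto
    have "Q v = diagonal_planes a s (T x)" unfolding Qb by (rule diagonal_planes_cong[OF x(2)])
    also have "\<dots> = hyperbolic_quad s (coords scale b' v)" unfolding h[rule_format] by (rule hyperbolic_quad_cong[OF x(1)[symmetric]])
    finally show ?thesis .
  qed
  moreover have "Q v = elliptic_quad lam s (coords scale b' v)" if h: "\<forall>x. diagonal_planes a s (T x) = elliptic_quad lam s x" for v
  proof -
    obtain x where x: "\<And>i. i \<in> {1..2*s} \<Longrightarrow> coords scale b' v i = x i" "\<And>i. i \<in> {1..2*s} \<Longrightarrow> coords scale b v i = T x i"
      using c[of v] sm by auto
    have "Q v = diagonal_planes a s (T x)" unfolding Qb by (rule diagonal_planes_cong[OF x(2)])
    also have "\<dots> = elliptic_quad lam s (coords scale b' v)" unfolding h[rule_format] by (rule elliptic_quad_cong[OF x(1)[symmetric] s])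
    finally show ?thesis .
  qed
  ultimately have "(\<forall>v. hyperbolic_quad s (coords scale b' v) = 1 * Q v) \<or> (\<forall>v. elliptic_quad lam s (coords scale b' v) = 1 * Q v)"
    using Ts by (metis mult_1)
  then have "quad_equivalent scale Q (\<lambda>v. hyperbolic_quad s (coords scale b' v)) \<or>
      quad_equivalent scale Q (\<lambda>v. elliptic_quad lam s (coords scale b' v))"
    unfolding quad_equivalent_def using id_in_GL by (metis zero_neq_one)
  then show ?thesis unfolding quad_has_type_def using rank s b' by blast
qed

text \<open>The scalar of the equivalence is a square, so a change of basis absorbs it and the form
  itself, not only a multiple of it, becomes the standard one.\<close>

lemma quad_type_basis:
  assumes "quad_has_type scale lam Q \<tau>" and rank: "quad_rank scale Q = 2 * s" and s: "s \<ge> 1"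
  obtains b where "is_basis scale b"
    "\<tau> = 1 \<and> (\<forall>v. Q v = hyperbolic_quad s (coords scale b v)) \<or>
     \<tau> = -1 \<and> (\<forall>v. Q v = elliptic_quad lam s (coords scale b v))"
proof -
  have sm: "2 * s \<le> dim_V" using rank quad_rank_le[of Q] by simp
  have "Q \<noteq> (\<lambda>_. 0)" using rank s quad_rank_0 by auto
  then obtain s' b where "quad_rank scale Q = 2*s'" and b: "is_basis scale b" and
    ty: "\<tau> = 1 \<and> quad_equivalent scale Q (\<lambda>v. hyperbolic_quad s' (coords scale b v)) \<or>
            \<tau> = -1 \<and> quad_equivalent scale Q (\<lambda>v. elliptic_quad lam s' (coords scale b v))"
    using assms(1) unfolding quad_has_type_def by blast
  then have s': "s' = s" using rank by simp
  have *: "\<exists>b'. is_basis scale b' \<and> (\<forall>v. Q v = g (coords scale b' v))"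
    if eqv: "quad_equivalent scale Q (\<lambda>v. g (coords scale b v))"
      and hom: "\<And>c x. g (\<lambda>i. c * x i) = c\<^sup>2 * g x"
      and cong: "\<And>x y. (\<And>i. i \<in> {1..2*s} \<Longrightarrow> x i = y i) \<Longrightarrow> g x = g y"
    for g :: "(nat \<Rightarrow> 'a) \<Rightarrow> 'a"
  proof -
    obtain a L where a: "a \<noteq> 0" and L: "L \<in> GL scale" and eq: "\<And>v. g (coords scale b v) = a * Q (L v)"
      using eqv unfolding quad_equivalent_def by blast
    obtain \<gamma> where \<gamma>: "\<gamma>\<^sup>2 = inverse a" using square_surj[OF even_card] by blast
    then have "\<gamma> \<noteq> 0" using a by auto
    obtain b' where b': "is_basis scale b'"
      "\<And>v i. i \<in> {1..dim_V} \<Longrightarrow> coords scale b' (L v) i = \<gamma> * coords scale b v i"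
      using transport_basis[OF b L \<open>\<gamma> \<noteq> 0\<close>] by blast
    have "Q w = g (coords scale b' w)" for w
    proof -
      obtain v where v: "L v = w" using GL_surj[OF L] by blast
      have "g (coords scale b' w) = g (\<lambda>i. \<gamma> * coords scale b v i)"
        by (rule cong) (use b'(2)[of _ v] v sm in auto)
      also have "\<dots> = Q w" unfolding hom eq \<gamma> v using a by simp
      finally show ?thesis ..
    qed
    then show ?thesis using b' by blast
  qed
  show thesis using ty unfolding s'
  proof (elim disjE conjE)
    assume "quad_equivalent scale Q (\<lambda>v. hyperbolic_quad s (coords scale b v))" "\<tau> = 1"
    then show thesis
      using *[of "hyperbolic_quad s"] hyperbolic_quad_scale hyperbolic_quad_cong that by metis
  next
    assume "quad_equivalent scale Q (\<lambda>v. elliptic_quad lam s (coords scale b v))" "\<tau> = -1"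
    then show thesis
      using *[of "elliptic_quad lam s"] elliptic_quad_scale elliptic_quad_cong[OF _ s] that by metis
  qed
qed

context
  fixes \<chi> :: "'a \<Rightarrow> complex"
  assumes \<chi>: "nontrivial_additive_character \<chi>"
begin

lemma sum_over_coords:
  assumes b: "is_basis scale b" and cong: "\<And>x y. (\<And>i. i \<in> {1..dim_V} \<Longrightarrow> x i = y i) \<Longrightarrow> g x = g y"
  shows "(\<Sum>v\<in>UNIV. \<chi> (g (coords scale b v))) = (\<Sum>x\<in>vecs {1..dim_V}. \<chi> (g x))"
  by (subst sum.reindex_bij_betw[OF lincomb_bij[OF b], symmetric])
    (intro sum.cong refl arg_cong[where f = \<chi>] cong, rule coords_lincomb[OF b])

lemma gauss_sum_form_of:
  assumes b: "is_basis scale b"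
  shows "gauss_sum \<chi> dim_V B d = (\<Sum>v\<in>UNIV. \<chi> (form_of b B d v))"
  unfolding form_of_def gauss_sum_def
  by (rule sum_over_coords[OF b, symmetric]) (rule matrix_quad_cong)

text \<open>As a sum over all vectors the Gauss sum does not depend on the basis, so it may be
  computed in a basis adapted to the type.\<close>

lemma gauss_sum_type:
  assumes b: "is_basis scale b" and ty: "quad_has_type scale lam (form_of b B d) \<tau>"
    and rank: "quad_rank scale (form_of b B d) = 2 * s" and s: "s \<ge> 1"
  shows "gauss_sum \<chi> dim_V B d * of_nat CARD('a) ^ s = of_int \<tau> * of_nat CARD('a) ^ dim_V"
proof -
  have sm: "2 * s \<le> dim_V" using rank quad_rank_le[of "form_of b B d"] by simp
  then have sub: "{1..2*s} \<subseteq> {1..dim_V}" by auto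
  obtain b' where b': "is_basis scale b'" and
    "\<tau> = 1 \<and> (\<forall>v. form_of b B d v = hyperbolic_quad s (coords scale b' v)) \<or>
     \<tau> = -1 \<and> (\<forall>v. form_of b B d v = elliptic_quad lam s (coords scale b' v))"
    using quad_type_basis[OF ty rank s] by blast
  then show ?thesis
  proof (elim disjE conjE)
    assume \<tau>: "\<tau> = 1" and "\<forall>v. form_of b B d v = hyperbolic_quad s (coords scale b' v)"
    then have "(\<Sum>v\<in>UNIV. \<chi> (form_of b B d v)) = (\<Sum>v\<in>UNIV. \<chi> (hyperbolic_quad s (coords scale b' v)))" by simp
    also have "\<dots> = (\<Sum>x\<in>vecs {1..dim_V}. \<chi> (hyperbolic_quad s x))"
      by (rule sum_over_coords[OF b'], rule hyperbolic_quad_cong) (use sub in blast)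
    finally show ?thesis unfolding gauss_sum_form_of[OF b] using hyperbolic_sum[OF even_card lam \<chi> _ sub] \<tau> by simp
  next
    assume \<tau>: "\<tau> = -1" and "\<forall>v. form_of b B d v = elliptic_quad lam s (coords scale b' v)"
    then have "(\<Sum>v\<in>UNIV. \<chi> (form_of b B d v)) = (\<Sum>v\<in>UNIV. \<chi> (elliptic_quad lam s (coords scale b' v)))" by simp
    also have "\<dots> = (\<Sum>x\<in>vecs {1..dim_V}. \<chi> (elliptic_quad lam s x))"
      by (rule sum_over_coords[OF b'], rule elliptic_quad_cong[OF _ s]) (use sub in blast)
    finally show ?thesis unfolding gauss_sum_form_of[OF b] using elliptic_sum[OF even_card lam \<chi> _ sub s] \<tau> by simp
  qed
qed

text \<open>Some type exists, and the two types have Gauss sums of opposite sign; so exactly one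
  holds and the Gauss sum decides which. This gives the indicator of a type in a shape that can be
  summed over diagonals.\<close>

lemma quad_type_iff_gauss_sum:
  assumes b: "is_basis scale b" and B: "B \<in> alternating_on {1..dim_V}"
    and rank: "quad_rank scale (form_of b B d) = 2 * s" and s: "s \<ge> 1" and \<tau>: "\<tau> \<in> {1, -1}"
  shows "(if quad_has_type scale lam (form_of b B d) \<tau> then 2 else 0) * of_nat CARD('a) ^ dim_V =
    of_nat CARD('a) ^ dim_V + of_int \<tau> * gauss_sum \<chi> dim_V B d * of_nat CARD('a) ^ s"
proof -
  let ?G = "gauss_sum \<chi> dim_V B d * of_nat CARD('a) ^ s"
  have q: "(of_nat CARD('a) :: complex) ^ dim_V \<noteq> 0" by simp
  note g = gauss_sum_type[OF b _ rank s]
  consider "quad_has_type scale lam (form_of b B d) 1" "?G = of_nat CARD('a) ^ dim_V" |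
    "quad_has_type scale lam (form_of b B d) (-1)" "?G = - (of_nat CARD('a) ^ dim_V)"
    using quad_type_exists[OF form_of_quadratic[OF b B] rank s] g[of 1] g[of "-1"] by auto
  then show ?thesis
  proof cases
    case 1
    have "\<not> quad_has_type scale lam (form_of b B d) (-1)" using g[of "-1"] 1(2) q by auto
    then show ?thesis using 1 \<tau> unfolding mult.assoc by auto
  next
    case 2
    have "\<not> quad_has_type scale lam (form_of b B d) 1" using g[of 1] 2(2) q by auto
    then show ?thesis using 2 \<tau> unfolding mult.assoc by auto
  qed
qed

end

end

end

section \<open>Normal forms of symmetric bilinear forms\<close>

text \<open>Coordinates are indexed from 1; the index \<open>t = 0\<close> means that there is no square term.\<close>

definition normal_sym :: "nat \<Rightarrow> nat \<Rightarrow> (nat \<Rightarrow> 'a::field) \<Rightarrow> (nat \<Rightarrow> 'a) \<Rightarrow> 'a" where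
  "normal_sym r t x y = plus_sym r x y + (if t = 0 then 0 else x t * y t)"

lemma plus_sym_scale: "plus_sym r (\<lambda>i. c * x i) (\<lambda>i. c * y i) = c\<^sup>2 * plus_sym r x y"
  by (simp add: plus_sym_def sum_distrib_left power2_eq_square distrib_left mult_ac)

lemma normal_sym_scale: "normal_sym r t (\<lambda>i. c * x i) (\<lambda>i. c * y i) = c\<^sup>2 * normal_sym r t x y"
  by (simp add: normal_sym_def plus_sym_scale distrib_left) (simp add: power2_eq_square mult_ac)

lemma normal_sym_cong:
  assumes "\<And>i. i \<in> {1..2*r} \<union> {t} - {0} \<Longrightarrow> x i = x' i" "\<And>i. i \<in> {1..2*r} \<union> {t} - {0} \<Longrightarrow> y i = y' i"
  shows "normal_sym r t x y = normal_sym r t x' y'"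
proof -
  have "x (2*k - 1) = x' (2*k - 1) \<and> x (2*k) = x' (2*k) \<and> y (2*k - 1) = y' (2*k - 1) \<and> y (2*k) = y' (2*k)"
    if "k \<in> {1..r}" for k
    using that by (intro conjI assms) auto
  then have "plus_sym r x y = plus_sym r x' y'"
    unfolding plus_sym_def by (intro sum.cong refl) (simp del: One_nat_def)
  then show ?thesis using assms by (simp add: normal_sym_def)
qed

lemma minus_sym_normal:
  assumes "s \<ge> 1"
  shows "minus_sym s x y = normal_sym s (2*s) x y"
proof -
  obtain s' where "s = Suc s'" using assms by (cases s) auto
  then show ?thesis by (simp add: minus_sym_def normal_sym_def plus_sym_def add.assoc)
qed

context finite_form_space
begin

lemma sym_rank_le: "sym_rank scale S \<le> dim_V"
  by (simp add: sym_rank_def)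

lemma sym_rank_0: "sym_rank scale (\<lambda>_ _. 0) = 0"
  by (simp add: sym_rank_def vdim_def)

text \<open>The relevant values of \<open>t\<close> are 0 for type 1, \<open>2 * r\<close> for type
  -1 and \<open>2 * r + 1\<close> for odd rank.\<close>

definition has_normal_form :: "('v \<Rightarrow> 'v \<Rightarrow> 'a) \<Rightarrow> nat \<Rightarrow> nat \<Rightarrow> bool" where
  "has_normal_form S r t \<longleftrightarrow> (\<exists>b. is_basis scale b \<and>
     (\<forall>v w. S v w = normal_sym r t (coords scale b v) (coords scale b w)))"

text \<open>A functional f is sent to the combination of the vectors \<open>u j\<close> with
  coefficients \<open>f (w j)\<close>; here this is applied to the coordinate functionals of
  \<open>b\<close>. A relation between the images would be a combination of these functionals that
  vanishes on the basis \<open>w\<close>, hence is zero.\<close>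

lemma lincomb_hat_basis:
  assumes u: "is_basis scale u" and w: "is_basis scale w" and b: "is_basis scale b"
  shows "is_basis scale (\<lambda>i. lincomb dim_V u (\<lambda>j. coords scale b (w j) i))"
proof (rule is_basisI)
  fix c assume c: "lincomb dim_V (\<lambda>i. lincomb dim_V u (\<lambda>j. coords scale b (w j) i)) c = 0"
  have lc: "lincomb n (\<lambda>i. lincomb dim_V u (\<lambda>j. coords scale b (w j) i)) c =
    lincomb dim_V u (\<lambda>j. \<Sum>i=1..n. c i * coords scale b (w j) i)" for n
  proof (induction n)
    case (Suc n)
    then show ?case by (simp add: lincomb_add lincomb_scale) (simp add: lincomb_def)
  qed (simp add: lincomb_def)
  have "lincomb dim_V u (\<lambda>j. \<Sum>i=1..dim_V. c i * coords scale b (w j) i) = lincomb dim_V u (\<lambda>_. 0)"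
    using c unfolding lc by (simp add: lincomb_def)
  then have wz: "(\<Sum>i=1..dim_V. c i * coords scale b (w j) i) = 0" if "j \<in> {1..dim_V}" for j
    using that by (simp only: lincomb_eq_iff[OF u])
  have coords_lc: "coords scale b (lincomb n w d) i = (\<Sum>j=1..n. d j * coords scale b (w j) i)"
    for n d i
  proof (induction n)
    case 0
    have "coords scale b (scale 0 0) i = 0" by (simp only: coords_scale[OF b] mult_zero_left)
    then show ?case by (simp add: lincomb_def)
  next
    case (Suc n)
    have "lincomb (Suc n) w d = lincomb n w d + scale (d (Suc n)) (w (Suc n))" by (simp add: lincomb_def)
    then show ?case using Suc by (simp add: coords_add[OF b] coords_scale[OF b])
  qed
  show "\<forall>k\<in>{1..dim_V}. c k = 0"
  proof
    fix k assume k: "k \<in> {1..dim_V}"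
    let ?d = "coords scale w (b k)"
    have "c k = (\<Sum>i=1..dim_V. c i * (if i = k then 1 else 0))" using k by (simp add: sum_mult_delta)
    also have "\<dots> = (\<Sum>i=1..dim_V. c i * coords scale b (b k) i)"
      by (intro sum.cong refl) (simp add: coords_basis[OF b k])
    also have "\<dots> = (\<Sum>i=1..dim_V. c i * coords scale b (lincomb dim_V w ?d) i)"
      by (simp add: lincomb_coords[OF w])
    also have "\<dots> = (\<Sum>i=1..dim_V. \<Sum>j=1..dim_V. ?d j * (c i * coords scale b (w j) i))"
      unfolding coords_lc by (simp add: sum_distrib_left mult_ac)
    also have "\<dots> = (\<Sum>j=1..dim_V. \<Sum>i=1..dim_V. ?d j * (c i * coords scale b (w j) i))"
      by (rule sum.swap)
    also have "\<dots> = (\<Sum>j=1..dim_V. ?d j * (\<Sum>i=1..dim_V. c i * coords scale b (w j) i))"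
      by (simp only: sum_distrib_left)
    also have "\<dots> = 0" using wz by (intro sum.neutral) auto
    finally show "c k = 0" .
  qed
qed

text \<open>The upper triangular matrix built from the values and polar products of \<open>Q\<close>
  on \<open>u\<close> shows that the choice in \<open>coefficient_matrix\<close> succeeds.\<close>

lemma coefficient_matrix_spec:
  assumes Q: "Q \<in> quadratic_forms scale"
  shows "Q (lincomb dim_V u x) = (\<Sum>i=1..dim_V. \<Sum>j=1..dim_V. coefficient_matrix scale u Q i j * x i * x j)"
proof -
  define A where "A i j = (if i < j then polar Q (u i) (u j) else if i = j then Q (u i) else 0)" for i j
  have split: "(\<Sum>i=1..m. A i j * x i * x j) = (\<Sum>i=1..<j. polar Q (u i) (u j) * x i * x j) + Q (u j) * (x j)\<^sup>2"
    if j: "j \<in> {1..m}" for j x m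
  proof -
    have "{1..m} = insert j ({1..<j} \<union> {j<..m})" using j by auto
    then have "(\<Sum>i=1..m. A i j * x i * x j) = A j j * x j * x j + (\<Sum>i\<in>{1..<j} \<union> {j<..m}. A i j * x i * x j)"
      by simp
    also have "(\<Sum>i\<in>{1..<j} \<union> {j<..m}. A i j * x i * x j) = (\<Sum>i=1..<j. A i j * x i * x j)"
      by (intro sum.mono_neutral_right) (auto simp: A_def)
    also have "\<dots> = (\<Sum>i=1..<j. polar Q (u i) (u j) * x i * x j)"
      by (intro sum.cong) (auto simp: A_def)
    finally show ?thesis by (simp add: A_def power2_eq_square mult_ac)
  qed
  have "Q (lincomb dim_V u x) = (\<Sum>i=1..dim_V. \<Sum>j=1..dim_V. A i j * x i * x j)" for x
  proof -
    have "(\<Sum>i=1..dim_V. \<Sum>j=1..dim_V. A i j * x i * x j) = (\<Sum>j=1..dim_V. \<Sum>i=1..dim_V. A i j * x i * x j)"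
      by (rule sum.swap)
    also have "\<dots> = (\<Sum>j=1..dim_V. (\<Sum>i=1..<j. polar Q (u i) (u j) * x i * x j) + Q (u j) * (x j)\<^sup>2)"
      by (intro sum.cong refl split)
    also have "\<dots> = Q (lincomb dim_V u x)"
      unfolding quad_lincomb[OF Q] matrix_quad_def cross_terms_def by (simp add: sum.distrib)
    finally show ?thesis ..
  qed
  then have "\<exists>A. \<forall>x. Q (\<Sum>i=1..dim_V. scale (x i) (u i)) = (\<Sum>i=1..dim_V. \<Sum>j=1..dim_V. A i j * x i * x j)"
    unfolding lincomb_def by blast
  from someI_ex[OF this] show ?thesis unfolding coefficient_matrix_def lincomb_def by blast
qed

lemma polar_coefficient_matrix:
  assumes Q: "Q \<in> quadratic_forms scale"
  shows "polar Q (lincomb dim_V u x) (lincomb dim_V u y) =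
    (\<Sum>i=1..dim_V. \<Sum>j=1..dim_V. coefficient_matrix scale u Q i j * (x j * y i + y j * x i))"
  unfolding polar_def lincomb_add[symmetric] coefficient_matrix_spec[OF Q]
  by (simp add: sum_subtractf[symmetric] algebra_simps)

text \<open>The trace pairs a quadratic form with a symmetric tensor. Under the transport of
  functionals by \<open>w\<close> and \<open>u\<close>, a symmetrized product of two functionals is
  paired to the polar product of their vectors, and the square of a functional to the value of
  \<open>Q\<close> at its vector.\<close>

lemma pairing_normal_form:
  assumes S: "has_normal_form S r t" and u: "is_basis scale u" and w: "is_basis scale w"
  shows "\<exists>v. is_basis scale v \<and> (\<forall>\<chi>. \<forall>Q\<in>quadratic_forms scale. pairing scale \<chi> u w Q S =
      \<chi> ((\<Sum>k=1..r. polar Q (v (2*k - 1)) (v (2*k))) + (if t = 0 then 0 else Q (v t))))"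
proof -
  obtain b where b: "is_basis scale b" and Sb: "\<And>v w. S v w = normal_sym r t (coords scale b v) (coords scale b w)"
    using S unfolding has_normal_form_def by blast
  define f where "f i j = coords scale b (w j) i" for i j
  define v where "v i = lincomb dim_V u (f i)" for i
  have "is_basis scale v" unfolding v_def f_def by (rule lincomb_hat_basis[OF u w b])
  moreover have "pairing scale \<chi> u w Q S =
      \<chi> ((\<Sum>k=1..r. polar Q (v (2*k - 1)) (v (2*k))) + (if t = 0 then 0 else Q (v t)))"
    if Q: "Q \<in> quadratic_forms scale" for \<chi> Q
  proof -
    let ?A = "coefficient_matrix scale u Q"
    have "(\<Sum>i=1..dim_V. \<Sum>j=1..dim_V. ?A i j * S (w j) (w i)) =
      (\<Sum>i=1..dim_V. \<Sum>j=1..dim_V. (\<Sum>k=1..r. ?A i j * (f (2*k - 1) j * f (2*k) i + f (2*k) j * f (2*k - 1) i)) +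
         (if t = 0 then 0 else ?A i j * f t i * f t j))"
      unfolding Sb normal_sym_def plus_sym_def f_def[symmetric] distrib_left sum_distrib_left
      by (intro sum.cong refl arg_cong2[where f = "(+)"]) auto
    also have "\<dots> = (\<Sum>i=1..dim_V. \<Sum>j=1..dim_V. \<Sum>k=1..r. ?A i j * (f (2*k - 1) j * f (2*k) i + f (2*k) j * f (2*k - 1) i)) +
       (if t = 0 then 0 else Q (v t))"
      unfolding sum.distrib by (simp add: v_def coefficient_matrix_spec[OF Q])
    also have "(\<Sum>i=1..dim_V. \<Sum>j=1..dim_V. \<Sum>k=1..r. ?A i j * (f (2*k - 1) j * f (2*k) i + f (2*k) j * f (2*k - 1) i)) =
      (\<Sum>k=1..r. \<Sum>i=1..dim_V. \<Sum>j=1..dim_V. ?A i j * (f (2*k - 1) j * f (2*k) i + f (2*k) j * f (2*k - 1) i))"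
      by (subst sum.swap[of _ _ "{1..dim_V}"], subst sum.swap[of _ "{1..r}"]) (intro sum.cong refl sum.swap)
    also have "\<dots> = (\<Sum>k=1..r. polar Q (v (2*k - 1)) (v (2*k)))"
      unfolding v_def polar_coefficient_matrix[OF Q] ..
    finally show ?thesis unfolding pairing_def by simp
  qed
  ultimately show ?thesis by blast
qed

end

section \<open>Normal forms from the type and from odd rank\<close>

context even_form_space
begin

lemma sym_type_normal_form:
  assumes ty: "sym_has_type scale S \<tau>" and rank: "sym_rank scale S = 2 * s"
  shows "\<tau> = 1 \<and> has_normal_form S s 0 \<or> \<tau> = -1 \<and> s \<ge> 1 \<and> has_normal_form S s (2*s)"
proof (cases "S = (\<lambda>_ _. 0)")
  case True
  then have "s = 0" using rank sym_rank_0 by simp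
  then have "\<tau> = 1" using ty rank unfolding sym_has_type_def by auto
  moreover obtain b where "is_basis scale b" by (rule obtain_basis)
  ultimately show ?thesis using True \<open>s = 0\<close>
    unfolding has_normal_form_def by (auto simp: normal_sym_def plus_sym_def)
next
  case False
  then obtain s' b where "s' \<ge> 1" "sym_rank scale S = 2*s'" and b: "is_basis scale b" and
    ty': "\<tau> = 1 \<and> sym_equivalent scale S (\<lambda>v v'. plus_sym s' (coords scale b v) (coords scale b v')) \<or>
            \<tau> = -1 \<and> sym_equivalent scale S (\<lambda>v v'. minus_sym s' (coords scale b v) (coords scale b v'))"
    using ty unfolding sym_has_type_def by blast
  then have s: "s' = s" "s \<ge> 1" using rank by auto
  have sm: "2 * s \<le> dim_V" using rank sym_rank_le[of S] by simp
  have *: "has_normal_form S s t"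
    if eqv: "sym_equivalent scale S (\<lambda>v v'. normal_sym s t (coords scale b v) (coords scale b v'))" and t: "t \<le> 2*s"
    for t
  proof -
    obtain a L where a: "a \<noteq> 0" and L: "L \<in> GL scale"
      and eq: "\<And>v w. normal_sym s t (coords scale b v) (coords scale b w) = a * S (L v) (L w)"
      using eqv unfolding sym_equivalent_def by blast
    obtain \<gamma> where \<gamma>: "\<gamma>\<^sup>2 = inverse a" using square_surj[OF even_card] by blast
    then have "\<gamma> \<noteq> 0" using a by auto
    obtain b' where b': "is_basis scale b'"
      "\<And>v i. i \<in> {1..dim_V} \<Longrightarrow> coords scale b' (L v) i = \<gamma> * coords scale b v i"
      using transport_basis[OF b L \<open>\<gamma> \<noteq> 0\<close>] by blast
    have "S x y = normal_sym s t (coords scale b' x) (coords scale b' y)" for x y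
    proof -
      obtain v w where v: "L v = x" "L w = y" using GL_surj[OF L] by meson
      have "normal_sym s t (coords scale b' x) (coords scale b' y) =
          normal_sym s t (\<lambda>i. \<gamma> * coords scale b v i) (\<lambda>i. \<gamma> * coords scale b w i)"
        by (rule normal_sym_cong; use b'(2)[of _ v] b'(2)[of _ w] v sm t in auto)
      also have "\<dots> = S x y" unfolding normal_sym_scale eq \<gamma> v using a by simp
      finally show ?thesis ..
    qed
    then show ?thesis using b' unfolding has_normal_form_def by blast
  qed
  from ty' show ?thesis
  proof (elim disjE conjE)
    assume "\<tau> = 1" "sym_equivalent scale S (\<lambda>v v'. plus_sym s' (coords scale b v) (coords scale b v'))"
    then show ?thesis using *[of 0] s by (simp add: normal_sym_def)
  next
    assume "\<tau> = -1" "sym_equivalent scale S (\<lambda>v v'. minus_sym s' (coords scale b v) (coords scale b v'))"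
    then show ?thesis using *[of "2*s"] s by (simp add: minus_sym_normal)
  qed
qed

text \<open>
  The diagonal of \<open>S\<close> is the square of a linear functional \<open>g\<close>, and \<open>S - g \<otimes> g\<close> is alternating.
  Its radical is strictly larger than that of \<open>S\<close> exactly if the rank of \<open>S\<close> is odd.
\<close>

lemma sym_odd_normal_form:
  assumes S: "S \<in> symmetric_bilinear_forms scale" and rank: "sym_rank scale S = 2 * s + 1"
  shows "has_normal_form S s (2*s + 1)"
proof -
  \<comment> \<open>\<open>S (v + w) (v + w)\<close> has no cross term in characteristic 2 and
    square roots are unique and additive there, so \<open>g\<close> is linear.\<close>
  define g where "g v = (SOME y. y\<^sup>2 = S v v)" for v
  have g2: "(g v)\<^sup>2 = S v v" for v
    unfolding g_def using square_surj[OF even_card, of "S v v"] by (rule someI_ex)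
  note sadd = form_add_left[OF S] form_add_right[OF S] form_scale_left[OF S] form_scale_right[OF S]
  have g_add: "g (v + w) = g v + g w" for v w
  proof -
    have "(g (v + w))\<^sup>2 = S v v + S w w + (S v w + S v w)"
      unfolding g2 sadd using form_sym[OF S, of w v] by (simp add: add_ac)
    then have "(g (v + w))\<^sup>2 = (g v + g w)\<^sup>2"
      by (simp add: add_self square_add[OF even_card] g2)
    then show ?thesis by (simp only: square_eq_iff[OF even_card])
  qed
  have g_scale: "g (scale c v) = c * g v" for c v
  proof -
    have "(g (scale c v))\<^sup>2 = (c * g v)\<^sup>2"
      unfolding g2 sadd power_mult_distrib by (simp add: power2_eq_square)
    then show ?thesis by (simp only: square_eq_iff[OF even_card])
  qed
  have g0: "g 0 = 0" using g_scale[of 0 0] by simp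
  have g_diff: "g (v - w) = g v - g w" for v w using g_add[of "v - w" w] by (simp add: algebra_simps)
  have g_lincomb: "g (lincomb n x c) = (\<Sum>i=1..n. c i * g (x i))" for n x c
    by (induction n) (simp_all add: lincomb_def g0 g_add g_scale)
  define A where "A v w = S v w + g v * g w" for v w
  have A: "A \<in> symmetric_bilinear_forms scale"
    by (rule symmetric_bilinearI)
      (simp_all add: A_def sadd g_add g_scale algebra_simps form_sym[OF S])
  have A_self: "A v v = 0" for v using add_self[of "S v v"] by (simp add: A_def g2 flip: power2_eq_square)
  have SA: "S v w = A v w + g v * g w" for v w by (simp add: A_def add.assoc add_self)
  note aadd = form_add_left[OF A] form_add_right[OF A] form_scale_left[OF A] form_scale_right[OF A]
  have radS: "(\<forall>w. S v w = 0) \<longleftrightarrow> (\<forall>w. A v w = 0) \<and> g v = 0" for v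
    using g2[of v] SA by (metis add.right_neutral mult_zero_left zero_eq_power2)
  obtain r x where x: "hyperbolic_family A r x"
    and pr: "\<And>v w. A (v - lincomb (2*r) x (\<lambda>i. A v (x (partner i)))) w = 0"
    using maximal_hyperbolic_family[OF A A_self] by blast
  have ind0: "\<forall>i\<in>{1..2*r}. c i = 0" if "\<And>j. j \<in> {1..2*r} \<Longrightarrow> A (lincomb (2*r) x c) (x j) = 0" for c
  proof
    fix i assume i: "i \<in> {1..2*r}"
    have "c (partner (partner i)) = 0"
      using hyperbolic_family_coeff[OF A x partner_in[OF i], of c] that[OF partner_in[OF i]] by simp
    then show "c i = 0" using i by (simp add: partner_partner)
  qed
  \<comment> \<open>Otherwise \<open>g\<close> vanishes on the radical of \<open>A\<close>, the two
    radicals agree, and \<open>S\<close> would have the even rank \<open>2 * r\<close>.\<close>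
  have "\<exists>z. (\<forall>w. A z w = 0) \<and> g z \<noteq> 0"
  proof (rule ccontr)
    assume "\<not> ?thesis"
    then have rad: "{v. \<forall>w. S v w = 0} = {v. \<forall>w. A v w = 0}" using radS by blast
    obtain b where "card {v. \<forall>w. A v w = 0} * CARD('a) ^ (2 * r) = CARD('a) ^ dim_V"
      by (rule basis_extending[OF subspace_radical[OF A], of "2*r" x]) (use ind0 pr in blast)+
    then have "sym_rank scale S = 2 * r" unfolding sym_rank_iff[OF S] rad .
    then show False using rank by presburger
  qed
  then obtain z0 where z0: "\<And>w. A z0 w = 0" "g z0 \<noteq> 0" by blast
  define z where "z = scale (inverse (g z0)) z0"
  have z: "A z w = 0" "A w z = 0" "g z = 1" for w
    using z0 form_sym[OF A, of w] by (auto simp: z_def aadd g_scale)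
  let ?n = "2*r + 1"
  \<comment> \<open>Subtracting multiples of \<open>z\<close> makes \<open>g\<close> vanish on the
    hyperbolic family; as \<open>z\<close> lies in the radical of \<open>A\<close>, the products
    under \<open>A\<close> do not change.\<close>
  define x' where "x' i = (if i = ?n then z else x i - scale (g (x i)) z)" for i
  have x'_low: "x' i = x i - scale (g (x i)) z" if "i \<in> {1..2*r}" for i using that by (simp add: x'_def)
  have lc': "lincomb ?n x' c = lincomb (2*r) x c + scale (c ?n - g (lincomb (2*r) x c)) z" for c
  proof -
    have "lincomb (2*r) x' c = lincomb (2*r) (\<lambda>i. x i - scale (g (x i)) z) c"
      by (rule lincomb_cong) (simp_all add: x'_low)
    also have "\<dots> = lincomb (2*r) x c - scale (\<Sum>i=1..2*r. c i * g (x i)) z"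
      by (simp add: lincomb_def scale_right_diff_distrib sum_subtractf scale_sum_left)
    finally have "lincomb (2*r) x' c = lincomb (2*r) x c - scale (g (lincomb (2*r) x c)) z"
      by (simp only: g_lincomb)
    moreover have "lincomb ?n x' c = lincomb (2*r) x' c + scale (c ?n) z"
      by (simp add: lincomb_def x'_def)
    ultimately show ?thesis by (simp add: scale_left_diff_distrib)
  qed
  obtain b where b: "is_basis scale b" "\<And>i. i \<in> {1..?n} \<Longrightarrow> b i = x' i"
    "\<And>i. i \<in> {?n+1..dim_V} \<Longrightarrow> b i \<in> {v. \<forall>w. S v w = 0}" "?n \<le> dim_V"
    "card {v. \<forall>w. S v w = 0} * CARD('a) ^ ?n = CARD('a) ^ dim_V"
  proof (rule basis_extending[OF subspace_radical[OF S], of ?n x'])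
    fix c assume "lincomb ?n x' c \<in> {v. \<forall>w. S v w = 0}"
    then have c: "\<And>w. A (lincomb ?n x' c) w = 0" "g (lincomb ?n x' c) = 0" using radS by blast+
    have "A (lincomb (2*r) x c) (x j) = 0" for j using c(1)[of "x j"] unfolding lc' by (simp add: aadd z)
    then have c0: "\<forall>i\<in>{1..2*r}. c i = 0" by (rule ind0)
    have "c ?n = 0" using c(2) unfolding lc' by (simp add: g_add g_scale z g_diff)
    then show "\<forall>i\<in>{1..?n}. c i = 0" using c0 by (auto simp: le_Suc_eq)
  next
    fix v
    let ?f = "\<lambda>i. A v (x (partner i))"
    let ?c = "?f(?n := g v)"
    have "lincomb (2*r) x ?c = lincomb (2*r) x ?f" by (rule lincomb_cong) auto
    then have eq: "v - lincomb ?n x' ?c = (v - lincomb (2*r) x ?f) + scale (g (lincomb (2*r) x ?f) - g v) z"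
      unfolding lc' by (simp add: scale_left_diff_distrib)
    have "(\<forall>w. A (v - lincomb ?n x' ?c) w = 0) \<and> g (v - lincomb ?n x' ?c) = 0"
      unfolding eq by (simp add: aadd g_add g_diff g_scale pr z)
    then have "v - lincomb ?n x' ?c \<in> {v. \<forall>w. S v w = 0}" unfolding mem_Collect_eq radS .
    then show "\<exists>c. v - lincomb ?n x' c \<in> {v. \<forall>w. S v w = 0}" by blast
  qed blast+
  have "sym_rank scale S = ?n" unfolding sym_rank_iff[OF S] by (rule b(5))
  then have rs: "r = s" using rank by simp
  have Sb: "S (b i) (b j) = (if i \<in> {1..2*r} \<and> j = partner i \<or> i = ?n \<and> j = ?n then 1 else 0)"
    if ij: "i \<in> {1..dim_V}" "j \<in> {1..dim_V}" for i j
  proof -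
    have gb: "g (b i) = (if i = ?n then 1 else 0)" if "i \<in> {1..dim_V}" for i
    proof -
      consider "i \<in> {1..2*r}" | "i = ?n" | "i \<in> {?n+1..dim_V}" using \<open>i \<in> {1..dim_V}\<close> by fastforce
      then show ?thesis
      proof cases
        case 1
        then show ?thesis using b(2)[of i] by (simp add: x'_low g_diff g_scale z)
      next
        case 2
        then show ?thesis using b(2)[of i] by (simp add: x'_def z)
      next
        case 3
        then show ?thesis using b(3)[of i] radS by auto
      qed
    qed
    have Ab: "A (b i) (b j) = (if i \<in> {1..2*r} \<and> j = partner i then 1 else 0)"
    proof -
      have rad: "\<forall>w. A (b k) w = 0" if "k \<in> {?n..dim_V}" for k
        using b(3)[of k] radS b(2)[of k] z that by (cases "k = ?n") (auto simp: x'_def)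
      have xx: "A (x' k) (x' l) = A (x k) (x l)" if "k \<in> {1..2*r}" "l \<in> {1..2*r}" for k l
        using that unfolding x'_low[OF that(1)] x'_low[OF that(2)]
        by (simp add: diff_conv_add_uminus[of _ "scale _ z"] aadd z flip: scale_minus_left)
      consider "i \<in> {1..2*r}" "j \<in> {1..2*r}" | "i \<in> {?n..dim_V}" | "i \<in> {1..2*r}" "j \<in> {?n..dim_V}"
        using ij by fastforce
      then show ?thesis
      proof cases
        case 1
        then show ?thesis using xx x b(2) by (simp add: hyperbolic_family_def)
      next
        case 2
        then show ?thesis using rad[of i] by auto
      next
        case 3
        then have "j \<noteq> partner i" using partner_in[OF 3(1)] by auto
        then show ?thesis using rad[of j] 3 form_sym[OF A, of "b i" "b j"] by simp
      qed
    qed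
    show ?thesis unfolding SA Ab using gb ij by auto
  qed
  have "S v w = normal_sym s (2*s + 1) (coords scale b v) (coords scale b w)" for v w
  proof -
    let ?v = "coords scale b v" and ?w = "coords scale b w"
    have "S v w = S (lincomb dim_V b ?v) (lincomb dim_V b ?w)" by (simp add: lincomb_coords[OF b(1)])
    also have "\<dots> = (\<Sum>i=1..dim_V. \<Sum>j=1..dim_V. ?v i * (?w j * S (b i) (b j)))"
      unfolding form_lincomb_left[OF S] unfolding form_lincomb_right[OF S] sum_distrib_left ..
    also have "\<dots> = (\<Sum>i=1..dim_V. (if i \<in> {1..2*r} then ?v i * ?w (partner i) else 0) + (if i = ?n then ?v i * ?w i else 0))"
    proof (intro sum.cong refl)
      fix i assume i: "i \<in> {1..dim_V}"
      \<comment> \<open>In row \<open>i\<close> of the Gram matrix only the entry at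
        \<open>k\<close> can be nonzero.\<close>
      define k where "k = (if i \<in> {1..2*r} then partner i else i)"
      have k: "k \<in> {1..dim_V}" using i b(4) partner_in[of i r] by (auto simp: k_def)
      have "(\<Sum>j=1..dim_V. ?v i * (?w j * S (b i) (b j))) =
        (\<Sum>j=1..dim_V. (if i \<in> {1..?n} then ?v i * ?w j else 0) * (if j = k then 1 else 0))"
        using i by (intro sum.cong refl) (auto simp: Sb k_def)
      also have "\<dots> = (if i \<in> {1..?n} then ?v i * ?w k else 0)"
        using k by (simp only: sum_mult_delta finite_atLeastAtMost)
      also have "\<dots> = (if i \<in> {1..2*r} then ?v i * ?w (partner i) else 0) + (if i = ?n then ?v i * ?w i else 0)"
        using i by (auto simp: k_def)
      finally show "(\<Sum>j=1..dim_V. ?v i * (?w j * S (b i) (b j))) =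
        (if i \<in> {1..2*r} then ?v i * ?w (partner i) else 0) + (if i = ?n then ?v i * ?w i else 0)" .
    qed
    also have "\<dots> = (\<Sum>i=1..2*r. ?v i * ?w (partner i)) + ?v ?n * ?w ?n"
    proof -
      have "(\<Sum>i=1..dim_V. if i \<in> {1..2*r} then ?v i * ?w (partner i) else 0) = (\<Sum>i=1..2*r. ?v i * ?w (partner i))"
        using b(4) by (intro sum.mono_neutral_cong_right) auto
      moreover have "(\<Sum>i=1..dim_V. if i = ?n then ?v i * ?w i else 0) = ?v ?n * ?w ?n"
        using b(4) by simp
      ultimately show ?thesis by (simp only: sum.distrib)
    qed
    also have "\<dots> = normal_sym s (2*s + 1) ?v ?w"
      unfolding sum_partner[of "\<lambda>i j. ?v i * ?w j"] normal_sym_def plus_sym_def rs by simp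
    finally show ?thesis .
  qed
  then show ?thesis using b(1) unfolding has_normal_form_def by blast
qed

end

section \<open>The P-numbers\<close>

text \<open>Membership in the radical says that column \<open>t\<close> vanishes, and skew-symmetry
  turns the column into the row.\<close>

lemma unit_vec_in_radical_iff:
  fixes B :: "nat \<Rightarrow> nat \<Rightarrow> 'a::{finite, field}"
  assumes "finite I" "t \<in> I" "B \<in> alternating_on I"
  shows "(\<lambda>i. if i = t then 1 else 0) \<in> matrix_radical I B \<longleftrightarrow> B t = (\<lambda>_. 0)"
proof -
  have "(\<Sum>j\<in>I. B i j * (if j = t then 1 else 0)) = B i t" for i
    using assms by (simp add: sum_mult_delta)
  then have "(\<lambda>i. if i = t then 1 else 0) \<in> matrix_radical I B \<longleftrightarrow> (\<forall>i. B i t = 0)"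
    using assms(2) by (simp add: matrix_radical_def vecs_def)
  also have "\<dots> \<longleftrightarrow> (\<forall>i. B t i = 0)"
    using alternating_on_swap[OF assms(3), of _ t] by (metis minus_zero neg_equal_0_iff_equal)
  finally show ?thesis by (simp add: fun_eq_iff)
qed

lemma powi_nat:
  assumes "s \<ge> 0"
  shows "x powi s = x ^ nat s" "x powi (2*s) = x ^ (2 * nat s)"
  using assms by (simp_all add: power_int_def nat_mult_distrib)

locale character_form_space = even_form_space +
  fixes lam :: 'a and \<chi> :: "'a \<Rightarrow> complex" and u w :: "nat \<Rightarrow> 'b"
  assumes lam: "absolute_trace lam = 1"
    and \<chi>: "nontrivial_additive_character \<chi>"
    and u: "is_basis scale u" and w: "is_basis scale w"
begin

abbreviation P where "P \<equiv> P_number scale lam \<chi> u w"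

text \<open>\<open>THE\<close> is determined once all members of a nonempty class give the same sum;
  evaluating the sum at each \<open>S\<close> therefore also proves independence of the
  choice.\<close>

lemma P_numberI:
  assumes "sym_class scale k \<noteq> {}"
    and "\<And>S. S \<in> sym_class scale k \<Longrightarrow> (\<Sum>Q\<in>quad_class scale lam i. pairing scale \<chi> u w Q S) = z"
  shows "P i k = z"
  unfolding P_number_def by (rule the_equality) (use assms in auto)

lemma twice_P_numberI:
  assumes "sym_class scale k \<noteq> {}"
    and "\<And>S. S \<in> sym_class scale k \<Longrightarrow> 2 * (\<Sum>Q\<in>quad_class scale lam i. pairing scale \<chi> u w Q S) = z"
  shows "2 * P i k = z"
proof -
  have "P i k = z / 2"
  proof (rule P_numberI[OF assms(1)])
    fix S assume "S \<in> sym_class scale k"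
    from assms(2)[OF this, symmetric]
    show "(\<Sum>Q\<in>quad_class scale lam i. pairing scale \<chi> u w Q S) = z / 2" by simp
  qed
  then show ?thesis by (simp add: mult.commute)
qed

text \<open>The vector z in coordinates of the adapted basis; \<open>t = 0\<close> encodes z = 0, as
  in \<open>normal_sym\<close>.\<close>

definition index_vec :: "nat \<Rightarrow> nat \<Rightarrow> 'a" where
  "index_vec t = (\<lambda>i. if t \<noteq> 0 \<and> i = t then 1 else 0)"

definition pair_sum :: "nat \<Rightarrow> (nat \<Rightarrow> nat \<Rightarrow> 'a) \<Rightarrow> 'a" where
  "pair_sum r B = (\<Sum>k=1..r. B (2*k - 1) (2*k))"

text \<open>The part of the character sum that sees only matrices with z in the radical, that is,
  alternating forms on the quotient by z.\<close>

definition radical_sum :: "nat \<Rightarrow> nat \<Rightarrow> nat \<Rightarrow> complex" where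
  "radical_sum s r t = (\<Sum>B\<in>{B \<in> alternating_of_rank {1..dim_V} (2*s). index_vec t \<in> matrix_radical {1..dim_V} B}.
     \<chi> (pair_sum r B))"

lemma sum_pair_sum:
  assumes "2 * r \<le> dim_V"
  shows "(\<Sum>B\<in>alternating_of_rank {1..dim_V} (2*s). \<chi> (pair_sum r B)) =
    complex_of_real (F_number CARD('a) (int dim_V) (int s) (int r))"
  using alternating_character_sum[OF \<chi>, of "{1..dim_V}" r s] assms by (simp add: pair_sum_def)

lemma radical_sum_0:
  assumes "2 * r \<le> dim_V"
  shows "radical_sum s r 0 = complex_of_real (F_number CARD('a) (int dim_V) (int s) (int r))"
proof -
  have "index_vec 0 \<in> matrix_radical {1..dim_V} B" for B by (simp add: index_vec_def matrix_radical_def)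
  then show ?thesis unfolding radical_sum_def using sum_pair_sum[OF assms] by simp
qed

lemma radical_sum_eq:
  assumes "t \<in> {1..dim_V}"
  shows "radical_sum s r t = (\<Sum>B\<in>alternating_of_rank ({1..dim_V} - {t}) (2*s). \<chi> (pair_sum r B))"
proof -
  have t: "index_vec t = (\<lambda>i. if i = t then 1 else 0)" using assms by (simp add: index_vec_def)
  have "{B \<in> alternating_of_rank {1..dim_V} (2*s). index_vec t \<in> matrix_radical {1..dim_V} B} =
    {B \<in> alternating_of_rank {1..dim_V} (2*s). B t = (\<lambda>_. 0)}"
    using unit_vec_in_radical_iff[OF _ assms] alternating_of_rankD unfolding t by blast
  then show ?thesis unfolding radical_sum_def alternating_zero_row[OF finite_atLeastAtMost assms] by simp
qed

text \<open>The deleted index lies outside all pairs, so only the dimension drops.\<close>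

lemma radical_sum_odd:
  assumes "2 * r + 1 \<le> dim_V"
  shows "radical_sum s r (2*r + 1) = complex_of_real (F_number CARD('a) (int dim_V - 1) (int s) (int r))"
proof -
  have t: "2*r + 1 \<in> {1..dim_V}" "{1..2*r} \<subseteq> {1..dim_V} - {2*r + 1}" using assms by auto
  have "card ({1..dim_V} - {2*r + 1}) = dim_V - 1" using t by simp
  moreover have "int (dim_V - 1) = int dim_V - 1" using assms by simp
  ultimately show ?thesis
    unfolding radical_sum_eq[OF t(1)] pair_sum_def using alternating_character_sum[OF \<chi> _ t(2)] by simp
qed

text \<open>The deleted index belongs to the last pair, whose entry becomes 0; dimension and number
  of pairs both drop by one.\<close>

lemma radical_sum_even:
  assumes "2 * r \<le> dim_V" "r \<ge> 1"
  shows "radical_sum s r (2*r) = complex_of_real (F_number CARD('a) (int dim_V - 1) (int s) (int r - 1))"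
proof -
  obtain r' where r: "r = Suc r'" using assms by (cases r) auto
  have t: "2*r \<in> {1..dim_V}" "{1..2*r'} \<subseteq> {1..dim_V} - {2*r}" using assms r by auto
  have "card ({1..dim_V} - {2*r}) = dim_V - 1" using t by simp
  moreover have "int (dim_V - 1) = int dim_V - 1" using assms by simp
  moreover have "int r - 1 = int r'" using r by simp
  moreover have "pair_sum r B = pair_sum r' B" if "B \<in> alternating_of_rank ({1..dim_V} - {2*r}) (2*s)" for B
    using alternating_on_outside[OF alternating_of_rankD[OF that], of "2*r - 1" "2*r"] by (simp add: pair_sum_def r)
  ultimately show ?thesis
    unfolding radical_sum_eq[OF t(1)] using alternating_character_sum[OF \<chi> _ t(2), of s] by (simp add: pair_sum_def)
qed

section \<open>Class sums against a symmetric form in normal form\<close>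

context
  fixes S r t
  assumes S: "has_normal_form S r t" and r: "2 * r \<le> dim_V" and t: "t \<le> dim_V"
begin

text \<open>In the adapted basis the polar products are entries of \<open>B\<close> and the value at
  \<open>v t\<close> is \<open>d t\<close>, so \<chi> splits into a factor for \<open>B\<close> and
  one for the diagonal.\<close>

lemma pairing_sum_expand:
  obtains v where "is_basis scale v"
    "\<And>B d. B \<in> alternating_on {1..dim_V} \<Longrightarrow>
       pairing scale \<chi> u w (form_of v B d) S = \<chi> (pair_sum r B) * \<chi> (\<Sum>i=1..dim_V. d i * index_vec t i)"
proof -
  obtain v where v: "is_basis scale v" and
    pair: "\<forall>\<chi>. \<forall>Q\<in>quadratic_forms scale. pairing scale \<chi> u w Q S =
      \<chi> ((\<Sum>k=1..r. polar Q (v (2*k - 1)) (v (2*k))) + (if t = 0 then 0 else Q (v t)))"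
    using pairing_normal_form[OF S u w] by (elim exE conjE)
  have "pairing scale \<chi> u w (form_of v B d) S = \<chi> (pair_sum r B) * \<chi> (\<Sum>i=1..dim_V. d i * index_vec t i)"
    if B: "B \<in> alternating_on {1..dim_V}" for B d
  proof -
    have "(\<Sum>k=1..r. polar (form_of v B d) (v (2*k - 1)) (v (2*k))) = pair_sum r B"
      unfolding pair_sum_def using r by (intro sum.cong refl polar_form_of_basis[OF v B]) auto
    moreover have "(if t = 0 then 0 else form_of v B d (v t)) = (\<Sum>i=1..dim_V. d i * index_vec t i)"
    proof (cases "t = 0")
      case False
      then have "t \<in> {1..dim_V}" using t by auto
      then show ?thesis using False by (simp add: index_vec_def form_of_basis[OF v] sum_mult_delta)
    qed (simp add: index_vec_def)
    ultimately show ?thesis unfolding pair[rule_format, OF form_of_quadratic[OF v B]] by (simp add: char_add[OF \<chi>])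
  qed
  then show thesis by (rule that[OF v])
qed

lemma index_vec_facts:
  shows "index_vec t \<in> vecs {1..dim_V}" "(index_vec t i)\<^sup>2 = index_vec t i"
    "cross_terms dim_V B (index_vec t) = 0" "index_vec t = (\<lambda>_. 0) \<longleftrightarrow> t = 0"
proof -
  show "index_vec t \<in> vecs {1..dim_V}" using t by (auto simp: index_vec_def vecs_def)
  show "(index_vec t i)\<^sup>2 = index_vec t i" by (simp add: index_vec_def)
  show "cross_terms dim_V B (index_vec t) = 0"
    unfolding cross_terms_def index_vec_def by (intro sum.neutral ballI) auto
  show "index_vec t = (\<lambda>_. 0) \<longleftrightarrow> t = 0" by (auto simp: index_vec_def fun_eq_iff)
qed

lemma radical_sum_distrib:
  "(\<Sum>B\<in>alternating_of_rank {1..dim_V} (2*s). \<chi> (pair_sum r B) *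
     (if index_vec t \<in> matrix_radical {1..dim_V} B then c else 0)) = c * radical_sum s r t"
proof -
  have "(\<Sum>B\<in>alternating_of_rank {1..dim_V} (2*s). \<chi> (pair_sum r B) *
     (if index_vec t \<in> matrix_radical {1..dim_V} B then c else 0)) =
    (\<Sum>B\<in>alternating_of_rank {1..dim_V} (2*s).
      if index_vec t \<in> matrix_radical {1..dim_V} B then c * \<chi> (pair_sum r B) else 0)"
    by (intro sum.cong) auto
  also have "\<dots> = (\<Sum>B\<in>{B \<in> alternating_of_rank {1..dim_V} (2*s). index_vec t \<in> matrix_radical {1..dim_V} B}.
      c * \<chi> (pair_sum r B))"
    by (rule sum.inter_filter[symmetric]) simp
  finally show ?thesis by (simp only: radical_sum_def sum_distrib_left)
qed

lemma restrict_to_rank: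
  fixes h :: "(nat \<Rightarrow> nat \<Rightarrow> 'a) \<Rightarrow> 'c \<Rightarrow> complex"
  assumes "\<And>B d. B \<in> alternating_on {1..dim_V} \<Longrightarrow> d \<in> D B \<Longrightarrow> B \<in> alternating_of_rank {1..dim_V} (2*s)"
  shows "(\<Sum>B\<in>alternating_on {1..dim_V}. \<Sum>d\<in>D B. h B d) =
    (\<Sum>B\<in>alternating_of_rank {1..dim_V} (2*s). \<Sum>d\<in>D B. h B d)"
proof (rule sum.mono_neutral_right)
  show "finite (alternating_on {1..dim_V} :: (nat \<Rightarrow> nat \<Rightarrow> 'a) set)" by (rule finite_alternating_on) simp
  show "alternating_of_rank {1..dim_V} (2*s) \<subseteq> (alternating_on {1..dim_V} :: (nat \<Rightarrow> nat \<Rightarrow> 'a) set)"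
    using alternating_of_rankD by blast
  show "\<forall>B\<in>alternating_on {1..dim_V} - alternating_of_rank {1..dim_V} (2*s). (\<Sum>d\<in>D B. h B d) = 0"
  proof
    fix B :: "nat \<Rightarrow> nat \<Rightarrow> 'a" assume "B \<in> alternating_on {1..dim_V} - alternating_of_rank {1..dim_V} (2*s)"
    then have "D B = {}" using assms by blast
    then show "(\<Sum>d\<in>D B. h B d) = 0" by simp
  qed
qed

text \<open>For fixed \<open>B\<close> the forms of odd rank are given by all diagonals except those
  vanishing on the radical. The sum over all diagonals is 0 unless z = 0, whence the extra term with
  \<open>q^m\<close> for alternating \<open>S\<close>.\<close>

lemma odd_class_sum:
  "(\<Sum>Q\<in>quad_class scale lam (Odd_Idx (int s)). pairing scale \<chi> u w Q S) =
    (if t = 0 then of_nat CARD('a) ^ dim_V * complex_of_real (F_number CARD('a) (int dim_V) (int s) (int r)) else 0) -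
    of_nat CARD('a) ^ (2*s) * radical_sum s r t"
proof -
  obtain v where v: "is_basis scale v" and pair: "\<And>B d. B \<in> alternating_on {1..dim_V} \<Longrightarrow>
       pairing scale \<chi> u w (form_of v B d) S = \<chi> (pair_sum r B) * \<chi> (\<Sum>i=1..dim_V. d i * index_vec t i)"
    using pairing_sum_expand by blast
  let ?V = "vecs {1..dim_V} :: (nat \<Rightarrow> 'a) set"
  let ?R = "alternating_of_rank {1..dim_V} (2*s) :: (nat \<Rightarrow> nat \<Rightarrow> 'a) set"
  let ?e = "\<lambda>d. \<chi> (\<Sum>i=1..dim_V. d i * index_vec t i)"
  have rank: "quad_rank scale (form_of v B d) = 2*s + 1 \<longleftrightarrow> B \<in> ?R \<and> \<not> vanishes_on_radical dim_V B d"
    if "B \<in> alternating_on {1..dim_V}" for B d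
    by (rule quad_rank_form_of(2)[OF v that])
  have "quad_class scale lam (Odd_Idx (int s)) = {Q \<in> quadratic_forms scale. quad_rank scale Q = 2*s + 1}" by auto
  then have "(\<Sum>Q\<in>quad_class scale lam (Odd_Idx (int s)). pairing scale \<chi> u w Q S) =
    (\<Sum>B\<in>alternating_on {1..dim_V}. \<Sum>d\<in>{d \<in> ?V. quad_rank scale (form_of v B d) = 2*s + 1}.
       pairing scale \<chi> u w (form_of v B d) S)"
    by (simp only: sum_over_quadratic_forms[OF v])
  also have "\<dots> = (\<Sum>B\<in>?R. \<Sum>d\<in>{d \<in> ?V. quad_rank scale (form_of v B d) = 2*s + 1}.
       pairing scale \<chi> u w (form_of v B d) S)"
    by (rule restrict_to_rank) (use rank in blast)
  also have "\<dots> = (\<Sum>B\<in>?R. \<chi> (pair_sum r B) *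
      ((if t = 0 then of_nat CARD('a) ^ dim_V else 0) -
       (if index_vec t \<in> matrix_radical {1..dim_V} B then of_nat CARD('a) ^ (2*s) else 0)))"
  proof (intro sum.cong refl)
    fix B assume B: "B \<in> ?R"
    note Ba = alternating_of_rankD[OF B]
    have "(\<Sum>d\<in>{d \<in> ?V. quad_rank scale (form_of v B d) = 2*s + 1}. pairing scale \<chi> u w (form_of v B d) S) =
      \<chi> (pair_sum r B) * (\<Sum>d\<in>{d \<in> ?V. \<not> vanishes_on_radical dim_V B d}. ?e d)"
      unfolding sum_distrib_left rank[OF Ba] by (intro sum.cong) (use B in \<open>auto simp: pair[OF Ba]\<close>)
    also have "(\<Sum>d\<in>{d \<in> ?V. \<not> vanishes_on_radical dim_V B d}. ?e d) =
      (\<Sum>d\<in>?V. ?e d) - (\<Sum>d\<in>{d \<in> ?V. vanishes_on_radical dim_V B d}. ?e d)"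
    proof -
      have "{d \<in> ?V. \<not> vanishes_on_radical dim_V B d} = ?V - {d \<in> ?V. vanishes_on_radical dim_V B d}" by blast
      then show ?thesis by (simp add: sum_diff)
    qed
    also have "\<dots> = (if t = 0 then of_nat CARD('a) ^ dim_V else 0) -
       (if index_vec t \<in> matrix_radical {1..dim_V} B then of_nat CARD('a) ^ (2*s) else 0)"
      unfolding sum_all_diagonals[OF even_card \<chi> index_vec_facts(1,2)]
        sum_vanishing_diagonals[OF even_card \<chi> index_vec_facts(1,2) B index_vec_facts(3)] index_vec_facts(4) ..
    finally show "(\<Sum>d\<in>{d \<in> ?V. quad_rank scale (form_of v B d) = 2*s + 1}. pairing scale \<chi> u w (form_of v B d) S) =
      \<chi> (pair_sum r B) * ((if t = 0 then of_nat CARD('a) ^ dim_V else 0) -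
       (if index_vec t \<in> matrix_radical {1..dim_V} B then of_nat CARD('a) ^ (2*s) else 0))" .
  qed
  also have "\<dots> = (if t = 0 then of_nat CARD('a) ^ dim_V else 0) * (\<Sum>B\<in>?R. \<chi> (pair_sum r B)) -
      of_nat CARD('a) ^ (2*s) * radical_sum s r t"
    unfolding right_diff_distrib sum_subtractf radical_sum_distrib sum_distrib_left by (simp add: mult.commute)
  finally show ?thesis unfolding sum_pair_sum[OF r] by simp
qed

text \<open>Doubling replaces the indicator of type \<tau> by a constant plus \<tau> times the
  normalized Gauss sum. The constant part yields \<open>radical_sum\<close>, the Gauss part the full
  character sum in dimension m.\<close>

lemma even_class_sum:
  assumes s: "s \<ge> 1" and \<tau>: "\<tau> \<in> {1, -1}"
  shows "2 * (\<Sum>Q\<in>quad_class scale lam (Even_Idx (int s) \<tau>). pairing scale \<chi> u w Q S) =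
    of_nat CARD('a) ^ (2*s) * radical_sum s r t +
    of_int \<tau> * of_nat CARD('a) ^ s * complex_of_real (F_number CARD('a) (int dim_V) (int s) (int r))"
proof -
  obtain v where v: "is_basis scale v" and pair: "\<And>B d. B \<in> alternating_on {1..dim_V} \<Longrightarrow>
       pairing scale \<chi> u w (form_of v B d) S = \<chi> (pair_sum r B) * \<chi> (\<Sum>i=1..dim_V. d i * index_vec t i)"
    using pairing_sum_expand by blast
  let ?V = "vecs {1..dim_V} :: (nat \<Rightarrow> 'a) set"
  let ?R = "alternating_of_rank {1..dim_V} (2*s) :: (nat \<Rightarrow> nat \<Rightarrow> 'a) set"
  let ?e = "\<lambda>d. \<chi> (\<Sum>i=1..dim_V. d i * index_vec t i)"
  let ?qm = "of_nat CARD('a) ^ dim_V :: complex"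
  let ?cond = "\<lambda>B d. quad_rank scale (form_of v B d) = 2*s \<and> quad_has_type scale lam (form_of v B d) \<tau>"
  have rank: "quad_rank scale (form_of v B d) = 2*s \<longleftrightarrow> B \<in> ?R \<and> vanishes_on_radical dim_V B d"
    if "B \<in> alternating_on {1..dim_V}" for B d
    by (rule quad_rank_form_of(1)[OF v that])
  have "quad_class scale lam (Even_Idx (int s) \<tau>) =
      {Q \<in> quadratic_forms scale. quad_rank scale Q = 2*s \<and> quad_has_type scale lam Q \<tau>}" by auto
  then have "(\<Sum>Q\<in>quad_class scale lam (Even_Idx (int s) \<tau>). pairing scale \<chi> u w Q S) =
    (\<Sum>B\<in>alternating_on {1..dim_V}. \<Sum>d\<in>{d \<in> ?V. ?cond B d}. pairing scale \<chi> u w (form_of v B d) S)"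
    by (simp only: sum_over_quadratic_forms[OF v])
  also have "\<dots> = (\<Sum>B\<in>?R. \<Sum>d\<in>{d \<in> ?V. ?cond B d}. pairing scale \<chi> u w (form_of v B d) S)"
    by (rule restrict_to_rank) (use rank in blast)
  finally have "2 * (\<Sum>Q\<in>quad_class scale lam (Even_Idx (int s) \<tau>). pairing scale \<chi> u w Q S) =
    (\<Sum>B\<in>?R. 2 * (\<Sum>d\<in>{d \<in> ?V. ?cond B d}. pairing scale \<chi> u w (form_of v B d) S))"
    by (simp only: sum_distrib_left)
  also have "\<dots> = (\<Sum>B\<in>?R. \<chi> (pair_sum r B) *
       (if index_vec t \<in> matrix_radical {1..dim_V} B then of_nat CARD('a) ^ (2*s) else 0) +
       of_int \<tau> * of_nat CARD('a) ^ s * \<chi> (pair_sum r B))"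
  proof (intro sum.cong refl)
    fix B assume B: "B \<in> ?R"
    note Ba = alternating_of_rankD[OF B]
    let ?E = "if index_vec t \<in> matrix_radical {1..dim_V} B then of_nat CARD('a) ^ (2*s) else 0 :: complex"
    let ?G = "\<lambda>d. gauss_sum \<chi> dim_V B d"
    \<comment> \<open>Diagonals that do not vanish on the radical have Gauss sum 0, so the sum may
      be extended to all diagonals.\<close>
    have G: "(\<Sum>d\<in>{d \<in> ?V. vanishes_on_radical dim_V B d}. ?G d * ?e d) = ?qm"
    proof -
      have "(\<Sum>d\<in>{d \<in> ?V. vanishes_on_radical dim_V B d}. ?G d * ?e d) = (\<Sum>d\<in>?V. ?G d * ?e d)"
        by (rule sum.mono_neutral_left) (auto simp: gauss_sum_eq_0[OF even_card \<chi> Ba])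
      then show ?thesis using sum_gauss_sum[OF even_card \<chi> index_vec_facts(1,2,3)] by simp
    qed
    \<comment> \<open>The factor \<open>?qm\<close> clears the denominator in the indicator of the
      type; it is cancelled on the way to \<open>E\<close>.\<close>
    have "(2 * (\<Sum>d\<in>{d \<in> ?V. ?cond B d}. ?e d)) * ?qm =
      (\<Sum>d\<in>{d \<in> ?V. vanishes_on_radical dim_V B d}.
        (if quad_has_type scale lam (form_of v B d) \<tau> then 2 else 0) * ?qm * ?e d)"
    proof -
      have "{d \<in> ?V. ?cond B d} = {d \<in> {d \<in> ?V. vanishes_on_radical dim_V B d}. quad_has_type scale lam (form_of v B d) \<tau>}"
        using rank[OF Ba] B by blast
      then have "(\<Sum>d\<in>{d \<in> ?V. ?cond B d}. 2 * ?qm * ?e d) =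
        (\<Sum>d\<in>{d \<in> {d \<in> ?V. vanishes_on_radical dim_V B d}. quad_has_type scale lam (form_of v B d) \<tau>}. 2 * ?qm * ?e d)"
        by (simp only:)
      also have "\<dots> =
        (\<Sum>d\<in>{d \<in> ?V. vanishes_on_radical dim_V B d}. if quad_has_type scale lam (form_of v B d) \<tau> then 2 * ?qm * ?e d else 0)"
        by (rule sum.inter_filter) simp
      also have "\<dots> = (\<Sum>d\<in>{d \<in> ?V. vanishes_on_radical dim_V B d}.
        (if quad_has_type scale lam (form_of v B d) \<tau> then 2 else 0) * ?qm * ?e d)"
        by (intro sum.cong) auto
      finally show ?thesis by (simp only: sum_distrib_left sum_distrib_right mult_ac)
    qed
    also have "\<dots> = (\<Sum>d\<in>{d \<in> ?V. vanishes_on_radical dim_V B d}.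
        ?qm * ?e d + of_int \<tau> * of_nat CARD('a) ^ s * (?G d * ?e d))"
    proof (intro sum.cong refl)
      fix d assume "d \<in> {d \<in> ?V. vanishes_on_radical dim_V B d}"
      then have "quad_rank scale (form_of v B d) = 2 * s" using rank[OF Ba] B by blast
      note eq = quad_type_iff_gauss_sum[OF lam \<chi> v Ba this s \<tau>]
      show "(if quad_has_type scale lam (form_of v B d) \<tau> then 2 else 0) * ?qm * ?e d =
        ?qm * ?e d + of_int \<tau> * of_nat CARD('a) ^ s * (?G d * ?e d)"
        unfolding eq by (simp only: distrib_left distrib_right mult_ac)
    qed
    also have "\<dots> = ?qm * ?E + of_int \<tau> * of_nat CARD('a) ^ s * ?qm"
      unfolding sum.distrib sum_distrib_left[symmetric] G
        sum_vanishing_diagonals[OF even_card \<chi> index_vec_facts(1,2) B index_vec_facts(3)] ..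
    also have "\<dots> = (?E + of_int \<tau> * of_nat CARD('a) ^ s) * ?qm"
      by (simp only: distrib_left distrib_right mult_ac)
    finally have "(2 * (\<Sum>d\<in>{d \<in> ?V. ?cond B d}. ?e d)) * ?qm = (?E + of_int \<tau> * of_nat CARD('a) ^ s) * ?qm" .
    then have E: "2 * (\<Sum>d\<in>{d \<in> ?V. ?cond B d}. ?e d) = ?E + of_int \<tau> * of_nat CARD('a) ^ s"
      by (subst (asm) mult_cancel_right) simp
    have "2 * (\<Sum>d\<in>{d \<in> ?V. ?cond B d}. pairing scale \<chi> u w (form_of v B d) S) =
      \<chi> (pair_sum r B) * (2 * (\<Sum>d\<in>{d \<in> ?V. ?cond B d}. ?e d))"
      unfolding pair[OF Ba] sum_distrib_left[symmetric] by (simp only: mult_ac)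
    also have "\<dots> = \<chi> (pair_sum r B) * ?E + of_int \<tau> * of_nat CARD('a) ^ s * \<chi> (pair_sum r B)"
      unfolding E by (simp only: distrib_left mult_ac)
    finally show "2 * (\<Sum>d\<in>{d \<in> ?V. ?cond B d}. pairing scale \<chi> u w (form_of v B d) S) =
      \<chi> (pair_sum r B) * ?E + of_int \<tau> * of_nat CARD('a) ^ s * \<chi> (pair_sum r B)" .
  qed
  also have "\<dots> = of_nat CARD('a) ^ (2*s) * radical_sum s r t +
      of_int \<tau> * of_nat CARD('a) ^ s * (\<Sum>B\<in>?R. \<chi> (pair_sum r B))"
    unfolding sum.distrib radical_sum_distrib sum_distrib_left[symmetric] ..
  finally show ?thesis unfolding sum_pair_sum[OF r] .
qed

end

section \<open>Evaluation on the classes of symmetric forms\<close>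

lemma odd_class_normal_form:
  assumes "S \<in> sym_class scale (Odd_Idx r)" "r \<ge> 0"
  shows "has_normal_form S (nat r) (2 * nat r + 1)" "2 * nat r + 1 \<le> dim_V"
proof -
  have S: "S \<in> symmetric_bilinear_forms scale" "sym_rank scale S = 2 * nat r + 1" using assms by auto
  show "has_normal_form S (nat r) (2 * nat r + 1)" by (rule sym_odd_normal_form[OF S])
  show "2 * nat r + 1 \<le> dim_V" using sym_rank_le[of S] S by simp
qed

lemma even_class_normal_form:
  assumes "S \<in> sym_class scale (Even_Idx r \<tau>)" "r \<ge> 0"
  shows "\<tau> = 1 \<and> has_normal_form S (nat r) 0 \<or> \<tau> = -1 \<and> nat r \<ge> 1 \<and> has_normal_form S (nat r) (2 * nat r)"
    "2 * nat r \<le> dim_V"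
proof -
  have S: "sym_has_type scale S \<tau>" "sym_rank scale S = 2 * nat r" using assms by auto
  show "\<tau> = 1 \<and> has_normal_form S (nat r) 0 \<or> \<tau> = -1 \<and> nat r \<ge> 1 \<and> has_normal_form S (nat r) (2 * nat r)"
    by (rule sym_type_normal_form[OF S])
  show "2 * nat r \<le> dim_V" using sym_rank_le[of S] S by simp
qed

lemma sym_class_normal_form:
  assumes "S \<in> sym_class scale k"
  obtains r t where "has_normal_form S r t"
proof (cases k)
  case (Odd_Idx r)
  then have "r \<ge> 0" using assms by auto
  then show thesis using odd_class_normal_form(1)[of S r] assms Odd_Idx that by blast
next
  case (Even_Idx r \<tau>)
  then have "r \<ge> 0" using assms by auto
  then show thesis using even_class_normal_form(1)[of S r \<tau>] assms Even_Idx that by blast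
qed

lemma zero_form_in_quadratic_forms: "(\<lambda>_. 0) \<in> quadratic_forms scale"
proof -
  have "polar (\<lambda>_ :: 'b. 0 :: 'a) = (\<lambda>_ _. 0)" by (simp add: polar_def fun_eq_iff)
  moreover have "(\<lambda>_ _. 0) \<in> symmetric_bilinear_forms scale" by (rule symmetric_bilinearI) auto
  ultimately show ?thesis by (simp add: quadratic_forms_def)
qed

lemma quad_class_zero: "quad_class scale lam (Even_Idx 0 1) = {\<lambda>_. 0}"
proof -
  have "quad_has_type scale lam (\<lambda>_. 0) 1" by (simp add: quad_has_type_def)
  moreover have "Q = (\<lambda>_. 0)" if "quad_has_type scale lam Q 1" "quad_rank scale Q = 0" for Q
    using that unfolding quad_has_type_def by auto
  moreover have "quad_class scale lam (Even_Idx 0 1) =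
      {Q \<in> quadratic_forms scale. quad_rank scale Q = 0 \<and> quad_has_type scale lam Q 1}" by simp
  ultimately show ?thesis using quad_rank_0 zero_form_in_quadratic_forms by blast
qed

lemma sym_class_zero: "sym_class scale (Even_Idx 0 1) = {\<lambda>_ _. 0}"
proof -
  have "(\<lambda>_ _. 0) \<in> symmetric_bilinear_forms scale" by (rule symmetric_bilinearI) auto
  moreover have "sym_has_type scale (\<lambda>_ _. 0) 1" by (simp add: sym_has_type_def)
  moreover have "S = (\<lambda>_ _. 0)" if "sym_has_type scale S 1" "sym_rank scale S = 0" for S
    using that unfolding sym_has_type_def by auto
  moreover have "sym_class scale (Even_Idx 0 1) =
      {S \<in> symmetric_bilinear_forms scale. sym_rank scale S = 0 \<and> sym_has_type scale S 1}" by simp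
  ultimately show ?thesis using sym_rank_0 by blast
qed

text \<open>The chosen \<open>coefficient_matrix\<close> of the zero form is only known to be
  alternating, so the pairing is evaluated through \<open>pairing_normal_form\<close> rather than
  from the matrix.\<close>

lemma P_zero_row:
  assumes "sym_class scale k \<noteq> {}"
  shows "P (Even_Idx 0 1) k = 1"
proof (rule P_numberI[OF assms])
  fix S assume "S \<in> sym_class scale k"
  then obtain r t where nf: "has_normal_form S r t" by (rule sym_class_normal_form)
  obtain v where pair: "\<forall>\<chi>. \<forall>Q\<in>quadratic_forms scale. pairing scale \<chi> u w Q S =
      \<chi> ((\<Sum>k=1..r. polar Q (v (2*k - 1)) (v (2*k))) + (if t = 0 then 0 else Q (v t)))"
    using pairing_normal_form[OF nf u w] by (elim exE conjE)
  show "(\<Sum>Q\<in>quad_class scale lam (Even_Idx 0 1). pairing scale \<chi> u w Q S) = 1"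
    unfolding quad_class_zero using pair[rule_format, OF zero_form_in_quadratic_forms, of \<chi>]
    by (simp add: polar_def char_0[OF \<chi>])
qed

lemma P_zero_column: "P i (Even_Idx 0 1) = of_nat (card (quad_class scale lam i))"
proof (rule P_numberI)
  fix S assume "S \<in> sym_class scale (Even_Idx 0 1)"
  then have "S = (\<lambda>_ _. 0)" unfolding sym_class_zero by simp
  then have "pairing scale \<chi> u w Q S = 1" for Q by (simp add: pairing_def char_0[OF \<chi>])
  then show "(\<Sum>Q\<in>quad_class scale lam i. pairing scale \<chi> u w Q S) = of_nat (card (quad_class scale lam i))"
    by simp
qed (simp add: sym_class_zero del: sym_class.simps)

lemma P_odd_odd:
  assumes "r \<ge> 0" "s \<ge> 0" "sym_class scale (Odd_Idx r) \<noteq> {}"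
  shows "P (Odd_Idx s) (Odd_Idx r) =
    complex_of_real (- (real CARD('a) powi (2*s)) * F_number CARD('a) (int dim_V - 1) s r)"
proof (rule P_numberI[OF assms(3)])
  fix S assume S: "S \<in> sym_class scale (Odd_Idx r)"
  note nf = odd_class_normal_form[OF S assms(1)]
  note nat = nat_0_le[OF assms(1)] nat_0_le[OF assms(2)]
  have r: "2 * nat r \<le> dim_V" using nf(2) by simp
  show "(\<Sum>Q\<in>quad_class scale lam (Odd_Idx s). pairing scale \<chi> u w Q S) =
    complex_of_real (- (real CARD('a) powi (2*s)) * F_number CARD('a) (int dim_V - 1) s r)"
    unfolding odd_class_sum[OF nf(1) r nf(2), of "nat s", unfolded radical_sum_odd[OF nf(2)] nat]
      powi_nat[OF assms(2)] by simp
qed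

lemma P_even_odd:
  assumes "r \<ge> 0" "s \<ge> 1" "\<tau> \<in> {1, -1}" "sym_class scale (Odd_Idx r) \<noteq> {}"
  shows "2 * P (Even_Idx s \<tau>) (Odd_Idx r) = complex_of_real
    (real CARD('a) powi (2*s) * F_number CARD('a) (int dim_V - 1) s r +
     real_of_int \<tau> * real CARD('a) powi s * F_number CARD('a) (int dim_V) s r)"
proof (rule twice_P_numberI[OF assms(4)])
  fix S assume S: "S \<in> sym_class scale (Odd_Idx r)"
  have s: "s \<ge> 0" "nat s \<ge> 1" using assms by auto
  note nf = odd_class_normal_form[OF S assms(1)]
  note nat = nat_0_le[OF assms(1)] nat_0_le[OF s(1)]
  have r: "2 * nat r \<le> dim_V" using nf(2) by simp
  show "2 * (\<Sum>Q\<in>quad_class scale lam (Even_Idx s \<tau>). pairing scale \<chi> u w Q S) = complex_of_real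
    (real CARD('a) powi (2*s) * F_number CARD('a) (int dim_V - 1) s r +
     real_of_int \<tau> * real CARD('a) powi s * F_number CARD('a) (int dim_V) s r)"
    unfolding even_class_sum[OF nf(1) r nf(2) s(2) assms(3), unfolded radical_sum_odd[OF nf(2)] nat]
      powi_nat[OF s(1)] by simp
qed

text \<open>For z = 0 both character sums are F in dimension m, so the two terms combine into a
  product.\<close>

lemma P_even_alternating:
  assumes "r \<ge> 1" "s \<ge> 1" "\<tau> \<in> {1, -1}" "sym_class scale (Even_Idx r 1) \<noteq> {}"
  shows "2 * P (Even_Idx s \<tau>) (Even_Idx r 1) = complex_of_real
    (real CARD('a) powi s * (real CARD('a) powi s + real_of_int \<tau>) * F_number CARD('a) (int dim_V) s r)"
proof (rule twice_P_numberI[OF assms(4)])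
  fix S assume S: "S \<in> sym_class scale (Even_Idx r 1)"
  have rs: "r \<ge> 0" "s \<ge> 0" "nat s \<ge> 1" using assms by auto
  note nat = nat_0_le[OF rs(1)] nat_0_le[OF rs(2)]
  have nf: "has_normal_form S (nat r) 0" "2 * nat r \<le> dim_V"
    using even_class_normal_form[OF S rs(1)] by auto
  show "2 * (\<Sum>Q\<in>quad_class scale lam (Even_Idx s \<tau>). pairing scale \<chi> u w Q S) = complex_of_real
    (real CARD('a) powi s * (real CARD('a) powi s + real_of_int \<tau>) * F_number CARD('a) (int dim_V) s r)"
    unfolding even_class_sum[OF nf le0 rs(3) assms(3), unfolded radical_sum_0[OF nf(2)] nat]
      powi_nat[OF rs(2)] by (simp add: distrib_left distrib_right mult_2 mult_2_right power_add mult_ac)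
qed

lemma P_even_nonalternating:
  assumes "r \<ge> 1" "s \<ge> 1" "\<tau> \<in> {1, -1}" "sym_class scale (Even_Idx r (-1)) \<noteq> {}"
  shows "2 * P (Even_Idx s \<tau>) (Even_Idx r (-1)) = complex_of_real
    (real CARD('a) powi (2*s) * F_number CARD('a) (int dim_V - 1) s (r - 1) +
     real_of_int \<tau> * real CARD('a) powi s * F_number CARD('a) (int dim_V) s r)"
proof (rule twice_P_numberI[OF assms(4)])
  fix S assume S: "S \<in> sym_class scale (Even_Idx r (-1))"
  have rs: "r \<ge> 0" "s \<ge> 0" "nat s \<ge> 1" using assms by auto
  note nat = nat_0_le[OF rs(1)] nat_0_le[OF rs(2)]
  have nf: "has_normal_form S (nat r) (2 * nat r)" "2 * nat r \<le> dim_V" "nat r \<ge> 1"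
    using even_class_normal_form[OF S rs(1)] by auto
  show "2 * (\<Sum>Q\<in>quad_class scale lam (Even_Idx s \<tau>). pairing scale \<chi> u w Q S) = complex_of_real
    (real CARD('a) powi (2*s) * F_number CARD('a) (int dim_V - 1) s (r - 1) +
     real_of_int \<tau> * real CARD('a) powi s * F_number CARD('a) (int dim_V) s r)"
    unfolding even_class_sum[OF nf(1,2,2) rs(3) assms(3), unfolded radical_sum_even[OF nf(2,3)] nat]
      powi_nat[OF rs(2)] by simp
qed

lemma P_odd_alternating:
  assumes "r \<ge> 1" "s \<ge> 0" "sym_class scale (Even_Idx r 1) \<noteq> {}"
  shows "P (Odd_Idx s) (Even_Idx r 1) = complex_of_real
    ((real CARD('a) ^ dim_V - real CARD('a) powi (2*s)) * F_number CARD('a) (int dim_V) s r)"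
proof (rule P_numberI[OF assms(3)])
  fix S assume S: "S \<in> sym_class scale (Even_Idx r 1)"
  have r: "r \<ge> 0" using assms by auto
  note nat = nat_0_le[OF r] nat_0_le[OF assms(2)]
  have nf: "has_normal_form S (nat r) 0" "2 * nat r \<le> dim_V"
    using even_class_normal_form[OF S r] by auto
  show "(\<Sum>Q\<in>quad_class scale lam (Odd_Idx s). pairing scale \<chi> u w Q S) = complex_of_real
    ((real CARD('a) ^ dim_V - real CARD('a) powi (2*s)) * F_number CARD('a) (int dim_V) s r)"
    unfolding odd_class_sum[OF nf le0, of "nat s", unfolded radical_sum_0[OF nf(2)] nat]
      powi_nat[OF assms(2)] by (simp add: left_diff_distrib)
qed

lemma P_odd_nonalternating:
  assumes "r \<ge> 1" "s \<ge> 0" "sym_class scale (Even_Idx r (-1)) \<noteq> {}"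
  shows "P (Odd_Idx s) (Even_Idx r (-1)) = complex_of_real
    (- (real CARD('a) powi (2*s)) * F_number CARD('a) (int dim_V - 1) s (r - 1))"
proof (rule P_numberI[OF assms(3)])
  fix S assume S: "S \<in> sym_class scale (Even_Idx r (-1))"
  have r: "r \<ge> 0" using assms by auto
  note nat = nat_0_le[OF r] nat_0_le[OF assms(2)]
  have nf: "has_normal_form S (nat r) (2 * nat r)" "2 * nat r \<le> dim_V" "nat r \<ge> 1"
    using even_class_normal_form[OF S r] by auto
  \<comment> \<open>For type -1 the vector z is not zero, so the term with \<open>q^m\<close> in
    \<open>odd_class_sum\<close> is absent.\<close>
  have t: "2 * nat r \<noteq> 0" using nf(3) by auto
  show "(\<Sum>Q\<in>quad_class scale lam (Odd_Idx s). pairing scale \<chi> u w Q S) = complex_of_real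
    (- (real CARD('a) powi (2*s)) * F_number CARD('a) (int dim_V - 1) s (r - 1))"
    unfolding odd_class_sum[OF nf(1,2,2), of "nat s", unfolded radical_sum_even[OF nf(2,3)] nat]
      powi_nat[OF assms(2)] using t by simp
qed

end

theorem theorem3p2:
  fixes scale :: "'a::finite_field \<Rightarrow> 'v::ab_group_add \<Rightarrow> 'v"
    and q m :: nat
    and lam :: 'a
    and \<chi> :: "'a \<Rightarrow> complex"
    and u w :: "nat \<Rightarrow> 'v"
  defines "P \<equiv> P_number scale lam \<chi> u w"
    and "F \<equiv> F_number q"
  assumes "CARD('a) = q" and "even q"
    and "vector_space scale" and "vdim scale = m" and "m \<ge> 1"
    and "absolute_trace lam = 1"
    and "nontrivial_additive_character \<chi>"
    and "is_basis scale u" and "is_basis scale w"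
  shows "(\<forall>k\<in>form_indices. sym_class scale k \<noteq> {} \<longrightarrow> P (Even_Idx 0 1) k = 1) \<and>
    (\<forall>i\<in>form_indices. P i (Even_Idx 0 1) = of_nat (card (quad_class scale lam i))) \<and>
    (\<forall>r s. r \<ge> 0 \<and> s \<ge> 0 \<and> sym_class scale (Odd_Idx r) \<noteq> {} \<longrightarrow>
       P (Odd_Idx s) (Odd_Idx r) = complex_of_real (- (real q powi (2*s)) * F (int m - 1) s r)) \<and>
    (\<forall>r s. \<forall>\<tau>\<in>{1, -1}. r \<ge> 0 \<and> s \<ge> 1 \<and> sym_class scale (Odd_Idx r) \<noteq> {} \<longrightarrow>
       2 * P (Even_Idx s \<tau>) (Odd_Idx r) = complex_of_real
         (real q powi (2*s) * F (int m - 1) s r + real_of_int \<tau> * real q powi s * F (int m) s r)) \<and>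
    (\<forall>r s. \<forall>\<tau>\<in>{1, -1}. r \<ge> 1 \<and> s \<ge> 1 \<and> sym_class scale (Even_Idx r 1) \<noteq> {} \<longrightarrow>
       2 * P (Even_Idx s \<tau>) (Even_Idx r 1) = complex_of_real
         (real q powi s * (real q powi s + real_of_int \<tau>) * F (int m) s r)) \<and>
    (\<forall>r s. \<forall>\<tau>\<in>{1, -1}. r \<ge> 1 \<and> s \<ge> 1 \<and> sym_class scale (Even_Idx r (-1)) \<noteq> {} \<longrightarrow>
       2 * P (Even_Idx s \<tau>) (Even_Idx r (-1)) = complex_of_real
         (real q powi (2*s) * F (int m - 1) s (r - 1) +
          real_of_int \<tau> * real q powi s * F (int m) s r)) \<and>
    (\<forall>r s. r \<ge> 1 \<and> s \<ge> 0 \<and> sym_class scale (Even_Idx r 1) \<noteq> {} \<longrightarrow>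
       P (Odd_Idx s) (Even_Idx r 1) = complex_of_real
         ((real q ^ m - real q powi (2*s)) * F (int m) s r)) \<and>
    (\<forall>r s. r \<ge> 1 \<and> s \<ge> 0 \<and> sym_class scale (Even_Idx r (-1)) \<noteq> {} \<longrightarrow>
       P (Odd_Idx s) (Even_Idx r (-1)) = complex_of_real
         (- (real q powi (2*s)) * F (int m - 1) s (r - 1)))"
proof -
  interpret vector_space scale by fact
  interpret character_form_space scale lam \<chi> u w
    by unfold_locales (use assms in auto)
  have qm: "q = CARD('a)" "m = vdim scale" using assms(3,6) by auto
  show ?thesis unfolding P_def F_def qm
    by (intro conjI allI ballI impI; (elim conjE)?)
      (rule P_zero_row P_zero_column P_odd_odd P_even_odd P_even_alternating P_even_nonalternating
        P_odd_alternating P_odd_nonalternating; assumption)+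
qed

end
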